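(* Let $a:[0,1]\to[0,\infty)$ be continuous and suppose there is a point $x_0\in\{0,1\}$ such that $a(x_0)=0$ and $a>0$ on $[0,1]\setminus\{x_0\}$. Let $A$ be the operator on $L^2_{\frac1a}(0,1)$ defined by $$Au:=a u'''',\qquad D(A):=\left\{u\in H^2_{\frac1a}(0,1):\ a u''''\in L^2_{\frac1a}(0,1)\right\}.$$ Then $(A,D(A))$ is self-adjoint and non negative on $L^2_{\frac1a}(0,1)$. Hence $-A$ generates a contractive analytic semigroup of angle $\frac{\pi}{2}$ on $L^2_{\frac1a}(0,1)$.
   Context: Functions are real valued. $L^2_{\frac1a}(0,1):=\{u\in L^2(0,1): \int_0^1 \frac{u^2}{a}\,dx<+\infty\}$, a Hilbert space with inner product $\langle u,v\rangle_{L^2_{1/a}(0,1)}=\int_0^1\frac{uv}{a}\,dx$. $H^2_0(0,1):=\{u\in H^2(0,1): u(j)=u'(j)=0,\ j=0,1\}$ and $H^2_{\frac1a}(0,1):=L^2_{\frac1a}(0,1)\cap H^2_0(0,1)$. Derivatives are in the sense of distributions on $(0,1)$; the condition $au''''\in L^2_{\frac1a}(0,1)$ means that $u''''$ is a (locally integrable) function on $(0,1)$ and $au''''\in L^2_{\frac1a}(0,1)$. Non negative means $\langle Au,u\rangle\ge 0$ for all $u\in D(A)$. A contractive analytic semigroup of angle $\frac\pi2$ is a strongly continuous semigroup of contractions that (on the complexified space) extends to an analytic semigroup on the open right half-plane. *)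

theory Defs
  imports "HOL-Analysis.Analysis"
begin

section \<open>Operators and semigroups on a real Hilbert space\<close>

text \<open>
  The Hilbert space is given by a carrier \<open>H\<close> inside an ambient real vector space together with an
  inner product \<open>ip\<close> on \<open>H\<close>, because the space \<open>L\<^sup>2\<^sub>1\<^sub>/\<^sub>a(0,1)\<close> and its inner product depend on
  the weight \<open>a\<close>. All limits, bounds and density statements refer to the norm induced by \<open>ip\<close>.
\<close>

definition ipnorm :: "('v \<Rightarrow> 'v \<Rightarrow> real) \<Rightarrow> 'v \<Rightarrow> real" where
  "ipnorm ip x = sqrt (ip x x)"

definition linear_op ::
    "'v::real_vector set \<Rightarrow> 'v set \<Rightarrow> ('v \<Rightarrow> 'v) \<Rightarrow> bool" where
  "linear_op H D A \<longleftrightarrow> subspace D \<and> D \<subseteq> H \<and> A ` D \<subseteq> H \<and>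
     (\<forall>u\<in>D. \<forall>v\<in>D. A (u + v) = A u + A v) \<and> (\<forall>c. \<forall>u\<in>D. A (c *\<^sub>R u) = c *\<^sub>R A u)"

definition densely_defined ::
    "'v::real_vector set \<Rightarrow> ('v \<Rightarrow> 'v \<Rightarrow> real) \<Rightarrow> 'v set \<Rightarrow> bool" where
  "densely_defined H ip D \<longleftrightarrow> (\<forall>x\<in>H. \<forall>e>0. \<exists>u\<in>D. ipnorm ip (x - u) < e)"

definition adjoint_graph ::
    "'v set \<Rightarrow> ('v \<Rightarrow> 'v \<Rightarrow> real) \<Rightarrow> 'v set \<Rightarrow> ('v \<Rightarrow> 'v) \<Rightarrow> ('v \<times> 'v) set" where
  "adjoint_graph H ip D A = {(v, w). v \<in> H \<and> w \<in> H \<and> (\<forall>u\<in>D. ip (A u) v = ip u w)}"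

definition self_adjoint_op ::
    "'v::real_vector set \<Rightarrow> ('v \<Rightarrow> 'v \<Rightarrow> real) \<Rightarrow> 'v set \<Rightarrow> ('v \<Rightarrow> 'v) \<Rightarrow> bool" where
  "self_adjoint_op H ip D A \<longleftrightarrow> linear_op H D A \<and> densely_defined H ip D \<and>
     adjoint_graph H ip D A = {(u, A u) | u. u \<in> D}"

definition nonneg_op ::
    "('v \<Rightarrow> 'v \<Rightarrow> real) \<Rightarrow> 'v set \<Rightarrow> ('v \<Rightarrow> 'v) \<Rightarrow> bool" where
  "nonneg_op ip D A \<longleftrightarrow> (\<forall>u\<in>D. ip (A u) u \<ge> 0)"

definition bounded_op ::
    "'v::real_vector set \<Rightarrow> ('v \<Rightarrow> 'v \<Rightarrow> real) \<Rightarrow> ('v \<Rightarrow> 'v) \<Rightarrow> bool" where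
  "bounded_op H ip F \<longleftrightarrow> linear_op H H F \<and> (\<exists>C. \<forall>x\<in>H. ipnorm ip (F x) \<le> C * ipnorm ip x)"

definition C0_semigroup ::
    "'v::real_vector set \<Rightarrow> ('v \<Rightarrow> 'v \<Rightarrow> real) \<Rightarrow> (real \<Rightarrow> 'v \<Rightarrow> 'v) \<Rightarrow> bool" where
  "C0_semigroup H ip T \<longleftrightarrow>
     (\<forall>t\<ge>0. bounded_op H ip (T t)) \<and>
     (\<forall>x\<in>H. T 0 x = x) \<and>
     (\<forall>s\<ge>0. \<forall>t\<ge>0. \<forall>x\<in>H. T (s + t) x = T s (T t x)) \<and>
     (\<forall>x\<in>H. ((\<lambda>t. ipnorm ip (T t x - x)) \<longlongrightarrow> 0) (at_right 0))"

definition contractive ::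
    "'v set \<Rightarrow> ('v \<Rightarrow> 'v \<Rightarrow> real) \<Rightarrow> (real \<Rightarrow> 'v \<Rightarrow> 'v) \<Rightarrow> bool" where
  "contractive H ip T \<longleftrightarrow> (\<forall>t\<ge>0. \<forall>x\<in>H. ipnorm ip (T t x) \<le> ipnorm ip x)"

definition has_generator_at ::
    "('v::real_vector \<Rightarrow> 'v \<Rightarrow> real) \<Rightarrow> (real \<Rightarrow> 'v \<Rightarrow> 'v) \<Rightarrow> 'v \<Rightarrow> 'v \<Rightarrow> bool" where
  "has_generator_at ip T x y \<longleftrightarrow>
     ((\<lambda>t. ipnorm ip ((1 / t) *\<^sub>R (T t x - x) - y)) \<longlongrightarrow> 0) (at_right 0)"

definition is_generator ::
    "'v::real_vector set \<Rightarrow> ('v \<Rightarrow> 'v \<Rightarrow> real) \<Rightarrow> (real \<Rightarrow> 'v \<Rightarrow> 'v) \<Rightarrow> 'v set \<Rightarrow> ('v \<Rightarrow> 'v) \<Rightarrow> bool"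
  where
  "is_generator H ip T D B \<longleftrightarrow>
     {(x, y). x \<in> H \<and> y \<in> H \<and> has_generator_at ip T x y} = {(x, B x) | x. x \<in> D}"

text \<open>
  The complexification of \<open>H\<close> is \<open>H \<times> H\<close>, where \<open>(x, y)\<close> stands for \<open>x + \<i>y\<close>.
\<close>

definition cscale :: "complex \<Rightarrow> 'v::real_vector \<times> 'v \<Rightarrow> 'v \<times> 'v" where
  "cscale c w = (Re c *\<^sub>R fst w - Im c *\<^sub>R snd w, Im c *\<^sub>R fst w + Re c *\<^sub>R snd w)"

definition cnorm :: "('v \<Rightarrow> 'v \<Rightarrow> real) \<Rightarrow> 'v \<times> 'v \<Rightarrow> real" where
  "cnorm ip w = sqrt (ip (fst w) (fst w) + ip (snd w) (snd w))"

definition cbounded_op ::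
    "'v::real_vector set \<Rightarrow> ('v \<Rightarrow> 'v \<Rightarrow> real) \<Rightarrow> ('v \<times> 'v \<Rightarrow> 'v \<times> 'v) \<Rightarrow> bool" where
  "cbounded_op H ip F \<longleftrightarrow>
     F ` (H \<times> H) \<subseteq> H \<times> H \<and>
     (\<forall>w\<in>H \<times> H. \<forall>w'\<in>H \<times> H. F (w + w') = F w + F w') \<and>
     (\<forall>c. \<forall>w\<in>H \<times> H. F (cscale c w) = cscale c (F w)) \<and>
     (\<exists>C. \<forall>w\<in>H \<times> H. cnorm ip (F w) \<le> C * cnorm ip w)"

definition sector :: "real \<Rightarrow> complex set" where
  "sector \<theta> = {z. z \<noteq> 0 \<and> \<bar>Arg z\<bar> < \<theta>}"

text \<open>
  Analyticity is complex differentiability with respect to the operator norm.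
\<close>

definition op_holomorphic_on ::
    "'v::real_vector set \<Rightarrow> ('v \<Rightarrow> 'v \<Rightarrow> real) \<Rightarrow> (complex \<Rightarrow> 'v \<times> 'v \<Rightarrow> 'v \<times> 'v) \<Rightarrow> complex set \<Rightarrow> bool"
  where
  "op_holomorphic_on H ip S \<Omega> \<longleftrightarrow>
     (\<forall>z\<in>\<Omega>. \<exists>F. cbounded_op H ip F \<and>
        (\<forall>e>0. \<forall>\<^sub>F z' in at z. \<forall>w\<in>H \<times> H.
           cnorm ip (S z' w - S z w - cscale (z' - z) (F w)) \<le> e * cmod (z' - z) * cnorm ip w))"

definition analytic_semigroup ::
    "'v::real_vector set \<Rightarrow> ('v \<Rightarrow> 'v \<Rightarrow> real) \<Rightarrow> real \<Rightarrow> (complex \<Rightarrow> 'v \<times> 'v \<Rightarrow> 'v \<times> 'v) \<Rightarrow> bool"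
  where
  "analytic_semigroup H ip \<theta> S \<longleftrightarrow>
     (\<forall>z\<in>insert 0 (sector \<theta>). cbounded_op H ip (S z)) \<and>
     (\<forall>w\<in>H \<times> H. S 0 w = w) \<and>
     (\<forall>z\<in>insert 0 (sector \<theta>). \<forall>z'\<in>insert 0 (sector \<theta>). \<forall>w\<in>H \<times> H.
        S (z + z') w = S z (S z' w)) \<and>
     op_holomorphic_on H ip S (sector \<theta>) \<and>
     (\<forall>\<theta>'. 0 < \<theta>' \<and> \<theta>' < \<theta> \<longrightarrow>
        (\<forall>w\<in>H \<times> H. ((\<lambda>z. cnorm ip (S z w - w)) \<longlongrightarrow> 0) (at 0 within sector \<theta>')))"

definition generates_contractive_analytic_semigroup ::
    "'v::real_vector set \<Rightarrow> ('v \<Rightarrow> 'v \<Rightarrow> real) \<Rightarrow> 'v set \<Rightarrow> ('v \<Rightarrow> 'v) \<Rightarrow> real \<Rightarrow> bool" where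
  "generates_contractive_analytic_semigroup H ip D B \<theta> \<longleftrightarrow>
     (\<exists>T. C0_semigroup H ip T \<and> contractive H ip T \<and> is_generator H ip T D B \<and>
        (\<exists>S. analytic_semigroup H ip \<theta> S \<and>
           (\<forall>t\<ge>0. \<forall>x\<in>H. \<forall>y\<in>H. S (complex_of_real t) (x, y) = (T t x, T t y))))"


section \<open>Measurable functions on $(0,1)$ modulo almost everywhere equality\<close>

abbreviation M01 :: "real measure" where
  "M01 \<equiv> lebesgue_on {0<..<1}"

definition ae_eq :: "(real \<Rightarrow> real) \<Rightarrow> (real \<Rightarrow> real) \<Rightarrow> bool" where
  "ae_eq f g \<longleftrightarrow> f \<in> borel_measurable M01 \<and> g \<in> borel_measurable M01 \<and> (AE x in M01. f x = g x)"

quotient_type l0 = "real \<Rightarrow> real" / partial: ae_eq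
proof (rule part_equivpI)
  show "\<exists>f. ae_eq f f"
    by (rule exI[of _ "\<lambda>_. 0"]) (simp add: ae_eq_def)
  show "symp ae_eq"
    by (rule sympI) (auto simp: ae_eq_def)
  show "transp ae_eq"
  proof (rule transpI)
    fix f g h assume "ae_eq f g" "ae_eq g h"
    then have fg: "AE x in M01. f x = g x" and gh: "AE x in M01. g x = h x"
      and m: "f \<in> borel_measurable M01" "h \<in> borel_measurable M01"
      by (auto simp: ae_eq_def)
    from fg gh have "AE x in M01. f x = h x" by eventually_elim simp
    with m show "ae_eq f h" by (simp add: ae_eq_def)
  qed
qed

instantiation l0 :: real_vector
begin

lift_definition zero_l0 :: l0 is "\<lambda>_. 0" by (simp add: ae_eq_def)

lift_definition plus_l0 :: "l0 \<Rightarrow> l0 \<Rightarrow> l0" is "\<lambda>f g x. f x + g x"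
  by (auto simp: ae_eq_def elim: eventually_elim2)

lift_definition uminus_l0 :: "l0 \<Rightarrow> l0" is "\<lambda>f x. - f x"
  by (auto simp: ae_eq_def)

lift_definition minus_l0 :: "l0 \<Rightarrow> l0 \<Rightarrow> l0" is "\<lambda>f g x. f x - g x"
  by (auto simp: ae_eq_def elim: eventually_elim2)

lift_definition scaleR_l0 :: "real \<Rightarrow> l0 \<Rightarrow> l0" is "\<lambda>c f x. c * f x"
  by (auto simp: ae_eq_def elim: eventually_mono)

instance
  by standard (transfer; auto simp: ae_eq_def algebra_simps)+

end

text \<open>
  For measurable \<open>f\<close>, \<open>abs_l0 f\<close> is the class of \<open>f\<close>; \<open>rep_l0 u\<close> is a chosen measurable
  representative of \<open>u\<close>. All integrals below are independent of this choice.
\<close>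

lemma rep_l0_measurable: "rep_l0 u \<in> borel_measurable M01"
  using Quotient_rep_reflp[OF Quotient_l0, of u] by (simp add: ae_eq_def)

lemma rep_abs_l0:
  assumes "f \<in> borel_measurable M01"
  shows "AE x in M01. rep_l0 (abs_l0 f) x = f x"
proof -
  have "ae_eq (rep_l0 (abs_l0 f)) f"
    using assms by (intro Quotient_rep_abs[OF Quotient_l0]) (simp add: ae_eq_def)
  then show ?thesis by (simp add: ae_eq_def)
qed


section \<open>Distributional derivatives and function spaces on $(0,1)$\<close>

definition test_function :: "(real \<Rightarrow> real) \<Rightarrow> bool" where
  "test_function \<phi> \<longleftrightarrow>
     (\<forall>k x. (deriv ^^ k) \<phi> field_differentiable at x) \<and>
     (\<exists>K. compact K \<and> K \<subseteq> {0<..<1} \<and> (\<forall>x. x \<notin> K \<longrightarrow> \<phi> x = 0))"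

definition loc_integrable :: "l0 \<Rightarrow> bool" where
  "loc_integrable u \<longleftrightarrow>
     (\<forall>K. compact K \<and> K \<subseteq> {0<..<1} \<longrightarrow> integrable (lebesgue_on K) (rep_l0 u))"

definition has_dist_deriv :: "nat \<Rightarrow> l0 \<Rightarrow> l0 \<Rightarrow> bool" where
  "has_dist_deriv k u g \<longleftrightarrow> loc_integrable u \<and> loc_integrable g \<and>
     (\<forall>\<phi>. test_function \<phi> \<longrightarrow>
        (\<integral>x. rep_l0 u x * (deriv ^^ k) \<phi> x \<partial>M01) = (-1) ^ k * (\<integral>x. rep_l0 g x * \<phi> x \<partial>M01))"

text \<open>Unspecified unless the distributional derivative is a locally integrable function.\<close>

definition dist_deriv :: "nat \<Rightarrow> l0 \<Rightarrow> l0" where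
  "dist_deriv k u = (THE g. has_dist_deriv k u g)"

definition L2 :: "l0 set" where
  "L2 = {u. integrable M01 (\<lambda>x. (rep_l0 u x)\<^sup>2)}"

definition H2 :: "l0 set" where
  "H2 = {u \<in> L2. \<exists>g\<in>L2. \<exists>h\<in>L2. has_dist_deriv 1 u g \<and> has_dist_deriv 2 u h}"

text \<open>
  The boundary values of \<open>u \<in> H\<^sup>2(0,1)\<close> and of \<open>u'\<close> are those of the representative of \<open>u\<close> that is
  continuously differentiable on \<open>[0,1]\<close>.
\<close>

definition C1_representative :: "l0 \<Rightarrow> (real \<Rightarrow> real) \<Rightarrow> (real \<Rightarrow> real) \<Rightarrow> bool" where
  "C1_representative u U U' \<longleftrightarrow>
     (\<forall>x\<in>{0..1}. (U has_real_derivative U' x) (at x within {0..1})) \<and>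
     continuous_on {0..1} U' \<and> (AE x in M01. rep_l0 u x = U x)"

definition H20 :: "l0 set" where
  "H20 = {u \<in> H2. \<exists>U U'. C1_representative u U U' \<and> (\<forall>j\<in>{0, 1}. U j = 0 \<and> U' j = 0)}"

definition L2w :: "(real \<Rightarrow> real) \<Rightarrow> l0 set" where
  "L2w a = {u \<in> L2. integrable M01 (\<lambda>x. (rep_l0 u x)\<^sup>2 / a x)}"

definition ipw :: "(real \<Rightarrow> real) \<Rightarrow> l0 \<Rightarrow> l0 \<Rightarrow> real" where
  "ipw a u v = (\<integral>x. rep_l0 u x * rep_l0 v x / a x \<partial>M01)"

definition H2w :: "(real \<Rightarrow> real) \<Rightarrow> l0 set" where
  "H2w a = L2w a \<inter> H20"


section \<open>The operator $Au = au''''$\<close>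

definition l0_mult :: "(real \<Rightarrow> real) \<Rightarrow> l0 \<Rightarrow> l0" where
  "l0_mult a u = abs_l0 (\<lambda>x. a x * rep_l0 u x)"

definition opA :: "(real \<Rightarrow> real) \<Rightarrow> l0 \<Rightarrow> l0" where
  "opA a u = l0_mult a (dist_deriv 4 u)"

definition domA :: "(real \<Rightarrow> real) \<Rightarrow> l0 set" where
  "domA a = {u \<in> H2w a. \<exists>g. has_dist_deriv 4 u g \<and> l0_mult a g \<in> L2w a}"

end

theory Submission
  imports Defs
begin

text \<open>
  The form \<open>b(u,v) = \<integral> u'' v''\<close> is closed on \<open>H\<^sup>2\<^sub>1\<^sub>/\<^sub>a\<close>, so the Riesz theorem yields a bounded
  symmetric operator \<open>R\<close> with \<open>b(Rf, v) + \<langle>Rf, v\<rangle> = \<langle>f, v\<rangle>\<close>. The operator of the form is \<open>A\<close> on its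
  full domain because of Green's formula \<open>\<integral> u'''' v = \<integral> u'' v''\<close>, valid although \<open>u''''\<close> is only
  locally integrable: the lemma of du Bois-Reymond gives it for \<open>v\<close> cut off near both end points,
  and the error terms vanish by the Hardy-type bounds \<open>|v'(x)|\<^sup>2 \<le> x \<parallel>v''\<parallel>\<^sup>2\<close> and
  \<open>|v(x)|\<^sup>2 \<le> x\<^sup>3 \<parallel>v''\<parallel>\<^sup>2\<close>. Hence \<open>R = (1 + A)\<^sup>-\<^sup>1\<close>, which makes \<open>A\<close> self-adjoint, and
  \<open>exp(-zA)\<close> is the function \<open>exp(-z(1/r - 1))\<close> of \<open>R\<close> in the continuous functional calculus.
\<close>


section \<open>Hilbert spaces on a carrier\<close>

text \<open>Self-adjointness therefore hinges on showing that the maximal domain \<open>domA\<close>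
  is no larger than the range of \<open>R\<close>; this is what Green's formula is for. Sobolev
  theory is reduced to double primitives: \<open>u\<close> lies in \<open>H20\<close> exactly if it
  is the double primitive of a square integrable \<open>h\<close> with
  \<open>\<integral> h = \<integral> x h = 0\<close>. The pair \<open>(u, h)\<close> is pinned down
  by pairings with functions smooth up to the boundary. These are continuous in both components, so
  the form domain is complete without embedding theorems. Passing to the bounded operator
  \<open>R\<close> confines the functional calculus to continuous functions on \<open>[0,1]\<close>.
  It rests on the positivity of \<open>p(R)\<close> for polynomials \<open>p\<close> that are
  nonnegative there, which the Bernstein basis reduces to the operators
  \<open>R^k (1 - R)^l\<close>. The unboundedness of \<open>A\<close> survives only as the behaviour
  of the symbols at \<open>r = 0\<close>.\<close>

locale ip_space =
  fixes H :: "'v::real_vector set" and ip :: "'v \<Rightarrow> 'v \<Rightarrow> real"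
  assumes subspace_H: "subspace H"
    and ip_add_left: "\<lbrakk>x \<in> H; y \<in> H; z \<in> H\<rbrakk> \<Longrightarrow> ip (x + y) z = ip x z + ip y z"
    and ip_scale_left: "\<lbrakk>x \<in> H; y \<in> H\<rbrakk> \<Longrightarrow> ip (c *\<^sub>R x) y = c * ip x y"
    and ip_sym: "\<lbrakk>x \<in> H; y \<in> H\<rbrakk> \<Longrightarrow> ip x y = ip y x"
    and ip_nonneg: "x \<in> H \<Longrightarrow> 0 \<le> ip x x"
    and ip_definite: "\<lbrakk>x \<in> H; ip x x = 0\<rbrakk> \<Longrightarrow> x = 0"
begin

abbreviation N :: "'v \<Rightarrow> real" where "N \<equiv> ipnorm ip"

lemma mem_H [simp]:
  "0 \<in> H"
  "x \<in> H \<Longrightarrow> y \<in> H \<Longrightarrow> x + y \<in> H"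
  "x \<in> H \<Longrightarrow> y \<in> H \<Longrightarrow> x - y \<in> H"
  "x \<in> H \<Longrightarrow> c *\<^sub>R x \<in> H"
  "x \<in> H \<Longrightarrow> - x \<in> H"
  using subspace_H by (auto intro: subspace_0 subspace_add subspace_diff subspace_mul subspace_neg)

lemma ip_add_right: "\<lbrakk>x \<in> H; y \<in> H; z \<in> H\<rbrakk> \<Longrightarrow> ip x (y + z) = ip x y + ip x z"
  using ip_add_left[of y z x] ip_sym by simp

lemma ip_scale_right: "\<lbrakk>x \<in> H; y \<in> H\<rbrakk> \<Longrightarrow> ip x (c *\<^sub>R y) = c * ip x y"
  using ip_scale_left[of y x c] ip_sym by simp

lemma ip_minus_left: "\<lbrakk>x \<in> H; y \<in> H\<rbrakk> \<Longrightarrow> ip (- x) y = - ip x y"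
  using ip_scale_left[of x y "-1"] by simp

lemma ip_minus_right: "\<lbrakk>x \<in> H; y \<in> H\<rbrakk> \<Longrightarrow> ip x (- y) = - ip x y"
  using ip_scale_right[of x y "-1"] by simp

lemma ip_diff_left: "\<lbrakk>x \<in> H; y \<in> H; z \<in> H\<rbrakk> \<Longrightarrow> ip (x - y) z = ip x z - ip y z"
  using ip_add_left[of x "-y" z] ip_minus_left by simp

lemma ip_diff_right: "\<lbrakk>x \<in> H; y \<in> H; z \<in> H\<rbrakk> \<Longrightarrow> ip x (y - z) = ip x y - ip x z"
  using ip_add_right[of x y "-z"] ip_minus_right by simp

lemmas ip_simps = ip_add_left ip_add_right ip_scale_left ip_scale_right
  ip_minus_left ip_minus_right ip_diff_left ip_diff_right

lemma ip_zero [simp]: "x \<in> H \<Longrightarrow> ip 0 x = 0" "x \<in> H \<Longrightarrow> ip x 0 = 0"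
  using ip_scale_left[of x x 0] ip_scale_right[of x x 0] by simp_all

lemma N_sq: "x \<in> H \<Longrightarrow> (N x)\<^sup>2 = ip x x"
  by (simp add: ipnorm_def ip_nonneg)

lemma N_nonneg: "x \<in> H \<Longrightarrow> 0 \<le> N x"
  by (simp add: ipnorm_def ip_nonneg)

lemma N_zero [simp]: "N 0 = 0"
  by (simp add: ipnorm_def)

lemma N_eq_0: "x \<in> H \<Longrightarrow> N x = 0 \<Longrightarrow> x = 0"
  using N_sq ip_definite by fastforce

lemma N_minus: "x \<in> H \<Longrightarrow> N (- x) = N x"
  by (simp add: ipnorm_def ip_simps)

lemma N_commute: "x \<in> H \<Longrightarrow> y \<in> H \<Longrightarrow> N (x - y) = N (y - x)"
  using N_minus[of "x - y"] by simp

lemma Cauchy_Schwarz: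
  assumes "x \<in> H" "y \<in> H" shows "\<bar>ip x y\<bar> \<le> N x * N y"
proof (cases "y = 0")
  case False
  then have p: "ip y y > 0" using assms ip_definite ip_nonneg[of y] by fastforce
  let ?c = "ip x y / ip y y"
  have "0 \<le> ip (x - ?c *\<^sub>R y) (x - ?c *\<^sub>R y)" using assms by (simp add: ip_nonneg)
  also have "\<dots> = ip x x - (ip x y)\<^sup>2 / ip y y"
    using assms p by (simp add: ip_simps ip_sym[of y x] power2_eq_square field_simps)
  finally have "(ip x y)\<^sup>2 \<le> ip x x * ip y y" using p by (simp add: field_simps)
  then have "sqrt ((ip x y)\<^sup>2) \<le> sqrt (ip x x * ip y y)" by (rule real_sqrt_le_mono)
  then show ?thesis by (simp add: ipnorm_def real_sqrt_mult)
qed (use assms in simp)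

lemma N_triangle:
  assumes "x \<in> H" "y \<in> H" shows "N (x + y) \<le> N x + N y"
proof (rule power2_le_imp_le)
  have "(N (x + y))\<^sup>2 = (N x)\<^sup>2 + 2 * ip x y + (N y)\<^sup>2"
    using assms by (simp add: N_sq ip_simps ip_sym[of y x])
  then show "(N (x + y))\<^sup>2 \<le> (N x + N y)\<^sup>2"
    using Cauchy_Schwarz[OF assms] by (simp add: power2_sum)
  show "0 \<le> N x + N y" using assms N_nonneg by simp
qed

lemma N_diff_le: "\<lbrakk>x \<in> H; y \<in> H\<rbrakk> \<Longrightarrow> N (x - y) \<le> N x + N y"
  using N_triangle[of x "-y"] N_minus[of y] by simp

lemma N_triangle_via: "\<lbrakk>x \<in> H; y \<in> H; z \<in> H\<rbrakk> \<Longrightarrow> N (x - z) \<le> N (x - y) + N (y - z)"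
  using N_triangle[of "x - y" "y - z"] by simp

lemma N_le_zero_imp_eq:
  assumes "x \<in> H" "y \<in> H" "\<And>e. e > 0 \<Longrightarrow> N (x - y) \<le> e" shows "x = y"
proof -
  have "N (x - y) \<le> 0" using assms(3) by (metis dense_ge)
  then have "N (x - y) = 0" using N_nonneg[of "x - y"] assms by simp
  then show ?thesis using N_eq_0[of "x - y"] assms by simp
qed

lemma ip_tendsto:
  assumes "\<And>n. X n \<in> H" "x \<in> H" "v \<in> H" "((\<lambda>n. N (X n - x)) \<longlongrightarrow> 0) F"
  shows "((\<lambda>n. ip (X n) v) \<longlongrightarrow> ip x v) F"
proof (rule LIM_zero_cancel, rule Lim_null_comparison)
  show "\<forall>\<^sub>F n in F. norm (ip (X n) v - ip x v) \<le> N (X n - x) * N v"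
    using Cauchy_Schwarz[of "X n - x" v for n] assms by (auto simp: ip_simps)
  show "((\<lambda>n. N (X n - x) * N v) \<longlongrightarrow> 0) F"
    using tendsto_mult_right[OF assms(4), of "N v"] by simp
qed

end

locale hilbert = ip_space +
  assumes complete_H: "\<lbrakk>\<And>n::nat. X n \<in> H; \<And>e. e > 0 \<Longrightarrow> \<exists>M. \<forall>m\<ge>M. \<forall>n\<ge>M. N (X m - X n) < e\<rbrakk>
    \<Longrightarrow> \<exists>l\<in>H. (\<lambda>n. N (X n - l)) \<longlonglongrightarrow> 0"
begin

text \<open>With \<open>D = H\<close> this is the Riesz representation theorem; with \<open>l = ip x\<close> it is the orthogonal
  projection of \<open>x\<close> onto the closure of \<open>D\<close>. A minimising sequence of \<open>\<parallel>v\<parallel>\<^sup>2 - 2 l v\<close> on \<open>D\<close>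
  is Cauchy by the parallelogram law.\<close>

lemma Riesz_subspace:
  assumes D: "subspace D" "D \<subseteq> H"
    and l_add: "\<And>u v. u \<in> D \<Longrightarrow> v \<in> D \<Longrightarrow> l (u + v) = l u + (l v :: real)"
    and l_scale: "\<And>c u. u \<in> D \<Longrightarrow> l (c *\<^sub>R u) = c * l u"
    and l_bound: "\<And>u. u \<in> D \<Longrightarrow> \<bar>l u\<bar> \<le> C * N u"
  obtains p where "p \<in> H" "\<And>v. v \<in> D \<Longrightarrow> ip p v = l v" "\<And>e. e > 0 \<Longrightarrow> \<exists>d\<in>D. N (p - d) < e"
proof -
  have DH: "d \<in> D \<Longrightarrow> d \<in> H" for d using D by auto
  define J where "J v = ip v v - 2 * l v" for v
  \<comment> \<open>Completing the square:
    \<open>J v \<ge> (N v - C)\<^sup>2 - C\<^sup>2\<close>.\<close>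
  have lower: "- C\<^sup>2 \<le> J v" if "v \<in> D" for v
  proof -
    have "0 \<le> (N v - C)\<^sup>2" by simp
    then have "2 * (C * N v) \<le> (N v)\<^sup>2 + C\<^sup>2" by (simp add: power2_diff algebra_simps)
    then show ?thesis using l_bound[OF that] N_sq[OF DH[OF that]] unfolding J_def by linarith
  qed
  define m where "m = Inf (J ` D)"
  have bdd: "bdd_below (J ` D)" using lower by (intro bdd_belowI2[where m="- C\<^sup>2"]) auto
  have ne: "J ` D \<noteq> {}" using D subspace_0 by auto
  have m_le: "m \<le> J v" if "v \<in> D" for v
    unfolding m_def using bdd that by (intro cInf_lower) auto
  have "\<exists>d\<in>D. J d < m + inverse (real (Suc n))" for n
  proof -
    have "m < m + inverse (real (Suc n))" by simp
    then show ?thesis using ne bdd unfolding m_def by (subst (asm) cInf_less_iff) auto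
  qed
  then obtain d where dD: "\<And>n. d n \<in> D" and dJ: "\<And>n. J (d n) < m + inverse (real (Suc n))" by metis
  have dH: "d n \<in> H" for n using dD DH by auto
  have par: "(N (d i - d k))\<^sup>2 \<le> 2 * inverse (real (Suc i)) + 2 * inverse (real (Suc k))" for i k
  proof -
    let ?w = "(1/2) *\<^sub>R (d i + d k)"
    have w: "?w \<in> D" using D dD by (intro subspace_mul subspace_add) auto
    have lw: "l ?w = (l (d i) + l (d k)) / 2"
      using l_scale[of "d i + d k" "1/2"] l_add[OF dD dD] D dD by (simp add: subspace_add)
    have "(N (d i - d k))\<^sup>2 = 2 * J (d i) + 2 * J (d k) - 4 * J ?w"
      unfolding J_def lw using dH ip_sym[of "d k" "d i"] by (simp add: N_sq ip_simps field_simps)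
    then show ?thesis using dJ[of i] dJ[of k] m_le[OF w] by linarith
  qed
  have "\<exists>M. \<forall>i\<ge>M. \<forall>k\<ge>M. N (d i - d k) < e" if e: "e > 0" for e
  proof -
    obtain M where M: "inverse (real (Suc M)) < e\<^sup>2 / 4" using e reals_Archimedean[of "e\<^sup>2/4"] by auto
    have "N (d i - d k) < e" if "i \<ge> M" "k \<ge> M" for i k
    proof -
      have "inverse (real (Suc i)) \<le> inverse (real (Suc M))" "inverse (real (Suc k)) \<le> inverse (real (Suc M))"
        using that by (auto intro!: le_imp_inverse_le)
      then have "(N (d i - d k))\<^sup>2 < e\<^sup>2" using par[of i k] M by linarith
      then show ?thesis using e by (simp add: power2_less_imp_less)
    qed
    then show ?thesis by blast
  qed
  then obtain p where p: "p \<in> H" and lim: "(\<lambda>n. N (d n - p)) \<longlonglongrightarrow> 0"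
    using complete_H[of d] dH by blast
  have "ip p v = l v" if v: "v \<in> D" for v
  proof -
    have vH: "v \<in> H" using v DH by auto
    let ?b = "ip p v - l v"
    \<comment> \<open>First variation: \<open>J (d n + t *\<^sub>R v)\<close> is at least
      \<open>m\<close>, while \<open>J (d n)\<close> exceeds \<open>m\<close> by less than
      \<open>1 / (n + 1)\<close>; the limit in \<open>n\<close> removes this gap.\<close>
    have ineq: "0 \<le> 2 * t * ?b + t\<^sup>2 * ip v v" for t
    proof (rule LIMSEQ_le_const)
      have "(\<lambda>n. inverse (real (Suc n)) + (2 * t * (ip (d n) v - l v) + t\<^sup>2 * ip v v))
        \<longlonglongrightarrow> 0 + (2 * t * ?b + t\<^sup>2 * ip v v)"
        by (intro tendsto_intros LIMSEQ_inverse_real_of_nat ip_tendsto[OF dH p vH lim])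
      then show "(\<lambda>n. inverse (real (Suc n)) + (2 * t * (ip (d n) v - l v) + t\<^sup>2 * ip v v))
        \<longlonglongrightarrow> 2 * t * ?b + t\<^sup>2 * ip v v" by simp
      have "0 \<le> inverse (real (Suc n)) + (2 * t * (ip (d n) v - l v) + t\<^sup>2 * ip v v)" for n
      proof -
        have tv: "t *\<^sub>R v \<in> D" "d n + t *\<^sub>R v \<in> D" using D v dD by (auto intro: subspace_add subspace_mul)
        have "J (d n + t *\<^sub>R v) = J (d n) + 2 * t * (ip (d n) v - l v) + t\<^sup>2 * ip v v"
          unfolding J_def using l_add[OF dD tv(1)] l_scale[OF v] dH vH
          by (simp add: ip_simps ip_sym[of v "d n"] power2_eq_square algebra_simps)
        then show ?thesis using m_le[OF tv(2)] dJ[of n] by linarith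
      qed
      then show "\<exists>M. \<forall>n\<ge>M. 0 \<le> inverse (real (Suc n)) + (2 * t * (ip (d n) v - l v) + t\<^sup>2 * ip v v)"
        by blast
    qed
    show ?thesis
    proof (rule ccontr)
      assume ne: "ip p v \<noteq> l v"
      have alg: "2 * (- b / s) * b + (- b / s)\<^sup>2 * q = b\<^sup>2 / s * (q / s - 2)" for b q s :: real
        by (simp add: power2_eq_square algebra_simps)
      have v0: "0 \<le> ip v v" using vH ip_nonneg by auto
      \<comment> \<open>This \<open>t\<close> makes the linear term beat the quadratic one; the
        \<open>+ 1\<close> keeps the denominator positive even if \<open>ip v v = 0\<close>.\<close>
      have "0 \<le> 2 * (- ?b / (ip v v + 1)) * ?b + (- ?b / (ip v v + 1))\<^sup>2 * ip v v" by (rule ineq)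
      also have "\<dots> = ?b\<^sup>2 / (ip v v + 1) * (ip v v / (ip v v + 1) - 2)"
        using alg by blast
      also have "\<dots> < 0"
      proof (rule mult_pos_neg)
        show "0 < ?b\<^sup>2 / (ip v v + 1)" using v0 ne by simp
        have "ip v v / (ip v v + 1) \<le> 1" using v0 by simp
        then show "ip v v / (ip v v + 1) - 2 < 0" by linarith
      qed
      finally show False by simp
    qed
  qed
  moreover have "\<exists>u\<in>D. N (p - u) < e" if e0: "e > 0" for e
  proof -
    obtain n where "N (d n - p) < e"
      using order_tendstoD(2)[OF lim e0] by (auto simp: eventually_sequentially)
    then show ?thesis using dD N_commute[OF dH p] by metis
  qed
  ultimately show ?thesis using that p by blast
qed

end

section \<open>Bernstein representation of positive polynomials\<close>

text \<open>Picks an error \<open>e\<close> for which \<open>e * s\<close> stays below a prescribed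
  \<open>c\<close>; the \<open>+ 1\<close> covers \<open>s = 0\<close>.\<close>

lemma exists_scaled: "0 \<le> s \<Longrightarrow> 0 < c \<Longrightarrow> \<exists>e>0. e * (s + 1) = c" for c s :: real
  by (intro exI[of _ "c / (s + 1)"]) auto

text \<open>Both quantities are products of \<open>j\<close> factors of modulus at most 1, so they
  differ by at most the sum of the differences of the factors. Since \<open>2 * j \<le> n\<close>
  keeps \<open>n - i\<close> above \<open>n / 2\<close>, each of these is at most
  \<open>2 * j / n\<close>.\<close>

lemma choose_ratio_close:
  fixes j k n :: nat
  assumes "k \<le> n" "2 * j \<le> n" "0 < n"
  shows "\<bar>real (k choose j) / real (n choose j) - (real k / real n) ^ j\<bar> \<le> 2 * (real j)\<^sup>2 / real n"
proof -
  have ratio: "real (k choose j) / real (n choose j) = (\<Prod>i<j. (real k - real i) / (real n - real i))"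
    by (simp add: binomial_gbinomial gbinomial_prod_rev prod_dividef lessThan_atLeast0)
  have "\<bar>(\<Prod>i<j. (real k - real i) / (real n - real i)) - (\<Prod>i<j. real k / real n)\<bar>
    \<le> (\<Sum>i<j. \<bar>(real k - real i) / (real n - real i) - real k / real n\<bar>)"
    using assms by (intro norm_prod_diff[where 'a=real, unfolded real_norm_def]) (auto simp: field_simps abs_le_iff)
  also have "\<dots> \<le> (\<Sum>i<j. 2 * real j / real n)"
  proof (rule sum_mono)
    fix i assume i: "i \<in> {..<j}"
    then have pos: "real n - real i > 0" "real n \<le> 2 * (real n - real i)" using assms by auto
    have "(real k - real i) / (real n - real i) - real k / real n
        = - (real i * (real n - real k) / (real n * (real n - real i)))"
      using pos assms by (simp add: field_simps)
    then have "\<bar>(real k - real i) / (real n - real i) - real k / real n\<bar>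
        = real i * (real n - real k) / (real n * (real n - real i))"
      using pos assms by simp
    also have "\<dots> \<le> real j * real n / (real n * (real n - real i))"
      using pos assms i by (intro divide_right_mono mult_mono) auto
    also have "\<dots> = real j / (real n - real i)" using assms by simp
    also have "\<dots> \<le> real j / (real n / 2)" using pos assms by (intro divide_left_mono) auto
    finally show "\<bar>(real k - real i) / (real n - real i) - real k / real n\<bar> \<le> 2 * real j / real n" by (simp add: mult.commute)
  qed
  finally show ?thesis by (simp add: ratio power2_eq_square mult_ac)
qed

text \<open>These are the Bernstein coefficients of the monomial \<open>t ^ j\<close>: moving
  \<open>n choose j\<close> out of the product of binomial coefficients leaves \<open>t ^ j\<close>
  times a full binomial sum of degree \<open>n - j\<close>.\<close>

lemma Bernstein_choose_sum:
  fixes t :: real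
  assumes "j \<le> n"
  shows "(\<Sum>k\<le>n. real (k choose j) / real (n choose j) * real (n choose k) * (t ^ k * (1 - t) ^ (n - k))) = t ^ j"
proof -
  have "(\<Sum>k\<le>n. real (k choose j) / real (n choose j) * real (n choose k) * (t ^ k * (1 - t) ^ (n - k)))
    = (\<Sum>k=j..n. real (k choose j) / real (n choose j) * real (n choose k) * (t ^ k * (1 - t) ^ (n - k)))"
    by (intro sum.mono_neutral_right) (auto simp: not_le)
  also have "\<dots> = (\<Sum>k=j..n. real (n - j choose (k - j)) * (t ^ k * (1 - t) ^ (n - k)))"
  proof (rule sum.cong)
    fix k assume k: "k \<in> {j..n}"
    then have "(n choose k) * (k choose j) = (n choose j) * (n - j choose (k - j))" by (simp add: choose_mult)
    then have "real (n choose k) * real (k choose j) = real (n choose j) * real (n - j choose (k - j))"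
      by (metis of_nat_mult)
    then have "real (k choose j) / real (n choose j) * real (n choose k) = real (n - j choose (k - j))"
      using assms by (simp add: field_simps)
    then show "real (k choose j) / real (n choose j) * real (n choose k) * (t ^ k * (1 - t) ^ (n - k))
      = real (n - j choose (k - j)) * (t ^ k * (1 - t) ^ (n - k))" by simp
  qed simp
  also have "\<dots> = (\<Sum>i\<le>n - j. real (n - j choose i) * (t ^ (i + j) * (1 - t) ^ (n - j - i)))"
    using assms by (intro sum.reindex_bij_witness[of _ "\<lambda>i. i + j" "\<lambda>k. k - j"]) auto
  also have "\<dots> = t ^ j * (\<Sum>i\<le>n - j. real (n - j choose i) * t ^ i * (1 - t) ^ (n - j - i))"
    by (simp add: sum_distrib_left power_add algebra_simps)
  also have "\<dots> = t ^ j" using binomial_ring[of t "1 - t" "n - j"] by simp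
  finally show ?thesis .
qed

text \<open>The numbers \<open>\<beta> k\<close> are the coefficients of \<open>p\<close> in the Bernstein basis of degree \<open>n\<close>; they
  approach \<open>p (k / n)\<close> uniformly in \<open>k\<close>.\<close>

lemma poly_nonneg_Bernstein:
  fixes p :: "real poly"
  assumes nonneg: "\<And>t. t \<in> {0..1} \<Longrightarrow> 0 \<le> poly p t" and e: "e > 0"
  shows "\<exists>n \<beta>. (\<forall>k\<le>n. - e \<le> \<beta> k) \<and>
    p = (\<Sum>k\<le>n. smult (\<beta> k * real (n choose k)) ([:0, 1:] ^ k * [:1, -1:] ^ (n - k)))"
proof -
  let ?d = "degree p"
  let ?K = "2 * (\<Sum>j\<le>?d. \<bar>coeff p j\<bar> * (real j)\<^sup>2)"
  \<comment> \<open>The first bound makes the coefficient error at most \<open>e\<close>, the second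
    lets \<open>choose_ratio_close\<close> apply to every \<open>j\<close> up to the degree.\<close>
  obtain n :: nat where n: "real n > max (?K / e) (2 * real ?d)" using reals_Archimedean2 by blast
  have nd: "2 * ?d \<le> n" "0 < n" "?K / real n \<le> e"
  proof -
    show "2 * ?d \<le> n" using n by linarith
    show n0: "0 < n" using n by (cases n) auto
    have "?K < e * real n" using n e by (simp add: field_simps)
    then show "?K / real n \<le> e" using n0 by (simp add: field_simps)
  qed
  define \<beta> where "\<beta> k = (\<Sum>j\<le>?d. coeff p j * (real (k choose j) / real (n choose j)))" for k
  show ?thesis
  proof (intro exI[of _ n] exI[of _ \<beta>] conjI allI impI)
    fix k assume k: "k \<le> n"
    have "\<bar>\<beta> k - poly p (real k / real n)\<bar>
      = \<bar>\<Sum>j\<le>?d. coeff p j * (real (k choose j) / real (n choose j) - (real k / real n) ^ j)\<bar>"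
      unfolding \<beta>_def poly_altdef by (simp add: sum_subtractf right_diff_distrib)
    also have "\<dots> \<le> (\<Sum>j\<le>?d. \<bar>coeff p j\<bar> * (2 * (real j)\<^sup>2 / real n))"
    proof (intro order_trans[OF sum_abs] sum_mono)
      fix j assume "j \<in> {..?d}"
      then show "\<bar>coeff p j * (real (k choose j) / real (n choose j) - (real k / real n) ^ j)\<bar>
        \<le> \<bar>coeff p j\<bar> * (2 * (real j)\<^sup>2 / real n)"
        unfolding abs_mult using k nd by (intro mult_left_mono choose_ratio_close) auto
    qed
    also have "\<dots> = ?K / real n" by (simp add: sum_distrib_left sum_divide_distrib mult_ac)
    finally have "\<bar>\<beta> k - poly p (real k / real n)\<bar> \<le> e" using nd by linarith
    moreover have "0 \<le> poly p (real k / real n)" using k nd by (intro nonneg) auto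
    ultimately show "- e \<le> \<beta> k" by linarith
  next
    show "p = (\<Sum>k\<le>n. smult (\<beta> k * real (n choose k)) ([:0, 1:] ^ k * [:1, -1:] ^ (n - k)))"
    proof (subst poly_eq_poly_eq_iff[symmetric], rule ext)
      fix t :: real
      have "poly (\<Sum>k\<le>n. smult (\<beta> k * real (n choose k)) ([:0, 1:] ^ k * [:1, -1:] ^ (n - k))) t
        = (\<Sum>k\<le>n. \<Sum>j\<le>?d. coeff p j * (real (k choose j) / real (n choose j) * real (n choose k) * (t ^ k * (1 - t) ^ (n - k))))"
        by (simp add: poly_sum \<beta>_def sum_distrib_right mult.assoc)
      also have "\<dots> = (\<Sum>j\<le>?d. coeff p j * (\<Sum>k\<le>n. real (k choose j) / real (n choose j) * real (n choose k) * (t ^ k * (1 - t) ^ (n - k))))"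
        by (subst sum.swap) (simp add: sum_distrib_left)
      also have "\<dots> = (\<Sum>j\<le>?d. coeff p j * t ^ j)"
        using nd by (intro sum.cong refl arg_cong2[where f="(*)"] Bernstein_choose_sum) auto
      finally show "poly p t = poly (\<Sum>k\<le>n. smult (\<beta> k * real (n choose k)) ([:0, 1:] ^ k * [:1, -1:] ^ (n - k))) t"
        by (simp add: poly_altdef)
    qed
  qed
qed

text \<open>\<open>R_pos\<close> reads \<open>R\<^sup>2 \<le> R\<close>; with symmetry it yields
  \<open>0 \<le> R \<le> 1\<close>. For \<open>u = R f\<close> and \<open>A u = f - u\<close> it is
  the statement that \<open>ip (A u) u \<ge> 0\<close>.\<close>

locale resolvent = hilbert +
  fixes R :: "'a \<Rightarrow> 'a"
  assumes R_mem [simp]: "x \<in> H \<Longrightarrow> R x \<in> H"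
    and R_add: "\<lbrakk>x \<in> H; y \<in> H\<rbrakk> \<Longrightarrow> R (x + y) = R x + R y"
    and R_scale: "x \<in> H \<Longrightarrow> R (c *\<^sub>R x) = c *\<^sub>R R x"
    and R_sym: "\<lbrakk>x \<in> H; y \<in> H\<rbrakk> \<Longrightarrow> ip (R x) y = ip x (R y)"
    and R_pos: "x \<in> H \<Longrightarrow> ip (R x) (R x) \<le> ip (R x) x"
begin

lemma R_0 [simp]: "R 0 = 0"
  using R_scale[of 0 0] by simp

lemma R_minus: "x \<in> H \<Longrightarrow> R (- x) = - R x"
  using R_scale[of x "-1"] by simp

lemma R_diff: "\<lbrakk>x \<in> H; y \<in> H\<rbrakk> \<Longrightarrow> R (x - y) = R x - R y"
  using R_add[of x "-y"] R_scale[of y "-1"] by simp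

lemma N_R_le: assumes "x \<in> H" shows "N (R x) \<le> N x"
proof -
  have "N (R x) * N (R x) \<le> N x * N (R x)"
    using R_pos[OF assms] Cauchy_Schwarz[of "R x" x] assms N_sq[of "R x"] by (simp add: power2_eq_square mult.commute)
  then show ?thesis
    using N_nonneg[OF assms] N_nonneg[of "R x"] assms by (cases "N (R x) = 0") (auto simp: mult_le_cancel_right)
qed

section \<open>Polynomials in \<open>R\<close>\<close>

definition pR :: "real poly \<Rightarrow> 'a \<Rightarrow> 'a" where
  "pR p = fold_coeffs (\<lambda>a f x. a *\<^sub>R x + R (f x)) p (\<lambda>x. 0)"

lemma pR_0 [simp]: "pR 0 x = 0"
  by (simp add: pR_def)

lemma pR_pCons [simp]: "pR (pCons a p) x = a *\<^sub>R x + R (pR p x)"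
  by (cases "a = 0 \<and> p = 0") (auto simp: pR_def)

lemma pR_mem [simp]: "x \<in> H \<Longrightarrow> pR p x \<in> H"
  by (induction p) auto

lemma pR_1 [simp]: "pR 1 x = x"
  by (simp add: one_pCons)

lemma pR_add_arg: "\<lbrakk>x \<in> H; y \<in> H\<rbrakk> \<Longrightarrow> pR p (x + y) = pR p x + pR p y"
  by (induction p) (auto simp: R_add scaleR_add_right)

lemma pR_scale_arg: "x \<in> H \<Longrightarrow> pR p (c *\<^sub>R x) = c *\<^sub>R pR p x"
  by (induction p) (auto simp: R_scale scaleR_add_right mult.commute)

lemma pR_diff_arg: "\<lbrakk>x \<in> H; y \<in> H\<rbrakk> \<Longrightarrow> pR p (x - y) = pR p x - pR p y"
  using pR_add_arg[of x "-y"] pR_scale_arg[of y p "-1"] by simp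

lemma pR_add: "x \<in> H \<Longrightarrow> pR (p + q) x = pR p x + pR q x"
  by (induction p q rule: poly_induct2) (auto simp: R_add scaleR_add_left)

lemma pR_smult: "x \<in> H \<Longrightarrow> pR (smult c p) x = c *\<^sub>R pR p x"
  by (induction p) (auto simp: R_scale scaleR_add_right)

lemma pR_diff: "x \<in> H \<Longrightarrow> pR (p - q) x = pR p x - pR q x"
  using pR_add[of x p "- q"] pR_smult[of x "-1" q] by simp

lemma pR_mult: "x \<in> H \<Longrightarrow> pR (p * q) x = pR p (pR q x)"
  by (induction p) (auto simp: pR_add pR_smult)

lemma pR_sum: "x \<in> H \<Longrightarrow> pR (\<Sum>i\<in>I. f i) x = (\<Sum>i\<in>I. pR (f i) x)"
  by (induction I rule: infinite_finite_induct) (auto simp: pR_add)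

lemma pR_R: "x \<in> H \<Longrightarrow> pR p (R x) = R (pR p x)"
  by (induction p) (auto simp: R_add R_scale)

lemma pR_sym: "\<lbrakk>x \<in> H; y \<in> H\<rbrakk> \<Longrightarrow> ip (pR p x) y = ip x (pR p y)"
  by (induction p arbitrary: y) (auto simp: ip_simps R_sym pR_R)

lemma sum_mem: "(\<And>i. i \<in> I \<Longrightarrow> f i \<in> H) \<Longrightarrow> sum f I \<in> H"
  by (rule subspace_sum[OF subspace_H])

lemma ip_sum_left: "(\<And>i. i \<in> I \<Longrightarrow> f i \<in> H) \<Longrightarrow> y \<in> H \<Longrightarrow> ip (sum f I) y = (\<Sum>i\<in>I. ip (f i) y)"
  by (induction I rule: infinite_finite_induct) (auto simp: ip_simps sum_mem)

text \<open>Halving the exponents writes the operator as \<open>q b q\<close> with \<open>q\<close>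
  symmetric, so only the four cases \<open>1\<close>, \<open>R\<close>, \<open>1 - R\<close> and
  \<open>R (1 - R)\<close> of \<open>b\<close> remain. The first is trivial, \<open>R_pos\<close>
  settles \<open>R\<close> and \<open>R (1 - R)\<close>, and contractivity settles
  \<open>1 - R\<close>.\<close>

lemma pR_monomial_nonneg:
  assumes x: "x \<in> H"
  shows "0 \<le> ip (pR ([:0, 1:] ^ k * [:1, -1:] ^ l) x) x"
proof -
  let ?X = "[:0, 1:] :: real poly" and ?Y = "[:1, -1:] :: real poly"
  let ?q = "?X ^ (k div 2) * ?Y ^ (l div 2)" and ?b = "?X ^ (k mod 2) * ?Y ^ (l mod 2)"
  have sq: "r ^ n = r ^ (n div 2) * r ^ (n mod 2) * r ^ (n div 2)" for r :: "real poly" and n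
    unfolding power_add[symmetric] by (rule arg_cong[where f="(^) r"]) presburger
  have "?X ^ k * ?Y ^ l = ?q * (?b * ?q)" by (subst (1) sq, subst (2) sq) (simp only: mult_ac)
  then have eq: "ip (pR (?X ^ k * ?Y ^ l) x) x = ip (pR ?b (pR ?q x)) (pR ?q x)"
    using x by (simp only: pR_mult[of _ ?q] pR_mult[of _ ?b] pR_mem pR_sym[of _ _ ?q])
  have nn: "0 \<le> ip (pR ?b y) y" if y: "y \<in> H" for y
  proof -
    have 1: "0 \<le> ip (R y) y" using R_pos[OF y] ip_nonneg[of "R y"] y by simp
    have "ip (R y) y \<le> N y * N y"
      using Cauchy_Schwarz[of "R y" y] N_R_le[OF y] y mult_right_mono[OF N_R_le[OF y] N_nonneg[OF y]] by simp
    then have 2: "ip (R y) y \<le> ip y y" using N_sq[OF y] by (simp add: power2_eq_square)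
    have 3: "0 \<le> ip (R y - R (R y)) y" using R_pos[OF y] y by (simp add: ip_simps R_sym)
    have "k mod 2 = 0 \<or> k mod 2 = 1" "l mod 2 = 0 \<or> l mod 2 = 1" by auto
    then show ?thesis using 1 2 3 y ip_nonneg[OF y] by (auto simp: pR_mult ip_simps R_diff R_add R_minus)
  qed
  show ?thesis unfolding eq by (rule nn) (simp add: x)
qed

text \<open>The Bernstein polynomials act as positive operators and add up to the identity, so
  coefficients above \<open>- e\<close> bound the form below by \<open>- e * ip x x\<close>; finally
  \<open>e\<close> is arbitrary.\<close>

lemma pR_nonneg:
  assumes x: "x \<in> H" and p: "\<And>t. t \<in> {0..1} \<Longrightarrow> 0 \<le> poly p t"
  shows "0 \<le> ip (pR p x) x"
proof -
  let ?m = "\<lambda>n k. [:0, 1:] ^ k * [:1, -1:] ^ (n - k) :: real poly"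
  have "- e * ip x x \<le> ip (pR p x) x" if e: "e > 0" for e
  proof -
    obtain n \<beta> where \<beta>: "\<And>k. k \<le> n \<Longrightarrow> - e \<le> \<beta> k"
      and p_eq: "p = (\<Sum>k\<le>n. smult (\<beta> k * real (n choose k)) (?m n k))"
      using poly_nonneg_Bernstein[OF p e] by blast
    have one: "(\<Sum>k\<le>n. smult (real (n choose k)) (?m n k)) = 1"
    proof (subst poly_eq_poly_eq_iff[symmetric], rule ext)
      show "poly (\<Sum>k\<le>n. smult (real (n choose k)) (?m n k)) t = poly 1 t" for t
        using binomial_ring[of t "1 - t" n] by (simp add: poly_sum mult.assoc)
    qed
    have "- e * ip x x = - e * ip (pR (\<Sum>k\<le>n. smult (real (n choose k)) (?m n k)) x) x" by (simp add: one)
    also have "\<dots> = (\<Sum>k\<le>n. - e * (real (n choose k) * ip (pR (?m n k) x) x))"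
      using x by (simp add: pR_sum ip_sum_left pR_smult ip_simps sum_distrib_left sum_negf)
    also have "\<dots> \<le> (\<Sum>k\<le>n. \<beta> k * (real (n choose k) * ip (pR (?m n k) x) x))"
      using \<beta> pR_monomial_nonneg[OF x] by (intro sum_mono mult_right_mono) auto
    also have "\<dots> = ip (pR p x) x"
      using arg_cong[OF p_eq, of "\<lambda>p. ip (pR p x) x"] x
      by (simp add: pR_sum ip_sum_left pR_smult ip_simps mult.assoc)
    finally show ?thesis .
  qed
  note lower = this
  show ?thesis
  proof (rule ccontr)
    let ?L = "ip (pR p x) x"
    assume "\<not> 0 \<le> ?L"
    then have L: "?L < 0" by simp
    have q: "0 \<le> ip x x" by (rule ip_nonneg[OF x])
    obtain e where e: "0 < e" "e * (ip x x + 1) = - ?L / 2"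
      using exists_scaled[OF q, of "- ?L / 2"] L by auto
    then have "e * ip x x \<le> - ?L / 2" using e by (simp add: algebra_simps)
    then show False using lower[OF e(1)] L by simp
  qed
qed

text \<open>Positivity of \<open>[:M\<^sup>2:] - p * p\<close> on the unit interval, because
  symmetry turns the form of \<open>p * p\<close> into \<open>(N (pR p x))\<^sup>2\<close>.\<close>

lemma pR_bound:
  assumes x: "x \<in> H" and p: "\<And>t. t \<in> {0..1} \<Longrightarrow> \<bar>poly p t\<bar> \<le> M"
  shows "N (pR p x) \<le> M * N x"
proof (rule power2_le_imp_le)
  have M: "0 \<le> M" using p[of 0] by simp
  have "0 \<le> poly ([:M\<^sup>2:] - p * p) t" if "t \<in> {0..1}" for t
    using p[OF that] M abs_le_square_iff[of "poly p t" M] by (simp add: power2_eq_square)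
  then have "0 \<le> ip (pR ([:M\<^sup>2:] - p * p) x) x" by (rule pR_nonneg[OF x])
  then show "(N (pR p x))\<^sup>2 \<le> (M * N x)\<^sup>2"
    using x by (simp add: pR_diff pR_mult ip_simps N_sq power_mult_distrib pR_sym)
  show "0 \<le> M * N x" using M N_nonneg[OF x] by simp
qed

end

section \<open>Continuous functional calculus\<close>

context resolvent begin

text \<open>The functional calculus of \<open>R\<close> for continuous functions on \<open>[0,1]\<close>, which contains its spectrum.\<close>

definition fc :: "(real \<Rightarrow> real) \<Rightarrow> 'a \<Rightarrow> 'a" where
  "fc f x = (SOME y. y \<in> H \<and>
     (\<forall>p M. (\<forall>t\<in>{0..1}. \<bar>poly p t - f t\<bar> \<le> M) \<longrightarrow> N (pR p x - y) \<le> M * N x))"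

lemma Weierstrass_poly:
  fixes f :: "real \<Rightarrow> real"
  assumes "continuous_on {0..1} f" "e > 0"
  obtains p where "\<And>t. t \<in> {0..1} \<Longrightarrow> \<bar>poly p t - f t\<bar> \<le> e"
proof -
  obtain g where g: "real_polynomial_function g" "\<And>t. t \<in> {0..1} \<Longrightarrow> \<bar>f t - g t\<bar> < e"
    using Stone_Weierstrass_real_polynomial_function[OF _ assms] by auto
  then obtain c n where "g = (\<lambda>x. \<Sum>i\<le>n. c i * x ^ i)"
    by (auto simp: real_polynomial_function_iff_sum)
  then have "poly (\<Sum>i\<le>n. monom (c i) i) t = g t" for t
    by (simp add: poly_sum poly_monom)
  then show ?thesis
    using that[of "\<Sum>i\<le>n. monom (c i) i"] g(2) by (metis abs_minus_commute less_imp_le)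
qed

text \<open>Uniformly convergent polynomials give a Cauchy sequence by \<open>pR_bound\<close>. Its
  limit satisfies the estimate against every polynomial and every \<open>M\<close>, which justifies
  the choice in the definition of \<open>fc\<close>.\<close>

lemma fc_spec:
  assumes f: "continuous_on {0..1} f" and x: "x \<in> H"
  shows "fc f x \<in> H"
    and "(\<And>t. t \<in> {0..1} \<Longrightarrow> \<bar>poly p t - f t\<bar> \<le> M) \<Longrightarrow> N (pR p x - fc f x) \<le> M * N x"
proof -
  obtain P where P: "\<And>n t. t \<in> {0..1} \<Longrightarrow> \<bar>poly (P n) t - f t\<bar> \<le> inverse (real (Suc n))"
  proof -
    have "\<exists>p. \<forall>t\<in>{0..1}. \<bar>poly p t - f t\<bar> \<le> inverse (real (Suc n))" for n
      by (rule Weierstrass_poly[OF f, of "inverse (real (Suc n))"]) (simp, blast)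
    then show ?thesis using that by metis
  qed
  have close: "N (pR p x - pR (P n) x) \<le> (M + inverse (real (Suc n))) * N x"
    if "\<And>t. t \<in> {0..1} \<Longrightarrow> \<bar>poly p t - f t\<bar> \<le> M" for p M n
  proof -
    have "\<bar>poly (p - P n) t\<bar> \<le> M + inverse (real (Suc n))" if "t \<in> {0..1}" for t
      using P[OF that, of n] \<open>\<And>t. t \<in> {0..1} \<Longrightarrow> \<bar>poly p t - f t\<bar> \<le> M\<close>[OF that] by simp
    from pR_bound[OF x this] show ?thesis using x by (simp add: pR_diff)
  qed
  have "\<exists>M. \<forall>m\<ge>M. \<forall>n\<ge>M. N (pR (P m) x - pR (P n) x) < e" if e: "e > 0" for e
  proof -
    have Nx: "0 \<le> N x" by (rule N_nonneg[OF x])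
    obtain K where K: "inverse (real (Suc K)) < e / (2 * (N x + 1))"
      using reals_Archimedean[of "e / (2 * (N x + 1))"] e Nx by auto
    have "N (pR (P m) x - pR (P n) x) < e" if mn: "m \<ge> K" "n \<ge> K" for m n
    proof -
      have "inverse (real (Suc m)) \<le> inverse (real (Suc K))" "inverse (real (Suc n)) \<le> inverse (real (Suc K))"
        using mn by (auto intro!: le_imp_inverse_le)
      then have "N (pR (P m) x - pR (P n) x) \<le> (2 * inverse (real (Suc K))) * N x"
        using close[OF P[of _ m], of n] mult_right_mono[OF _ Nx] by (smt (verit))
      also have "\<dots> \<le> (2 * inverse (real (Suc K))) * (N x + 1)" by (intro mult_left_mono) auto
      also have "\<dots> < e" using K Nx by (simp add: field_simps)
      finally show ?thesis .
    qed
    then show ?thesis by blast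
  qed
  then obtain y where y: "y \<in> H" and lim: "(\<lambda>n. N (pR (P n) x - y)) \<longlonglongrightarrow> 0"
    using complete_H[of "\<lambda>n. pR (P n) x"] x by auto
  have "N (pR p x - y) \<le> M * N x" if "\<forall>t\<in>{0..1}. \<bar>poly p t - f t\<bar> \<le> M" for p M
  proof (rule LIMSEQ_le_const)
    show "(\<lambda>n. (M + inverse (real (Suc n))) * N x + N (pR (P n) x - y)) \<longlonglongrightarrow> M * N x"
      using tendsto_add[OF tendsto_mult_right[OF tendsto_add[OF tendsto_const LIMSEQ_inverse_real_of_nat]] lim]
      by simp
    have "N (pR p x - y) \<le> (M + inverse (real (Suc n))) * N x + N (pR (P n) x - y)" for n
      using close[of p M n] that N_triangle_via[of "pR p x" "pR (P n) x" y] x y by auto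
    then show "\<exists>K. \<forall>n\<ge>K. N (pR p x - y) \<le> (M + inverse (real (Suc n))) * N x + N (pR (P n) x - y)"
      by blast
  qed
  then have *: "\<exists>y. y \<in> H \<and> (\<forall>p M. (\<forall>t\<in>{0..1}. \<bar>poly p t - f t\<bar> \<le> M) \<longrightarrow> N (pR p x - y) \<le> M * N x)"
    using y by blast
  note s = someI_ex[OF *, folded fc_def]
  show "fc f x \<in> H" using s by blast
  show "(\<And>t. t \<in> {0..1} \<Longrightarrow> \<bar>poly p t - f t\<bar> \<le> M) \<Longrightarrow> N (pR p x - fc f x) \<le> M * N x"
    using s by blast
qed

lemmas fc_mem [simp] = fc_spec(1)

text \<open>The algebraic rules for \<open>fc\<close> reduce to this: it suffices to find
  polynomials that match the function and the vector up to a fixed multiple of \<open>e\<close>.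
  Only small \<open>e\<close> have to be treated, so that approximating polynomials stay bounded in
  products.\<close>

lemma fc_eqI:
  assumes f: "continuous_on {0..1} f" and x: "x \<in> H" and y: "y \<in> H"
    and approx: "\<And>e. \<lbrakk>0 < e; e \<le> 1\<rbrakk> \<Longrightarrow> \<exists>p. (\<forall>t\<in>{0..1}. \<bar>poly p t - f t\<bar> \<le> C * e) \<and> N (pR p x - y) \<le> C * e"
  shows "fc f x = y"
proof (rule N_le_zero_imp_eq)
  fix d :: real assume d: "d > 0"
  \<comment> \<open>The minimum with 1 meets the restriction on \<open>e\<close>; the summands
    \<open>+ 1\<close> keep the denominator positive.\<close>
  define e where "e = min 1 (d / ((\<bar>C\<bar> + 1) * (N x + 1)))"
  have Nx: "0 \<le> N x" by (rule N_nonneg[OF x])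
  have e: "0 < e" "e \<le> 1" using d Nx by (auto simp: e_def)
  have "e \<le> d / ((\<bar>C\<bar> + 1) * (N x + 1))" by (simp add: e_def)
  moreover have K: "0 < (\<bar>C\<bar> + 1) * (N x + 1)" using Nx by (intro mult_pos_pos) auto
  ultimately have ed: "(\<bar>C\<bar> + 1) * (N x + 1) * e \<le> d" by (simp only: pos_le_divide_eq[OF K] mult.commute)
  obtain p where p: "\<And>t. t \<in> {0..1} \<Longrightarrow> \<bar>poly p t - f t\<bar> \<le> C * e" "N (pR p x - y) \<le> C * e"
    using approx[OF e] by blast
  have "N (fc f x - y) \<le> N (pR p x - fc f x) + N (pR p x - y)"
    using N_triangle_via[of "fc f x" "pR p x" y] N_commute[of "fc f x" "pR p x"] x y f by simp
  also have "\<dots> \<le> C * e * N x + C * e" using fc_spec(2)[OF f x p(1)] p(2) by simp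
  also have "\<dots> = C * (e * (N x + 1))" by (simp add: algebra_simps)
  also have "\<dots> \<le> (\<bar>C\<bar> + 1) * (e * (N x + 1))" using e Nx by (intro mult_right_mono) auto
  also have "\<dots> \<le> d" using ed by (simp add: mult_ac)
  finally show "N (fc f x - y) \<le> d" .
qed (use assms in auto)

lemma fc_poly: assumes "x \<in> H" "\<And>t. t \<in> {0..1} \<Longrightarrow> poly p t = f t" shows "fc f x = pR p x"
proof (rule fc_eqI[where C=1])
  have "continuous_on {0..1} (poly p)" by (intro continuous_intros)
  then show "continuous_on {0..1} f" by (rule continuous_on_eq) (use assms in auto)
  show "\<exists>p'. (\<forall>t\<in>{0..1}. \<bar>poly p' t - f t\<bar> \<le> 1 * e) \<and> N (pR p' x - pR p x) \<le> 1 * e" if "0 < e" for e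
    using assms that by (intro exI[of _ p]) auto
qed (use assms in auto)

lemma fc_1: "x \<in> H \<Longrightarrow> fc (\<lambda>t. 1) x = x"
  using fc_poly[of x 1 "\<lambda>t. 1"] by simp

lemma fc_id: "x \<in> H \<Longrightarrow> fc (\<lambda>t. t) x = R x"
  using fc_poly[of x "[:0, 1:]" "\<lambda>t. t"] by simp

lemma fc_0: "x \<in> H \<Longrightarrow> fc (\<lambda>t. 0) x = 0"
  using fc_poly[of x 0 "\<lambda>t. 0"] by simp

text \<open>The polynomial is chosen before the vector, which the rules that compare
  \<open>fc f\<close> at several vectors rely on.\<close>

lemma fc_approx:
  assumes f: "continuous_on {0..1} f" and "e > 0"
  obtains p where "\<And>t. t \<in> {0..1} \<Longrightarrow> \<bar>poly p t - f t\<bar> \<le> e"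
    "\<And>x. x \<in> H \<Longrightarrow> N (pR p x - fc f x) \<le> e * N x"
proof -
  obtain p where "\<And>t. t \<in> {0..1} \<Longrightarrow> \<bar>poly p t - f t\<bar> \<le> e" using Weierstrass_poly[OF assms] by metis
  then show ?thesis using that fc_spec(2)[OF f] by blast
qed

lemma fc_bound:
  assumes f: "continuous_on {0..1} f" and x: "x \<in> H" and M: "\<And>t. t \<in> {0..1} \<Longrightarrow> \<bar>f t\<bar> \<le> M"
  shows "N (fc f x) \<le> M * N x"
proof (rule field_le_epsilon)
  fix d :: real assume d: "d > 0"
  have Nx: "0 \<le> N x" by (rule N_nonneg[OF x])
  from exists_scaled[OF Nx half_gt_zero[OF d]] obtain e where e: "e > 0" and ed: "e * (N x + 1) = d / 2" by blast
  obtain p where p: "\<And>t. t \<in> {0..1} \<Longrightarrow> \<bar>poly p t - f t\<bar> \<le> e" "N (pR p x - fc f x) \<le> e * N x"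
    using fc_approx[OF f e] x by metis
  have "\<bar>poly p t\<bar> \<le> M + e" if "t \<in> {0..1}" for t using p(1)[OF that] M[OF that] by linarith
  then have "N (pR p x) \<le> (M + e) * N x" by (rule pR_bound[OF x])
  moreover have "N (fc f x) \<le> N (pR p x - fc f x) + N (pR p x)"
    using N_diff_le[of "pR p x" "pR p x - fc f x"] x f by simp
  ultimately have "N (fc f x) \<le> M * N x + 2 * e * N x" using p(2) by (simp add: algebra_simps)
  also have "2 * e * N x \<le> 2 * e * (N x + 1)" using e by (intro mult_left_mono) auto
  also have "2 * e * (N x + 1) = d" using ed by (simp add: algebra_simps)
  finally show "N (fc f x) \<le> M * N x + d" by simp
qed

lemma fc_add:
  assumes f: "continuous_on {0..1} f" and g: "continuous_on {0..1} g" and x: "x \<in> H"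
  shows "fc (\<lambda>t. f t + g t) x = fc f x + fc g x"
proof (rule fc_eqI[where C="2 * N x + 2"])
  fix e :: real assume e: "0 < e"
  obtain p where p: "\<And>t. t \<in> {0..1} \<Longrightarrow> \<bar>poly p t - f t\<bar> \<le> e" "N (pR p x - fc f x) \<le> e * N x"
    using fc_approx[OF f e] x by metis
  obtain q where q: "\<And>t. t \<in> {0..1} \<Longrightarrow> \<bar>poly q t - g t\<bar> \<le> e" "N (pR q x - fc g x) \<le> e * N x"
    using fc_approx[OF g e] x by metis
  have Nx: "0 \<le> N x" by (rule N_nonneg[OF x])
  show "\<exists>p. (\<forall>t\<in>{0..1}. \<bar>poly p t - (f t + g t)\<bar> \<le> (2 * N x + 2) * e) \<and>
    N (pR p x - (fc f x + fc g x)) \<le> (2 * N x + 2) * e"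
  proof (intro exI[of _ "p + q"] conjI ballI)
    fix t :: real assume "t \<in> {0..1}"
    then have "\<bar>poly (p + q) t - (f t + g t)\<bar> \<le> 2 * e" using p(1)[of t] q(1)[of t] by simp
    also have "\<dots> \<le> (2 * N x + 2) * e" using e Nx by (intro mult_right_mono) auto
    finally show "\<bar>poly (p + q) t - (f t + g t)\<bar> \<le> (2 * N x + 2) * e" .
  next
    have "pR (p + q) x - (fc f x + fc g x) = (pR p x - fc f x) + (pR q x - fc g x)"
      using x by (simp add: pR_add)
    then have "N (pR (p + q) x - (fc f x + fc g x)) \<le> 2 * N x * e"
      using N_triangle[of "pR p x - fc f x" "pR q x - fc g x"] p(2) q(2) x f g by (simp add: algebra_simps)
    then show "N (pR (p + q) x - (fc f x + fc g x)) \<le> (2 * N x + 2) * e" using e by (simp add: algebra_simps)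
  qed
qed (use assms in \<open>auto intro: continuous_intros\<close>)

text \<open>The inner function is approximated at \<open>x\<close> and the outer one at the vector
  \<open>fc g x\<close>. The error splits into \<open>p(R)\<close> applied to the inner error plus
  the outer error at \<open>fc g x\<close>.\<close>

lemma fc_mult:
  assumes f: "continuous_on {0..1} f" and g: "continuous_on {0..1} g" and x: "x \<in> H"
  shows "fc (\<lambda>t. f t * g t) x = fc f (fc g x)"
proof -
  obtain B where B: "\<And>t. t \<in> {0..1} \<Longrightarrow> \<bar>f t\<bar> \<le> B" "\<And>t. t \<in> {0..1} \<Longrightarrow> \<bar>g t\<bar> \<le> B" "0 \<le> B"
  proof -
    have "compact (f ` {0..1})" "compact (g ` {0..1})"
      using f g by (auto intro: compact_continuous_image)
    then obtain B1 B2 where "\<And>t. t \<in> {0..1} \<Longrightarrow> \<bar>f t\<bar> \<le> B1" "\<And>t. t \<in> {0..1} \<Longrightarrow> \<bar>g t\<bar> \<le> B2"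
      by (force dest!: compact_imp_bounded simp: bounded_iff)
    then show ?thesis by (intro that[of "max \<bar>B1\<bar> \<bar>B2\<bar>"]) (force simp: le_max_iff_disj)+
  qed
  have Nx: "0 \<le> N x" by (rule N_nonneg[OF x])
  have gx: "fc g x \<in> H" using g x by simp
  have Ngx: "N (fc g x) \<le> B * N x" using fc_bound[OF g x] B by simp
  show ?thesis
  proof (rule fc_eqI[where C="(2 * B + 1) * (N x + 1)"])
    fix e :: real assume e: "0 < e" "e \<le> 1"
    obtain p where p: "\<And>t. t \<in> {0..1} \<Longrightarrow> \<bar>poly p t - f t\<bar> \<le> e" "N (pR p (fc g x) - fc f (fc g x)) \<le> e * N (fc g x)"
      using fc_approx[OF f e(1)] gx by metis
    obtain q where q: "\<And>t. t \<in> {0..1} \<Longrightarrow> \<bar>poly q t - g t\<bar> \<le> e" "N (pR q x - fc g x) \<le> e * N x"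
      using fc_approx[OF g e(1)] x by metis
    \<comment> \<open>This is where \<open>e \<le> 1\<close> enters.\<close>
    have pB: "\<bar>poly p t\<bar> \<le> B + 1" if "t \<in> {0..1}" for t using p(1)[OF that] B(1)[OF that] e by linarith
    show "\<exists>p. (\<forall>t\<in>{0..1}. \<bar>poly p t - f t * g t\<bar> \<le> (2 * B + 1) * (N x + 1) * e) \<and>
      N (pR p x - fc f (fc g x)) \<le> (2 * B + 1) * (N x + 1) * e"
    proof (intro exI[of _ "p * q"] conjI ballI)
      fix t :: real assume t: "t \<in> {0..1}"
      have "poly (p * q) t - f t * g t = poly p t * (poly q t - g t) + (poly p t - f t) * g t"
        by (simp add: algebra_simps)
      then have "\<bar>poly (p * q) t - f t * g t\<bar> \<le> \<bar>poly p t\<bar> * \<bar>poly q t - g t\<bar> + \<bar>poly p t - f t\<bar> * \<bar>g t\<bar>"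
        by (metis abs_mult abs_triangle_ineq)
      also have "\<dots> \<le> (B + 1) * e + e * B"
        using p(1)[OF t] q(1)[OF t] pB[OF t] B t e by (intro add_mono mult_mono) auto
      also have "\<dots> = (2 * B + 1) * 1 * e" by (simp add: algebra_simps)
      also have "\<dots> \<le> (2 * B + 1) * (N x + 1) * e"
        using Nx B e by (intro mult_right_mono mult_left_mono) auto
      finally show "\<bar>poly (p * q) t - f t * g t\<bar> \<le> (2 * B + 1) * (N x + 1) * e" .
    next
      have "pR (p * q) x - fc f (fc g x) = pR p (pR q x - fc g x) + (pR p (fc g x) - fc f (fc g x))"
        using x gx by (simp add: pR_mult pR_diff_arg)
      then have "N (pR (p * q) x - fc f (fc g x)) \<le> N (pR p (pR q x - fc g x)) + N (pR p (fc g x) - fc f (fc g x))"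
        by (simp only:) (rule N_triangle, use x gx f in auto)
      also have "\<dots> \<le> (B + 1) * (e * N x) + e * (B * N x)"
      proof (rule add_mono)
        have "N (pR p (pR q x - fc g x)) \<le> (B + 1) * N (pR q x - fc g x)" using pB x gx by (intro pR_bound) auto
        also have "\<dots> \<le> (B + 1) * (e * N x)" using q(2) B by (intro mult_left_mono) auto
        finally show "N (pR p (pR q x - fc g x)) \<le> (B + 1) * (e * N x)" .
        show "N (pR p (fc g x) - fc f (fc g x)) \<le> e * (B * N x)"
          using order_trans[OF p(2) mult_left_mono[OF Ngx]] e by simp
      qed
      also have "\<dots> = (2 * B + 1) * N x * e" by (simp add: algebra_simps)
      also have "\<dots> \<le> (2 * B + 1) * (N x + 1) * e"
        using Nx B e by (intro mult_right_mono mult_left_mono) auto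
      finally show "N (pR (p * q) x - fc f (fc g x)) \<le> (2 * B + 1) * (N x + 1) * e" .
    qed
  qed (use assms gx in \<open>auto intro: continuous_intros\<close>)
qed

lemma fc_scale:
  assumes "continuous_on {0..1} f" "x \<in> H"
  shows "fc (\<lambda>t. c * f t) x = c *\<^sub>R fc f x"
  using assms fc_mult[of "\<lambda>t. c" f x] fc_poly[of "fc f x" "[:c:]" "\<lambda>t. c"] by simp

lemma fc_diff:
  assumes "continuous_on {0..1} f" "continuous_on {0..1} g" "x \<in> H"
  shows "fc (\<lambda>t. f t - g t) x = fc f x - fc g x"
  using fc_add[of f "\<lambda>t. -1 * g t" x] fc_scale[of g x "-1"] assms by (simp add: continuous_on_minus)

lemma fc_add_arg:
  assumes f: "continuous_on {0..1} f" and x: "x \<in> H" and y: "y \<in> H"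
  shows "fc f (x + y) = fc f x + fc f y"
proof (rule fc_eqI[where C="N x + N y + 1"])
  fix e :: real assume e: "0 < e"
  obtain p where p: "\<And>t. t \<in> {0..1} \<Longrightarrow> \<bar>poly p t - f t\<bar> \<le> e" "\<And>x. x \<in> H \<Longrightarrow> N (pR p x - fc f x) \<le> e * N x"
    using fc_approx[OF f e] by metis
  have Nx: "0 \<le> N x" "0 \<le> N y" using N_nonneg x y by auto
  have "pR p (x + y) - (fc f x + fc f y) = (pR p x - fc f x) + (pR p y - fc f y)"
    using x y by (simp add: pR_add_arg)
  then have "N (pR p (x + y) - (fc f x + fc f y)) \<le> (N x + N y) * e"
    using N_triangle[of "pR p x - fc f x" "pR p y - fc f y"] p(2)[OF x] p(2)[OF y] x y f by (simp add: algebra_simps)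
  moreover have "e \<le> (N x + N y + 1) * e" using e Nx by simp
  ultimately show "\<exists>p. (\<forall>t\<in>{0..1}. \<bar>poly p t - f t\<bar> \<le> (N x + N y + 1) * e) \<and>
      N (pR p (x + y) - (fc f x + fc f y)) \<le> (N x + N y + 1) * e"
    using p(1) e by (intro exI[of _ p] conjI ballI) (fastforce simp: algebra_simps)+
qed (use assms in auto)

text \<open>A scalar is \<open>fc\<close> of a constant function, so multiplicativity
  applies.\<close>

lemma fc_scale_arg:
  assumes "continuous_on {0..1} f" "x \<in> H"
  shows "fc f (c *\<^sub>R x) = c *\<^sub>R fc f x"
proof -
  have "fc f (c *\<^sub>R x) = fc f (fc (\<lambda>t. c) x)" using fc_poly[of x "[:c:]" "\<lambda>t. c"] assms by simp
  also have "\<dots> = fc (\<lambda>t. c * f t) x" using fc_mult[of f "\<lambda>t. c" x] assms by (simp add: mult.commute)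
  also have "\<dots> = c *\<^sub>R fc f x" using fc_scale assms by blast
  finally show ?thesis .
qed

lemma fc_minus_arg: "\<lbrakk>continuous_on {0..1} f; x \<in> H\<rbrakk> \<Longrightarrow> fc f (- x) = - fc f x"
  using fc_scale_arg[of f x "-1"] by simp

lemma fc_diff_arg: "\<lbrakk>continuous_on {0..1} f; x \<in> H; y \<in> H\<rbrakk> \<Longrightarrow> fc f (x - y) = fc f x - fc f y"
  using fc_add_arg[of f x "-y"] fc_minus_arg[of f y] by simp

lemma fc_sym:
  assumes f: "continuous_on {0..1} f" and x: "x \<in> H" and y: "y \<in> H"
  shows "ip (fc f x) y = ip x (fc f y)"
proof -
  have Nx: "0 \<le> N x * N y" using N_nonneg x y by simp
  have bound: "\<bar>ip (fc f x) y - ip x (fc f y)\<bar> \<le> e * (2 * (N x * N y))" if e: "e > 0" for e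
  proof -
    obtain p where p: "\<And>x. x \<in> H \<Longrightarrow> N (pR p x - fc f x) \<le> e * N x"
      using fc_approx[OF f e] by metis
    have eq: "ip (fc f x) y - ip x (fc f y) = ip x (pR p y - fc f y) - ip (pR p x - fc f x) y"
      using x y f by (simp add: ip_simps pR_sym)
    have "\<bar>ip (fc f x) y - ip x (fc f y)\<bar> \<le> N x * N (pR p y - fc f y) + N (pR p x - fc f x) * N y"
      unfolding eq
      using Cauchy_Schwarz[of x "pR p y - fc f y"] Cauchy_Schwarz[of "pR p x - fc f x" y] x y f by simp
    also have "\<dots> \<le> N x * (e * N y) + (e * N x) * N y"
      using p[OF x] p[OF y] N_nonneg[OF x] N_nonneg[OF y] by (intro add_mono mult_left_mono mult_right_mono)
    finally show ?thesis by (simp add: algebra_simps)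
  qed
  have "\<bar>ip (fc f x) y - ip x (fc f y)\<bar> \<le> d" if d: "d > 0" for d
  proof -
    have "0 \<le> 2 * (N x * N y)" using Nx by simp
    then obtain e where e: "e > 0" "e * (2 * (N x * N y) + 1) = d" using exists_scaled[OF _ d] by blast
    have "e * (2 * (N x * N y)) \<le> d" using e by (simp add: algebra_simps)
    then show ?thesis using bound[OF e(1)] by linarith
  qed
  then have "\<bar>ip (fc f x) y - ip x (fc f y)\<bar> \<le> 0" by (metis dense_ge)
  then show ?thesis by simp
qed

end

section \<open>Symbols of the semigroup\<close>

text \<open>The symbol of \<open>exp (- z A)\<close> in the spectral variable \<open>r\<close> of \<open>R = (1 + A)\<^sup>-\<^sup>1\<close>: the spectral
  variable of \<open>A\<close> is \<open>1 / r - 1\<close>, and \<open>r = 0\<close> corresponds to infinity.\<close>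

definition heat :: "complex \<Rightarrow> real \<Rightarrow> complex" where
  "heat z r = (if z = 0 then 1 else if r = 0 then 0 else exp (- z * of_real (1 / r - 1)))"

text \<open>Symbols are given by a formula on \<open>{0<..1}\<close> only; the bound linear in
  \<open>r\<close> forces the limit 0 at the added point.\<close>

lemma continuous_on_extend_0:
  fixes h :: "real \<Rightarrow> complex"
  assumes h: "continuous_on {0<..1} h" and bound: "\<And>r. r \<in> {0<..1} \<Longrightarrow> cmod (h r) \<le> C * r"
  shows "continuous_on {0..1} (\<lambda>r. if r = 0 then 0 else h r)"
  unfolding continuous_on_eq_continuous_within
proof
  fix r :: real assume r: "r \<in> {0..1}"
  let ?f = "\<lambda>r. if r = 0 then 0 else h r"
  show "continuous (at r within {0..1}) ?f"
  proof (cases "r = 0")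
    case True
    have "((\<lambda>r. C * r) \<longlongrightarrow> C * 0) (at 0 within {0..1})" by (intro tendsto_intros)
    then have "((\<lambda>r. C * r) \<longlongrightarrow> 0) (at 0 within {0..1})" by simp
    then have "(?f \<longlongrightarrow> 0) (at 0 within {0..1})"
    proof (rule Lim_null_comparison[rotated])
      show "\<forall>\<^sub>F r in at 0 within {0..1}. cmod (?f r) \<le> C * r"
        unfolding eventually_at_filter using bound by (auto intro!: always_eventually)
    qed
    then show ?thesis using True by (simp add: continuous_within)
  next
    case False
    then have r': "r \<in> {0<..1}" "r > 0" using r by auto
    have "(h \<longlongrightarrow> h r) (at r within {0<..1})" using h r' by (auto simp: continuous_on_def)
    moreover have "at r within {0<..1} = at r within {0..1}"
      by (rule at_within_nhd[of _ "{0<..}"]) (use r' in auto)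
    ultimately have "(h \<longlongrightarrow> h r) (at r within {0..1})" by simp
    moreover have "\<forall>\<^sub>F s in nhds r. s \<in> {0<..}" by (rule eventually_nhds_in_open) (use r' in auto)
    then have "\<forall>\<^sub>F s in at r within {0..1}. h s = ?f s"
      unfolding eventually_at_filter by (rule eventually_mono) auto
    ultimately have "(?f \<longlongrightarrow> h r) (at r within {0..1})" by (simp only: tendsto_cong)
    then show ?thesis using False by (simp add: continuous_within)
  qed
qed

text \<open>Combines \<open>exp y \<ge> 1 + y\<close> with
  \<open>r + x * (1 - r) \<ge> min 1 x\<close>.\<close>

lemma exp_neg_resolvent_bound:
  fixes x r :: real
  assumes x: "x > 0" and r: "r \<in> {0<..1}"
  shows "exp (- x * (1 / r - 1)) \<le> (1 / min 1 x) * r"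
proof -
  have s: "0 \<le> 1 / r - 1" using r by simp
  have "min 1 x / r \<le> 1 + x * (1 / r - 1)"
  proof -
    have "min 1 x * 1 = min 1 x * r + min 1 x * (1 - r)" by (simp add: algebra_simps)
    also have "\<dots> \<le> 1 * r + x * (1 - r)" using r by (intro add_mono mult_right_mono) auto
    finally have "min 1 x / r \<le> (r + x * (1 - r)) / r" using r by (intro divide_right_mono) auto
    then show ?thesis using r by (simp add: field_simps)
  qed
  also have "\<dots> \<le> exp (x * (1 / r - 1))" by (rule exp_ge_add_one_self)
  finally have "1 / exp (x * (1 / r - 1)) \<le> 1 / (min 1 x / r)"
    using x r by (intro divide_left_mono) auto
  moreover have "1 / (min 1 x / r) = (1 / min 1 x) * r" by simp
  moreover have "1 / exp (x * (1 / r - 1)) = exp (- x * (1 / r - 1))"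
    by (simp only: mult_minus_left exp_minus inverse_eq_divide)
  ultimately show ?thesis by (simp only:)
qed

lemma cont_spectral: "continuous_on {0<..1} (\<lambda>r. complex_of_real (1 / r - 1))"
  by (intro continuous_intros) auto

lemma norm_exp_spectral: "cmod (exp (- z * complex_of_real s)) = exp (- Re z * s)"
  by simp

lemma continuous_heat:
  assumes "z = 0 \<or> Re z > 0" shows "continuous_on {0..1} (heat z)"
proof (cases "z = 0")
  case False
  have "continuous_on {0..1} (\<lambda>r. if r = 0 then 0 else exp (- z * of_real (1 / r - 1)))"
  proof (rule continuous_on_extend_0)
    show "continuous_on {0<..1} (\<lambda>r. exp (- z * of_real (1 / r - 1)))"
      by (intro continuous_intros cont_spectral)
    show "cmod (exp (- z * of_real (1 / r - 1))) \<le> (1 / min 1 (Re z)) * r" if "r \<in> {0<..1}" for r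
      unfolding norm_exp_spectral by (rule exp_neg_resolvent_bound) (use assms False that in auto)
  qed
  then show ?thesis using False by (simp add: heat_def[abs_def])
qed (simp add: heat_def[abs_def])

text \<open>The delicate point is \<open>r = 0\<close>, where the value depends on whether the time
  is zero: times of positive real part never add up to zero.\<close>

lemma heat_add:
  assumes "z = 0 \<or> Re z > 0" "z' = 0 \<or> Re z' > 0"
  shows "heat (z + z') r = heat z r * heat z' r"
proof -
  have "z + z' = 0 \<longleftrightarrow> z = 0 \<and> z' = 0" using assms by (auto simp: complex_eq_iff)
  moreover have "exp (- (z + z') * w) = exp (- z * w) * exp (- z' * w)" for w
    by (simp add: algebra_simps flip: exp_add)
  ultimately show ?thesis unfolding heat_def by (simp only: split: if_split) simp
qed

lemma norm_heat_le_1: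
  assumes "z = 0 \<or> Re z > 0" "r \<in> {0..1}" shows "cmod (heat z r) \<le> 1"
proof (cases "z = 0 \<or> r = 0")
  case False
  then have "0 \<le> Re z * (1 / r - 1)" using assms by (intro mult_nonneg_nonneg) auto
  then have "exp (- Re z * (1 / r - 1)) \<le> 1" by simp
  moreover have "heat z r = exp (- z * of_real (1 / r - 1))" using False by (simp add: heat_def)
  ultimately show ?thesis by (simp only: norm_exp_spectral)
qed (auto simp: heat_def)

text \<open>The derivative of \<open>exp\<close> has modulus at most 1 on the left half-plane, which
  is convex.\<close>

lemma norm_exp_diff_le:
  assumes "Re a \<le> 0" "Re b \<le> 0" shows "cmod (exp a - exp b) \<le> cmod (a - b)"
proof -
  have "cmod (exp a - exp b) \<le> 1 * cmod (a - b)"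
  proof (rule field_differentiable_bound[where S="{z. Re z \<le> 0}"])
    show "convex {z. Re z \<le> 0}" by (rule convex_halfspace_Re_le)
    show "(exp has_field_derivative exp z) (at z within {z. Re z \<le> 0})" for z :: complex
      using DERIV_exp has_field_derivative_at_within by blast
  qed (use assms in auto)
  then show ?thesis by simp
qed

text \<open>The spectral variable \<open>1 / r - 1\<close> of \<open>A\<close> is unbounded, so
  \<open>heat z - 1\<close> alone is not uniformly small as \<open>z\<close> tends to 0. The factor
  \<open>r\<close> turns it into \<open>1 - r\<close> and restores uniformity.\<close>

lemma heat_diff_1:
  assumes z: "z = 0 \<or> Re z > 0" and r: "r \<in> {0..1}"
  shows "cmod ((heat z r - 1) * of_real r) \<le> cmod z"
proof (cases "z = 0 \<or> r = 0")
  case False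
  then have r0: "r > 0" "r \<le> 1" using r by auto
  have "0 \<le> Re z * (1 / r - 1)" using z r0 False by (intro mult_nonneg_nonneg) auto
  then have "cmod (exp (- z * of_real (1 / r - 1)) - exp 0) \<le> cmod (- z * of_real (1 / r - 1) - 0)"
    by (intro norm_exp_diff_le) auto
  then have "cmod (heat z r - 1) \<le> cmod z * (1 / r - 1)"
    using False r0 by (simp add: heat_def norm_mult del: of_real_diff of_real_divide)
  then have "cmod (heat z r - 1) * r \<le> cmod z * (1 / r - 1) * r" using r0 by (intro mult_right_mono) auto
  also have "\<dots> = cmod z * (1 - r)" using r0 by (simp add: field_simps)
  also have "\<dots> \<le> cmod z" using r0 by (simp add: mult_left_le)
  finally show ?thesis using r0 by (simp add: norm_mult)
qed (auto simp: heat_def)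

definition heat_deriv :: "complex \<Rightarrow> real \<Rightarrow> complex" where
  "heat_deriv z r = (if r = 0 then 0 else - of_real (1 / r - 1) * exp (- z * of_real (1 / r - 1)))"

lemma continuous_heat_deriv:
  assumes z: "Re z > 0" shows "continuous_on {0..1} (heat_deriv z)"
proof -
  have "continuous_on {0..1} (\<lambda>r. if r = 0 then 0 else - of_real (1 / r - 1) * exp (- z * of_real (1 / r - 1)))"
  proof (rule continuous_on_extend_0)
    show "continuous_on {0<..1} (\<lambda>r. - of_real (1 / r - 1) * exp (- z * of_real (1 / r - 1)))"
      by (intro continuous_intros cont_spectral)
    fix r :: real assume r: "r \<in> {0<..1}"
    let ?s = "1 / r - 1" and ?x = "Re z"
    have s: "0 \<le> ?s" using r by simp
    \<comment> \<open>Half of the exponential decay pays for the factor \<open>1 / r - 1\<close>,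
      the other half yields the bound linear in \<open>r\<close>.\<close>
    have "?x / 2 * ?s \<le> exp (?x / 2 * ?s)" using exp_ge_add_one_self[of "?x / 2 * ?s"] by linarith
    then have "?s \<le> (2 / ?x) * exp (?x / 2 * ?s)" using z by (simp add: field_simps)
    then have "?s * exp (- ?x * ?s) \<le> (2 / ?x) * exp (?x / 2 * ?s) * exp (- ?x * ?s)"
      by (rule mult_right_mono) simp
    also have "\<dots> = (2 / ?x) * exp (- (?x / 2) * ?s)" by (simp add: field_simps flip: exp_add)
    also have "\<dots> \<le> (2 / ?x) * ((1 / min 1 (?x / 2)) * r)"
      using z by (intro mult_left_mono exp_neg_resolvent_bound r) auto
    finally have "?s * exp (- ?x * ?s) \<le> (2 / ?x * (1 / min 1 (?x / 2))) * r" by (simp add: mult.assoc)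
    then show "cmod (- of_real ?s * exp (- z * of_real ?s)) \<le> (2 / ?x * (1 / min 1 (?x / 2))) * r"
      unfolding norm_mult norm_minus_cancel norm_exp_spectral norm_of_real using s by simp
  qed
  then show ?thesis by (simp add: heat_deriv_def[abs_def])
qed

text \<open>With \<open>s = 1 / r - 1\<close> and \<open>w = z' - z\<close>, the Taylor remainder is
  at most \<open>exp (Re z / 2 * s) * (cmod w * s)\<^sup>2\<close>, since
  \<open>cmod w \<le> Re z / 2\<close>. Half of the decay of \<open>exp (- Re z * s)\<close> is left
  to absorb \<open>s\<^sup>2\<close>: for \<open>t = Re z / 2 * s\<close> one has
  \<open>t\<^sup>2 \<le> 2 * exp t\<close>, which gives \<open>8 / (Re z)\<^sup>2\<close>.\<close>

lemma heat_deriv_remainder: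
  assumes z: "Re z > 0" and w: "cmod (z' - z) \<le> Re z / 2" and r: "r \<in> {0..1}"
  shows "cmod (heat z' r - heat z r - (z' - z) * heat_deriv z r) \<le> 8 / (Re z)\<^sup>2 * (cmod (z' - z))\<^sup>2"
proof (cases "r = 0")
  case True
  have "z' \<noteq> 0" using w z complex_Re_le_cmod[of z] by (auto simp: norm_minus_commute)
  then show ?thesis using True z by (auto simp: heat_def heat_deriv_def)
next
  case False
  define s where "s = 1 / r - 1"
  have s: "0 \<le> s" using False r by (simp add: s_def)
  let ?w = "z' - z"
  have z0: "z' \<noteq> 0" "z \<noteq> 0" using w z complex_Re_le_cmod[of z] by (auto simp: norm_minus_commute)
  have "heat z' r - heat z r - ?w * heat_deriv z r
      = exp (- z * of_real s) * (exp (- ?w * of_real s) - (\<Sum>i\<le>1. (- ?w * of_real s) ^ i / fact i))"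
  proof -
    have "exp (- z' * of_real s) = exp (- z * of_real s) * exp (- ?w * of_real s)"
      by (simp add: algebra_simps flip: exp_add)
    then show ?thesis using False z0 by (simp add: heat_def heat_deriv_def algebra_simps flip: s_def of_real_divide of_real_diff)
  qed
  then have "cmod (heat z' r - heat z r - ?w * heat_deriv z r)
      = exp (- Re z * s) * cmod (exp (- ?w * of_real s) - (\<Sum>i\<le>1. (- ?w * of_real s) ^ i / fact i))"
    by (simp only: norm_mult norm_exp_spectral)
  also have "\<dots> \<le> exp (- Re z * s) * (exp \<bar>Re (- ?w * of_real s)\<bar> * cmod (- ?w * of_real s) ^ Suc 1 / fact 1)"
    by (intro mult_left_mono Taylor_exp) auto
  also have "\<dots> \<le> exp (- Re z * s) * (exp (Re z / 2 * s) * (cmod ?w * s)\<^sup>2)"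
  proof -
    have "\<bar>Re (- ?w * of_real s)\<bar> \<le> cmod (- ?w * of_real s)" by (rule abs_Re_le_cmod)
    also have "\<dots> = cmod ?w * s" using s by (simp add: norm_mult norm_minus_commute)
    also have "\<dots> \<le> Re z / 2 * s" using w s by (intro mult_right_mono)
    finally have "exp \<bar>Re (- ?w * of_real s)\<bar> \<le> exp (Re z / 2 * s)" by simp
    moreover have "cmod (- ?w * of_real s) = cmod ?w * s" using s by (simp add: norm_mult norm_minus_commute)
    ultimately show ?thesis by (simp add: power2_eq_square mult_left_mono mult_right_mono)
  qed
  also have "\<dots> = (cmod ?w)\<^sup>2 * (exp (- (Re z / 2 * s)) * s\<^sup>2)"
  proof -
    have "exp (- Re z * s) * exp (Re z / 2 * s) = exp (- (Re z / 2 * s))" by (simp flip: exp_add)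
    then show ?thesis by (simp add: power_mult_distrib mult_ac)
  qed
  also have "\<dots> \<le> (cmod ?w)\<^sup>2 * (8 / (Re z)\<^sup>2)"
  proof (rule mult_left_mono)
    let ?t = "Re z / 2 * s"
    have "?t\<^sup>2 / 2 \<le> exp ?t" using exp_lower_Taylor_quadratic[of ?t] mult_nonneg_nonneg[of "Re z / 2" s] z s by linarith
    then have "exp (- ?t) * (?t\<^sup>2 / 2) \<le> exp (- ?t) * exp ?t" by (intro mult_left_mono) auto
    then have "exp (- ?t) * (?t\<^sup>2 / 2) \<le> 1" by (simp flip: exp_add)
    then show "exp (- ?t) * s\<^sup>2 \<le> 8 / (Re z)\<^sup>2" using z by (simp add: field_simps)
  qed simp
  finally show ?thesis by (simp add: mult_ac)
qed

lemma heat_real: "heat (of_real t) r = of_real (if t = 0 then 1 else if r = 0 then 0 else exp (- t * (1 / r - 1)))"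
  by (simp add: heat_def exp_of_real[symmetric])

text \<open>\<open>G\<close> is the symbol of \<open>((T t - 1) / t + A) R\<close>, because
  \<open>A R\<close> has the symbol \<open>1 - r\<close>. The two bounds are the hypotheses of
  \<open>fc_tendsto_0\<close>: boundedness uniform in \<open>t\<close>, and smallness after one more
  factor \<open>r\<close>.\<close>

lemma heat_generator_symbol:
  fixes t r :: real
  assumes t: "t > 0" and r: "r \<in> {0..1}"
  defines "G \<equiv> (1 / t) * ((Re (heat (of_real t) r) - 1) * r) + (1 - r)"
  shows "\<bar>G\<bar> \<le> 2" "\<bar>G * r\<bar> \<le> t"
proof -
  show "\<bar>G\<bar> \<le> 2"
  proof -
    have "\<bar>(Re (heat (of_real t) r) - 1) * r\<bar> \<le> cmod ((heat (of_real t) r - 1) * of_real r)"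
      using abs_Re_le_cmod[of "(heat (of_real t) r - 1) * of_real r"] by simp
    also have "\<dots> \<le> cmod (of_real t)" by (rule heat_diff_1) (use t r in auto)
    finally have "\<bar>(1 / t) * ((Re (heat (of_real t) r) - 1) * r)\<bar> \<le> 1" using t by (simp add: abs_mult)
    then show ?thesis using r unfolding G_def atLeastAtMost_iff by linarith
  qed
  show "\<bar>G * r\<bar> \<le> t"
  proof (cases "r = 0")
    case False
    define s where "s = 1 / r - 1"
    have r0: "r > 0" using False r by auto
    have s: "0 \<le> s" "s * r = 1 - r" using r r0 by (auto simp: s_def field_simps)
    have y: "0 \<le> t * s" using t s by simp
    have "exp (- (t * s)) \<le> 1 - t * s + (t * s)\<^sup>2"
    proof -
      \<comment> \<open>Together with \<open>1 + y \<le> exp y\<close> this identity gives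
        \<open>exp (- y) \<le> 1 - y + y\<^sup>2\<close> for \<open>y \<ge> 0\<close>.\<close>
      have "(1 - y + y\<^sup>2) * (1 + y) = 1 + y ^ 3" for y :: real
        by (simp add: power2_eq_square power3_eq_cube algebra_simps)
      then have "1 \<le> (1 - t * s + (t * s)\<^sup>2) * (1 + t * s)" using y by simp
      also have "\<dots> \<le> (1 - t * s + (t * s)\<^sup>2) * exp (t * s)"
      proof (rule mult_left_mono)
        have "0 \<le> (1 - t * s)\<^sup>2 + t * s" using y by simp
        then show "0 \<le> 1 - t * s + (t * s)\<^sup>2" by (simp add: power2_eq_square algebra_simps)
      qed (use exp_ge_add_one_self[of "t * s"] in simp)
      finally show ?thesis by (simp add: exp_minus field_simps)
    qed
    moreover have "1 - t * s \<le> exp (- (t * s))" using exp_ge_add_one_self[of "- (t * s)"] by simp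
    ultimately have E: "\<bar>exp (- (t * s)) - 1 + t * s\<bar> \<le> (t * s)\<^sup>2" by simp
    have "G * r = (exp (- (t * s)) - 1 + t * s) * (r * r / t)"
      unfolding G_def heat_real s(2)[symmetric] using t r0 by (simp add: s_def[symmetric] field_simps)
    moreover have "0 \<le> r * r / t" using t r0 by simp
    ultimately have "\<bar>G * r\<bar> = \<bar>exp (- (t * s)) - 1 + t * s\<bar> * (r * r / t)" by (simp only: abs_mult abs_of_nonneg)
    also have "\<dots> \<le> (t * s)\<^sup>2 * (r * r / t)" using E \<open>0 \<le> r * r / t\<close> by (rule mult_right_mono)
    also have "\<dots> = t * (s * r)\<^sup>2" using t by (simp add: power2_eq_square)
    also have "\<dots> \<le> t * 1" using t r s(2) by (intro mult_left_mono) (auto simp: power_le_one)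
    finally show ?thesis by simp
  qed (use t in simp)
qed

section \<open>Operators with a bounded positive resolvent\<close>

locale selfadjoint_resolvent = resolvent +
  fixes A :: "'a \<Rightarrow> 'a" and D :: "'a set"
  assumes D_eq: "D = R ` H"
    and A_R: "f \<in> H \<Longrightarrow> A (R f) = f - R f"
begin

text \<open>\<open>A\<close> is a function, so \<open>x - R x = A (R x)\<close> depends on
  \<open>R x\<close> alone.\<close>

lemma R_inj: assumes "x \<in> H" "R x = 0" shows "x = 0"
  using A_R[of x] A_R[of 0] assms by simp

lemma D_subspace: "subspace D"
proof (rule subspaceI)
  show "0 \<in> D" unfolding D_eq by (rule image_eqI[of _ _ 0]) auto
  show "x + y \<in> D" if "x \<in> D" "y \<in> D" for x y
    using that R_add mem_H(2) unfolding D_eq by (metis (no_types, lifting) imageE imageI)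
  show "c *\<^sub>R x \<in> D" if "x \<in> D" for c x
    using that R_scale mem_H(4) unfolding D_eq by (metis (no_types, lifting) imageE imageI)
qed

lemma D_sub_H: "D \<subseteq> H"
  by (auto simp: D_eq)

text \<open>A symmetric injective operator has dense range: the difference of \<open>x\<close> and
  its projection \<open>p\<close> onto the closure of the range is orthogonal to the range, hence
  annihilated by \<open>R\<close>.\<close>

lemma R_dense: assumes x: "x \<in> H" and e: "e > 0" obtains y where "y \<in> H" "N (x - R y) < e"
proof -
  obtain p where p: "p \<in> H" "\<And>v. v \<in> D \<Longrightarrow> ip p v = ip x v" "\<And>e. e > 0 \<Longrightarrow> \<exists>d\<in>D. N (p - d) < e"
  proof (rule Riesz_subspace[OF D_subspace D_sub_H, of "ip x" "N x"])
    fix u v assume "u \<in> D" "v \<in> D"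
    then have "u \<in> H" "v \<in> H" using D_sub_H by auto
    then show "ip x (u + v) = ip x u + ip x v" "\<bar>ip x u\<bar> \<le> N x * N u" "ip x (c *\<^sub>R u) = c * ip x u" for c
      using x Cauchy_Schwarz by (auto simp: ip_simps)
  qed blast
  have "R (x - p) = 0"
  proof (rule ip_definite)
    have "ip (R (x - p)) (R (x - p)) = ip (x - p) (R (R (x - p)))" using x p(1) by (simp add: R_sym)
    also have "\<dots> = ip x (R (R (x - p))) - ip p (R (R (x - p)))" using x p(1) by (simp add: ip_simps)
    also have "\<dots> = 0" using p(2)[of "R (R (x - p))"] x p(1) by (simp add: D_eq)
    finally show "ip (R (x - p)) (R (x - p)) = 0" .
  qed (use x p in simp)
  then have "x = p" using R_inj[of "x - p"] x p(1) by simp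
  then show ?thesis using p(3)[OF e] that by (auto simp: D_eq)
qed

lemma A_linear: "linear_op H D A"
  unfolding linear_op_def
proof (intro conjI ballI allI D_subspace D_sub_H)
  show "A ` D \<subseteq> H" by (auto simp: D_eq A_R)
  fix u assume u: "u \<in> D"
  then obtain f where f: "f \<in> H" "u = R f" by (auto simp: D_eq)
  show "A (c *\<^sub>R u) = c *\<^sub>R A u" for c
    using f A_R[of "c *\<^sub>R f"] A_R[of f] by (simp add: R_scale scaleR_diff_right)
  fix v assume "v \<in> D"
  then obtain g where g: "g \<in> H" "v = R g" by (auto simp: D_eq)
  show "A (u + v) = A u + A v"
    using f g A_R[of "f + g"] A_R[of f] A_R[of g] by (simp add: R_add)
qed

lemma A_symmetric:
  assumes "u \<in> D" "v \<in> D" shows "ip (A u) v = ip u (A v)"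
  using assms by (auto simp: D_eq A_R ip_simps R_sym)

text \<open>Testing the adjoint relation with \<open>u = R f\<close> for arbitrary \<open>f\<close>
  turns it into \<open>ip f v = ip f (R (v + w))\<close>, so \<open>v = R (v + w)\<close> lies in
  the range of \<open>R\<close>.\<close>

lemma adjoint_graph_A: "adjoint_graph H ip D A = {(u, A u) | u. u \<in> D}"
proof (intro equalityI subsetI)
  fix z assume "z \<in> adjoint_graph H ip D A"
  then obtain v w where z: "z = (v, w)" "v \<in> H" "w \<in> H" "\<And>u. u \<in> D \<Longrightarrow> ip (A u) v = ip u w"
    by (auto simp: adjoint_graph_def)
  have "v - R (v + w) = 0"
  proof (rule ip_definite)
    have *: "ip f v = ip f (R (v + w))" if f: "f \<in> H" for f
    proof -
      have "ip (f - R f) v = ip (R f) w" using z(4)[of "R f"] f by (simp add: D_eq A_R)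
      then have "ip f v = ip (R f) (v + w)" using z f by (simp add: ip_simps)
      then show ?thesis using z f by (simp add: R_sym)
    qed
    show "ip (v - R (v + w)) (v - R (v + w)) = 0"
      using *[of "v - R (v + w)"] z by (simp add: ip_simps)
  qed (use z in simp)
  then have "v = R (v + w)" by simp
  then have "v \<in> D" "A v = w" using A_R[of "v + w"] z by (auto simp: D_eq)
  then show "z \<in> {(u, A u) | u. u \<in> D}" using z by auto
next
  fix z assume "z \<in> {(u, A u) | u. u \<in> D}"
  then obtain u where u: "z = (u, A u)" "u \<in> D" by auto
  have "A u \<in> H" using A_linear u by (auto simp: linear_op_def)
  then show "z \<in> adjoint_graph H ip D A"
    using u D_sub_H A_symmetric by (auto simp: adjoint_graph_def)
qed

lemma self_adjoint: "self_adjoint_op H ip D A"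
  unfolding self_adjoint_op_def densely_defined_def
proof (intro conjI ballI allI impI A_linear adjoint_graph_A)
  fix x and e :: real assume "x \<in> H" "e > 0"
  then obtain y where "y \<in> H" "N (x - R y) < e" by (rule R_dense)
  then show "\<exists>u\<in>D. N (x - u) < e" by (auto simp: D_eq)
qed

lemma nonneg: "nonneg_op ip D A"
  using R_pos by (auto simp: nonneg_op_def D_eq A_R ip_simps R_sym)

section \<open>Functional calculus on the complexification\<close>

definition cfc :: "(real \<Rightarrow> complex) \<Rightarrow> 'a \<times> 'a \<Rightarrow> 'a \<times> 'a" where
  "cfc F w = (fc (\<lambda>r. Re (F r)) (fst w) - fc (\<lambda>r. Im (F r)) (snd w),
     fc (\<lambda>r. Im (F r)) (fst w) + fc (\<lambda>r. Re (F r)) (snd w))"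

lemma cfc_mem:
  assumes "continuous_on {0..1} F" "w \<in> H \<times> H" shows "cfc F w \<in> H \<times> H"
proof -
  have "continuous_on {0..1} (\<lambda>r. Re (F r))" "continuous_on {0..1} (\<lambda>r. Im (F r))"
    using assms by (auto intro: continuous_intros)
  then show ?thesis using assms by (auto simp: cfc_def)
qed

lemma cfc_1: "w \<in> H \<times> H \<Longrightarrow> cfc (\<lambda>r. 1) w = w"
  by (auto simp: cfc_def fc_1 fc_0)

lemma fc_commute:
  assumes "continuous_on {0..1} f" "continuous_on {0..1} g" "x \<in> H"
  shows "fc f (fc g x) = fc g (fc f x)"
  using fc_mult[of f g x] fc_mult[of g f x] assms by (simp add: mult.commute)

lemma cfc_mult:
  assumes F: "continuous_on {0..1} F" and G: "continuous_on {0..1} G" and w: "w \<in> H \<times> H"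
  shows "cfc (\<lambda>r. F r * G r) w = cfc F (cfc G w)"
proof -
  have c: "continuous_on {0..1} (\<lambda>r. Re (F r))" "continuous_on {0..1} (\<lambda>r. Im (F r))"
    "continuous_on {0..1} (\<lambda>r. Re (G r))" "continuous_on {0..1} (\<lambda>r. Im (G r))"
    using F G by (auto intro: continuous_intros)
  obtain x y where [simp]: "w = (x, y)" and xy: "x \<in> H" "y \<in> H" using w by auto
  show ?thesis
    using fc_commute[OF c(1,4) xy(1)] fc_commute[OF c(1,4) xy(2)] c xy
    by (simp add: cfc_def fc_diff fc_add fc_mult fc_diff_arg fc_add_arg continuous_on_mult algebra_simps)
qed

lemma cfc_add_arg:
  assumes F: "continuous_on {0..1} F" and w: "w \<in> H \<times> H" "w' \<in> H \<times> H"
  shows "cfc F (w + w') = cfc F w + cfc F w'"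
proof -
  have c: "continuous_on {0..1} (\<lambda>r. Re (F r))" "continuous_on {0..1} (\<lambda>r. Im (F r))"
    using F by (auto intro: continuous_intros)
  show ?thesis using c w by (auto simp: cfc_def fc_add_arg)
qed

lemma cfc_cscale:
  assumes F: "continuous_on {0..1} F" and w: "w \<in> H \<times> H"
  shows "cfc F (cscale c w) = cscale c (cfc F w)"
proof -
  have c: "continuous_on {0..1} (\<lambda>r. Re (F r))" "continuous_on {0..1} (\<lambda>r. Im (F r))"
    using F by (auto intro: continuous_intros)
  show ?thesis using c w
    by (auto simp: cfc_def cscale_def fc_add_arg fc_diff_arg fc_scale_arg algebra_simps)
qed

text \<open>Each component is at most \<open>M * (N x + N y)\<close>. The resulting factor 2 does no
  harm: contractivity concerns the real semigroup, which \<open>fc_bound\<close> handles with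
  constant 1.\<close>

lemma cfc_bound:
  assumes F: "continuous_on {0..1} F" and w: "w \<in> H \<times> H" and M: "\<And>r. r \<in> {0..1} \<Longrightarrow> cmod (F r) \<le> M"
  shows "cnorm ip (cfc F w) \<le> 2 * M * cnorm ip w"
proof -
  have c: "continuous_on {0..1} (\<lambda>r. Re (F r))" "continuous_on {0..1} (\<lambda>r. Im (F r))"
    using F by (auto intro: continuous_intros)
  have M0: "0 \<le> M" using M[of 0] order_trans[OF norm_ge_zero] by simp
  obtain x y where [simp]: "w = (x, y)" and xy: "x \<in> H" "y \<in> H" using w by auto
  have Nxy: "0 \<le> N x" "0 \<le> N y" using xy N_nonneg by auto
  have b: "N (fc (\<lambda>r. Re (F r)) v) \<le> M * N v" "N (fc (\<lambda>r. Im (F r)) v) \<le> M * N v" if "v \<in> H" for v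
    using order_trans[OF abs_Re_le_cmod M] order_trans[OF abs_Im_le_cmod M] c that
    by (auto intro!: fc_bound)
  have le: "N (fst (cfc F w)) \<le> M * (N x + N y)" "N (snd (cfc F w)) \<le> M * (N x + N y)"
    using N_diff_le[of "fc (\<lambda>r. Re (F r)) x" "fc (\<lambda>r. Im (F r)) y"]
      N_triangle[of "fc (\<lambda>r. Im (F r)) x" "fc (\<lambda>r. Re (F r)) y"] b[OF xy(1)] b[OF xy(2)] c xy
    by (auto simp: cfc_def distrib_left)
  have cf: "fst (cfc F w) \<in> H" "snd (cfc F w) \<in> H" using cfc_mem[OF F w] by auto
  have "(N (fst (cfc F w)))\<^sup>2 + (N (snd (cfc F w)))\<^sup>2 \<le> (M * (N x + N y))\<^sup>2 + (M * (N x + N y))\<^sup>2"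
    using le cf N_nonneg by (intro add_mono power_mono) auto
  also have "\<dots> \<le> (2 * M)\<^sup>2 * ((N x)\<^sup>2 + (N y)\<^sup>2)"
  proof -
    have "2 * (N x + N y)\<^sup>2 \<le> 4 * ((N x)\<^sup>2 + (N y)\<^sup>2)"
      using sum_squares_bound[of "N x" "N y"] by (simp add: power2_sum)
    moreover have "(M * s)\<^sup>2 + (M * s)\<^sup>2 \<le> (2 * M)\<^sup>2 * q" if "2 * s\<^sup>2 \<le> 4 * q" for s q
      using mult_left_mono[OF that, of "M\<^sup>2"] by (simp add: power_mult_distrib)
    ultimately show ?thesis by blast
  qed
  finally have "sqrt ((N (fst (cfc F w)))\<^sup>2 + (N (snd (cfc F w)))\<^sup>2) \<le> sqrt ((2 * M)\<^sup>2 * ((N x)\<^sup>2 + (N y)\<^sup>2))"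
    by (rule real_sqrt_le_mono)
  then show ?thesis using M0 cf xy by (simp add: cnorm_def N_sq real_sqrt_mult)
qed

lemma cfc_bounded:
  assumes F: "continuous_on {0..1} F" shows "cbounded_op H ip (cfc F)"
proof -
  have "compact (F ` {0..1})" using F by (auto intro: compact_continuous_image)
  then obtain M where M: "\<And>r. r \<in> {0..1} \<Longrightarrow> cmod (F r) \<le> M"
    by (force dest!: compact_imp_bounded simp: bounded_iff)
  show ?thesis
    unfolding cbounded_op_def
  proof (intro conjI ballI allI exI[of _ "2 * M"])
    show "cfc F ` (H \<times> H) \<subseteq> H \<times> H" using cfc_mem[OF F] by (rule image_subsetI)
  qed (use cfc_add_arg[OF F] cfc_cscale[OF F] cfc_bound[OF F _ M] in blast)+
qed

text \<open>A density argument: on the range of \<open>R\<close> the extra factor \<open>r\<close>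
  makes the symbol uniformly small, and the uniform bound 2 carries the convergence over to all of
  \<open>H\<close>.\<close>

lemma fc_tendsto_0:
  assumes x: "x \<in> H"
    and G: "\<forall>\<^sub>F z in F. continuous_on {0..1} (G z) \<and> (\<forall>r\<in>{0..1}. \<bar>G z r\<bar> \<le> 2 \<and> \<bar>G z r * r\<bar> \<le> \<delta> z)"
    and \<delta>: "(\<delta> \<longlongrightarrow> 0) F"
  shows "((\<lambda>z. N (fc (G z) x)) \<longlongrightarrow> 0) F"
proof (rule tendstoI)
  fix e :: real assume e: "e > 0"
  obtain y where y: "y \<in> H" "N (x - R y) < e / 4" using R_dense[OF x, of "e / 4"] e by auto
  have Ny: "0 \<le> N y" using N_nonneg y by simp
  have "((\<lambda>z. \<delta> z * N y) \<longlongrightarrow> 0) F" using tendsto_mult_right[OF \<delta>, of "N y"] by simp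
  then have "\<forall>\<^sub>F z in F. \<delta> z * N y < e / 2" using e by (intro order_tendstoD(2)) auto
  with G show "\<forall>\<^sub>F z in F. dist (N (fc (G z) x)) 0 < e"
  proof eventually_elim
    case (elim z)
    then have c: "continuous_on {0..1} (G z)" by blast
    have "fc (G z) (R y) = fc (\<lambda>r. G z r * r) y"
      using fc_mult[OF c continuous_on_id y(1)] y by (simp add: fc_id)
    also have "N \<dots> \<le> \<delta> z * N y"
      using elim y by (intro fc_bound continuous_intros) auto
    finally have 1: "N (fc (G z) (R y)) \<le> \<delta> z * N y" .
    have 2: "N (fc (G z) (x - R y)) \<le> 2 * N (x - R y)"
      using elim c x y by (intro fc_bound) auto
    have "fc (G z) x = fc (G z) (x - R y) + fc (G z) (R y)"
      using c x y by (simp add: fc_diff_arg)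
    then have "N (fc (G z) x) \<le> N (fc (G z) (x - R y)) + N (fc (G z) (R y))"
      using N_triangle[of "fc (G z) (x - R y)" "fc (G z) (R y)"] c x y by simp
    then have "N (fc (G z) x) < e" using 1 2 elim y(2) by simp
    then show ?case using N_nonneg[of "fc (G z) x"] c x by simp
  qed
qed

section \<open>The semigroup generated by \<open>-A\<close>\<close>

definition T :: "real \<Rightarrow> 'a \<Rightarrow> 'a" where
  "T t = fc (\<lambda>r. Re (heat (of_real t) r))"

lemma continuous_Re_heat: "t \<ge> 0 \<Longrightarrow> continuous_on {0..1} (\<lambda>r. Re (heat (of_real t) r))"
  by (intro continuous_intros continuous_heat) auto

lemma Re_heat_bound: "t \<ge> 0 \<Longrightarrow> r \<in> {0..1} \<Longrightarrow> \<bar>Re (heat (of_real t) r)\<bar> \<le> 1"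
  using norm_heat_le_1[of "of_real t" r] abs_Re_le_cmod[of "heat (of_real t) r"] by fastforce

lemma T_mem: "t \<ge> 0 \<Longrightarrow> x \<in> H \<Longrightarrow> T t x \<in> H"
  by (simp add: T_def continuous_Re_heat)

lemma T_contractive: "t \<ge> 0 \<Longrightarrow> x \<in> H \<Longrightarrow> N (T t x) \<le> N x"
  using fc_bound[OF continuous_Re_heat, of t x 1] Re_heat_bound by (simp add: T_def)

text \<open>The real part of \<open>heat z - 1\<close> and its imaginary part both fall under
  \<open>fc_tendsto_0\<close>, by \<open>heat_diff_1\<close>. The approach set \<open>S\<close> is
  left open so that the result serves the sectors as well as, through the whole half-plane, real
  times.\<close>

lemma heat_complex_tendsto:
  assumes w: "w \<in> H \<times> H" and S: "\<And>z. z \<in> S \<Longrightarrow> Re z > 0"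
  shows "((\<lambda>z. cnorm ip (cfc (heat z) w - w)) \<longlongrightarrow> 0) (at 0 within S)"
proof -
  obtain x y where [simp]: "w = (x, y)" and xy: "x \<in> H" "y \<in> H" using w by auto
  have ev: "\<forall>\<^sub>F z in at 0 within S. Re z > 0"
    using S by (simp add: eventually_at_filter)
  have cm: "((\<lambda>z. cmod z) \<longlongrightarrow> 0) (at 0 within S)" by (rule tendsto_norm_zero) (rule tendsto_ident_at)
  have re: "((\<lambda>z. N (fc (\<lambda>r. Re (heat z r) - 1) v)) \<longlongrightarrow> 0) (at 0 within S)" if "v \<in> H" for v
  proof (rule fc_tendsto_0[OF that _ cm])
    show "\<forall>\<^sub>F z in at 0 within S. continuous_on {0..1} (\<lambda>r. Re (heat z r) - 1) \<and>
      (\<forall>r\<in>{0..1}. \<bar>Re (heat z r) - 1\<bar> \<le> 2 \<and> \<bar>(Re (heat z r) - 1) * r\<bar> \<le> cmod z)"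
      using ev
    proof eventually_elim
      case (elim z)
      then have z: "z = 0 \<or> Re z > 0" by simp
      have "\<bar>Re (heat z r) - 1\<bar> \<le> 2 \<and> \<bar>(Re (heat z r) - 1) * r\<bar> \<le> cmod z" if r: "r \<in> {0..1}" for r
        using norm_heat_le_1[OF z r] abs_Re_le_cmod[of "heat z r"] heat_diff_1[OF z r]
          abs_Re_le_cmod[of "(heat z r - 1) * of_real r"] by auto
      then show ?case by (auto intro!: continuous_intros continuous_heat z)
    qed
  qed
  have im: "((\<lambda>z. N (fc (\<lambda>r. Im (heat z r)) v)) \<longlongrightarrow> 0) (at 0 within S)" if "v \<in> H" for v
  proof (rule fc_tendsto_0[OF that _ cm])
    show "\<forall>\<^sub>F z in at 0 within S. continuous_on {0..1} (\<lambda>r. Im (heat z r)) \<and>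
      (\<forall>r\<in>{0..1}. \<bar>Im (heat z r)\<bar> \<le> 2 \<and> \<bar>Im (heat z r) * r\<bar> \<le> cmod z)"
      using ev
    proof eventually_elim
      case (elim z)
      then have z: "z = 0 \<or> Re z > 0" by simp
      have "\<bar>Im (heat z r)\<bar> \<le> 2 \<and> \<bar>Im (heat z r) * r\<bar> \<le> cmod z" if r: "r \<in> {0..1}" for r
        using norm_heat_le_1[OF z r] abs_Im_le_cmod[of "heat z r"] heat_diff_1[OF z r]
          abs_Im_le_cmod[of "(heat z r - 1) * of_real r"] by auto
      then show ?case by (auto intro!: continuous_intros continuous_heat z)
    qed
  qed
  let ?B = "\<lambda>z. (N (fc (\<lambda>r. Re (heat z r) - 1) x) + N (fc (\<lambda>r. Im (heat z r)) y))
     + (N (fc (\<lambda>r. Im (heat z r)) x) + N (fc (\<lambda>r. Re (heat z r) - 1) y))"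
  show ?thesis
  proof (rule Lim_null_comparison)
    show "(?B \<longlongrightarrow> 0) (at 0 within S)"
      using tendsto_add[OF tendsto_add[OF re im] tendsto_add[OF im re], of x y x y] xy by simp
    show "\<forall>\<^sub>F z in at 0 within S. norm (cnorm ip (cfc (heat z) w - w)) \<le> ?B z"
      using ev
    proof eventually_elim
      case (elim z)
      have c: "continuous_on {0..1} (\<lambda>r. Re (heat z r))" "continuous_on {0..1} (\<lambda>r. Im (heat z r))"
        using elim by (auto intro!: continuous_intros continuous_heat)
      have c1: "continuous_on {0..1} (\<lambda>r. Re (heat z r) - 1)"
        by (rule continuous_on_diff[OF c(1) continuous_on_const])
      let ?a = "fc (\<lambda>r. Re (heat z r) - 1) x - fc (\<lambda>r. Im (heat z r)) y"
      let ?b = "fc (\<lambda>r. Im (heat z r)) x + fc (\<lambda>r. Re (heat z r) - 1) y"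
      have eq: "cfc (heat z) w - w = (?a, ?b)"
        using c xy by (simp add: cfc_def fc_diff fc_1)
      have mem: "?a \<in> H" "?b \<in> H" using c c1 xy by auto
      have "cnorm ip (cfc (heat z) w - w) = sqrt ((N ?a)\<^sup>2 + (N ?b)\<^sup>2)"
        unfolding eq cnorm_def using mem by (simp add: N_sq)
      also have "\<dots> \<le> N ?a + N ?b" using mem N_nonneg by (intro sqrt_sum_squares_le_sum) auto
      also have "\<dots> \<le> ?B z"
        using N_diff_le[of "fc (\<lambda>r. Re (heat z r) - 1) x" "fc (\<lambda>r. Im (heat z r)) y"]
          N_triangle[of "fc (\<lambda>r. Im (heat z r)) x" "fc (\<lambda>r. Re (heat z r) - 1) y"] c c1 xy by simp
      finally have "cnorm ip (cfc (heat z) w - w) \<le> ?B z" .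
      moreover have "0 \<le> cnorm ip (cfc (heat z) w - w)"
        unfolding eq cnorm_def using mem ip_nonneg by (simp add: add_nonneg_nonneg)
      ultimately show ?case by simp
    qed
  qed
qed

lemma sector_pi_half: "z \<in> sector (pi / 2) \<longleftrightarrow> Re z > 0"
  unfolding sector_def mem_Collect_eq Arg_Re_pos by auto

text \<open>For \<open>x = R y\<close> the error \<open>(T t x - x) / t + A x\<close> is
  \<open>fc\<close> of the symbol in \<open>heat_generator_symbol\<close>, applied to
  \<open>y\<close>.\<close>

lemma generator_T:
  assumes x: "x \<in> D" shows "has_generator_at ip T x (- A x)"
proof -
  obtain y where y: "y \<in> H" "x = R y" using x by (auto simp: D_eq)
  have xH: "x \<in> H" using y by simp
  let ?G = "\<lambda>t r. (1 / t) * ((Re (heat (of_real t) r) - 1) * r) + (1 - r)"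
  have pos: "\<forall>\<^sub>F t in at_right (0::real). t > 0" by (simp add: eventually_at_right_less)
  have "((\<lambda>t. N (fc (?G t) y)) \<longlongrightarrow> 0) (at_right 0)"
  proof (rule fc_tendsto_0[OF y(1) _ tendsto_ident_at])
    show "\<forall>\<^sub>F t in at_right 0. continuous_on {0..1} (?G t) \<and>
      (\<forall>r\<in>{0..1}. \<bar>?G t r\<bar> \<le> 2 \<and> \<bar>?G t r * r\<bar> \<le> t)"
      using pos
    proof eventually_elim
      case (elim t)
      have "continuous_on {0..1} (?G t)" using elim by (intro continuous_intros continuous_Re_heat) auto
      then show ?case using heat_generator_symbol[OF elim] by blast
    qed
  qed
  moreover have "\<forall>\<^sub>F t in at_right 0. N (fc (?G t) y) = N ((1 / t) *\<^sub>R (T t x - x) - (- A x))"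
    using pos
  proof eventually_elim
    case (elim t)
    have c: "continuous_on {0..1} (\<lambda>r. Re (heat (of_real t) r))" using continuous_Re_heat elim by simp
    have c1: "continuous_on {0..1} (\<lambda>r. Re (heat (of_real t) r) - 1)"
      by (rule continuous_on_diff[OF c continuous_on_const])
    have "fc (?G t) y = fc (\<lambda>r. (1 / t) * ((Re (heat (of_real t) r) - 1) * r)) y + fc (\<lambda>r. 1 - r) y"
      using c1 y elim by (intro fc_add) (auto intro!: continuous_intros c)
    also have "fc (\<lambda>r. 1 - r) y = y - R y"
      using y by (subst fc_diff) (auto simp: fc_1 fc_id)
    also have "fc (\<lambda>r. (1 / t) * ((Re (heat (of_real t) r) - 1) * r)) y
      = (1 / t) *\<^sub>R fc (\<lambda>r. (Re (heat (of_real t) r) - 1) * r) y"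
      using c1 y elim by (intro fc_scale) (auto intro!: continuous_intros c)
    also have "fc (\<lambda>r. (Re (heat (of_real t) r) - 1) * r) y = fc (\<lambda>r. Re (heat (of_real t) r) - 1) (R y)"
      using fc_mult[OF c1 continuous_on_id y(1)] y by (simp add: fc_id)
    also have "\<dots> = T t x - x"
      using y c by (simp add: T_def fc_diff fc_1)
    finally show ?case using y A_R[of y] by (simp only: diff_minus_eq_add)
  qed
  ultimately show ?thesis unfolding has_generator_at_def by (rule Lim_transform_eventually)
qed

lemma T_sym: "t \<ge> 0 \<Longrightarrow> x \<in> H \<Longrightarrow> y \<in> H \<Longrightarrow> ip (T t x) y = ip x (T t y)"
  unfolding T_def by (intro fc_sym continuous_Re_heat)

text \<open>Symmetry of \<open>T t\<close> passes to the difference quotients. Pairing with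
  \<open>u\<close> in \<open>D\<close>, where the limit is already known, puts
  \<open>(x, - y)\<close> into the adjoint graph of \<open>A\<close>, which is the graph of
  \<open>A\<close>; so the generator is no proper extension of \<open>- A\<close>.\<close>

lemma generator_T_unique:
  assumes x: "x \<in> H" and y: "y \<in> H" and g: "has_generator_at ip T x y"
  shows "x \<in> D \<and> y = - A x"
proof -
  have pos: "\<forall>\<^sub>F t in at_right (0::real). t > 0" by (simp add: eventually_at_right_less)
  have lim: "((\<lambda>t. ip ((1 / t) *\<^sub>R (T t p - p)) v) \<longlongrightarrow> ip q v) (at_right 0)"
    if p: "p \<in> H" "q \<in> H" "v \<in> H" "has_generator_at ip T p q" for p q v
  proof -
    \<comment> \<open>\<open>ip_tendsto\<close> asks for membership in \<open>H\<close> at every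
      index, but \<open>T_mem\<close> covers only \<open>t \<ge> 0\<close>; the absolute value
      repairs negative \<open>t\<close>.\<close>
    let ?X = "\<lambda>t. (1 / \<bar>t\<bar>) *\<^sub>R (T \<bar>t\<bar> p - p)"
    have "((\<lambda>t. N (?X t - q)) \<longlongrightarrow> 0) (at_right 0)"
      using p(4) unfolding has_generator_at_def
      by (rule Lim_transform_eventually) (use pos in \<open>auto elim!: eventually_mono\<close>)
    then have "((\<lambda>t. ip (?X t) v) \<longlongrightarrow> ip q v) (at_right 0)"
      using p T_mem by (intro ip_tendsto) auto
    then show ?thesis
      by (rule Lim_transform_eventually) (use pos in \<open>auto elim!: eventually_mono\<close>)
  qed
  have "ip (A u) x = ip u (- y)" if u: "u \<in> D" for u
  proof -
    have uH: "u \<in> H" "A u \<in> H" using u A_linear D_sub_H by (auto simp: linear_op_def)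
    have "\<forall>\<^sub>F t in at_right 0. ip ((1 / t) *\<^sub>R (T t x - x)) u = ip ((1 / t) *\<^sub>R (T t u - u)) x"
      using pos
    proof eventually_elim
      case (elim t)
      then show ?case using x uH T_mem T_sym[of t x u] ip_sym[of x "T t u"] ip_sym[of x u]
        by (simp add: ip_simps)
    qed
    with lim[OF x y uH(1) g] have "((\<lambda>t. ip ((1 / t) *\<^sub>R (T t u - u)) x) \<longlongrightarrow> ip y u) (at_right 0)"
      by (rule Lim_transform_eventually)
    moreover have "((\<lambda>t. ip ((1 / t) *\<^sub>R (T t u - u)) x) \<longlongrightarrow> ip (- A u) x) (at_right 0)"
      using uH x generator_T[OF u] by (intro lim) auto
    ultimately have "ip y u = ip (- A u) x" by (intro tendsto_unique[of "at_right (0::real)"]) auto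
    then show ?thesis using uH x y ip_sym[of y u] by (simp add: ip_simps)
  qed
  then have "(x, - y) \<in> adjoint_graph H ip D A" using x y by (simp add: adjoint_graph_def)
  then have "x \<in> D" "- y = A x" by (auto simp: adjoint_graph_A)
  then show ?thesis by (metis minus_minus)
qed

lemma heat_holomorphic: "op_holomorphic_on H ip (\<lambda>z. cfc (heat z)) (sector (pi / 2))"
  unfolding op_holomorphic_on_def
proof (intro ballI exI conjI allI impI)
  fix z assume "z \<in> sector (pi / 2)"
  then have z: "Re z > 0" by (simp add: sector_pi_half)
  show "cbounded_op H ip (cfc (heat_deriv z))" by (rule cfc_bounded[OF continuous_heat_deriv[OF z]])
  fix e :: real assume e: "e > 0"
  \<comment> \<open>The first bound keeps \<open>z'\<close> in the half-plane and makes
    \<open>heat_deriv_remainder\<close> available. The second makes the remainder at most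
    \<open>e * cmod (z' - z)\<close>; here 16 is the 8 from there times the 2 of
    \<open>cfc_bound\<close>.\<close>
  define d where "d = min (Re z / 2) (e * (Re z)\<^sup>2 / 16)"
  have d: "d > 0" using e z by (simp add: d_def)
  show "\<forall>\<^sub>F z' in at z. \<forall>w\<in>H \<times> H. cnorm ip (cfc (heat z') w - cfc (heat z) w - cscale (z' - z) (cfc (heat_deriv z) w))
    \<le> e * cmod (z' - z) * cnorm ip w"
    unfolding eventually_at
  proof (intro exI[of _ d] conjI d ballI impI)
    fix z' w assume zz: "z' \<noteq> z \<and> dist z' z < d" and w: "w \<in> H \<times> H"
    have wz: "cmod (z' - z) \<le> Re z / 2" "cmod (z' - z) \<le> e * (Re z)\<^sup>2 / 16"
      using zz by (auto simp: d_def dist_norm)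
    have z': "Re z' > 0" using wz(1) abs_Re_le_cmod[of "z' - z"] z by simp
    let ?F = "\<lambda>r. heat z' r - heat z r - (z' - z) * heat_deriv z r"
    have c: "continuous_on {0..1} (heat z')" "continuous_on {0..1} (heat z)" "continuous_on {0..1} (heat_deriv z)"
      using z z' by (auto intro: continuous_heat continuous_heat_deriv)
    have cr: "continuous_on {0..1} (\<lambda>r. Re (heat z' r))" "continuous_on {0..1} (\<lambda>r. Im (heat z' r))"
      "continuous_on {0..1} (\<lambda>r. Re (heat z r))" "continuous_on {0..1} (\<lambda>r. Im (heat z r))"
      "continuous_on {0..1} (\<lambda>r. Re (heat_deriv z r))" "continuous_on {0..1} (\<lambda>r. Im (heat_deriv z r))"
      using c by (auto intro: continuous_intros)
    have F: "continuous_on {0..1} ?F" using c by (intro continuous_intros)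
    have "cfc ?F w = cfc (heat z') w - cfc (heat z) w - cscale (z' - z) (cfc (heat_deriv z) w)"
    proof -
      obtain x y where [simp]: "w = (x, y)" and xy: "x \<in> H" "y \<in> H" using w by auto
      show ?thesis using cr xy
        by (simp add: cfc_def cscale_def fc_diff fc_add fc_scale continuous_on_mult continuous_on_add
          continuous_on_diff algebra_simps)
    qed
    moreover have "cnorm ip (cfc ?F w) \<le> 2 * (8 / (Re z)\<^sup>2 * (cmod (z' - z))\<^sup>2) * cnorm ip w"
      by (rule cfc_bound[OF F w]) (rule heat_deriv_remainder[OF z wz(1)])
    moreover have "\<dots> \<le> e * cmod (z' - z) * cnorm ip w"
    proof (rule mult_right_mono)
      have "2 * (8 / (Re z)\<^sup>2 * (cmod (z' - z))\<^sup>2) = 16 / (Re z)\<^sup>2 * cmod (z' - z) * cmod (z' - z)"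
        by (simp add: power2_eq_square)
      also have "\<dots> \<le> e * cmod (z' - z)"
      proof (rule mult_right_mono)
        show "16 / (Re z)\<^sup>2 * cmod (z' - z) \<le> e" using wz(2) z by (simp add: field_simps)
      qed simp
      finally show "2 * (8 / (Re z)\<^sup>2 * (cmod (z' - z))\<^sup>2) \<le> e * cmod (z' - z)" .
      show "0 \<le> cnorm ip w" using w ip_nonneg by (auto simp: cnorm_def)
    qed
    ultimately show "cnorm ip (cfc (heat z') w - cfc (heat z) w - cscale (z' - z) (cfc (heat_deriv z) w))
      \<le> e * cmod (z' - z) * cnorm ip w" by simp
  qed
qed

lemma heat_semigroup:
  assumes "z = 0 \<or> Re z > 0" "z' = 0 \<or> Re z' > 0" "w \<in> H \<times> H"
  shows "cfc (heat (z + z')) w = cfc (heat z) (cfc (heat z') w)"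
proof -
  have "heat (z + z') = (\<lambda>r. heat z r * heat z' r)" by (rule ext) (rule heat_add[OF assms(1,2)])
  then show ?thesis
    using cfc_mult[OF continuous_heat[OF assms(1)] continuous_heat[OF assms(2)] assms(3)] by simp
qed

lemma heat_0 [simp]: "heat 0 = (\<lambda>r. 1)"
  by (simp add: heat_def[abs_def])

lemma heat_real_cfc:
  assumes "x \<in> H" "y \<in> H" shows "cfc (heat (of_real t)) (x, y) = (T t x, T t y)"
proof -
  have "Im (heat (of_real t) r) = 0" for r by (simp add: heat_real)
  then show ?thesis using assms by (simp add: cfc_def T_def fc_0)
qed

lemma analytic: "analytic_semigroup H ip (pi / 2) (\<lambda>z. cfc (heat z))"
  unfolding analytic_semigroup_def
proof (intro conjI ballI allI impI heat_holomorphic)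
  fix z z' assume z: "z \<in> insert 0 (sector (pi / 2))" "z' \<in> insert 0 (sector (pi / 2))"
  then have re: "z = 0 \<or> Re z > 0" "z' = 0 \<or> Re z' > 0" using sector_pi_half by auto
  show "cbounded_op H ip (cfc (heat z))" by (rule cfc_bounded[OF continuous_heat[OF re(1)]])
  show "cfc (heat (z + z')) w = cfc (heat z) (cfc (heat z') w)" if "w \<in> H \<times> H" for w
    by (rule heat_semigroup[OF re that])
next
  show "cfc (heat 0) w = w" if "w \<in> H \<times> H" for w
    using that by (simp add: cfc_1)
  fix \<theta>' and w assume t: "0 < \<theta>' \<and> \<theta>' < pi / 2" and w: "w \<in> H \<times> H"
  show "((\<lambda>z. cnorm ip (cfc (heat z) w - w)) \<longlongrightarrow> 0) (at 0 within sector \<theta>')"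
  proof (rule heat_complex_tendsto[OF w])
    fix z assume "z \<in> sector \<theta>'"
    then have "z \<in> sector (pi / 2)" using t by (auto simp: sector_def)
    then show "Re z > 0" by (simp add: sector_pi_half)
  qed
qed

lemma C0: "C0_semigroup H ip T"
  unfolding C0_semigroup_def
proof (intro conjI ballI allI impI)
  fix t :: real assume t: "0 \<le> t"
  have "linear_op H H (T t)"
    unfolding linear_op_def T_def using continuous_Re_heat[OF t] subspace_H
    by (auto simp: fc_add_arg fc_scale_arg)
  then show "bounded_op H ip (T t)"
    unfolding bounded_op_def using T_contractive[OF t] by (metis mult_1)
  fix s :: real assume s: "0 \<le> s"
  fix x assume x: "x \<in> H"
  \<comment> \<open>The real semigroup law is read off from the complex one on vectors
    \<open>(x, 0)\<close>.\<close>
  have "cfc (heat (of_real s + of_real t)) (x, 0) = cfc (heat (of_real s)) (cfc (heat (of_real t)) (x, 0))"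
    using s t x by (intro heat_semigroup) auto
  then show "T (s + t) x = T s (T t x)"
    using heat_real_cfc[of x 0 t] heat_real_cfc[of x 0 "s + t"] heat_real_cfc[of "T t x" "T t 0" s] x t T_mem
    by simp
next
  fix x assume x: "x \<in> H"
  show "T 0 x = x" using x by (simp add: T_def fc_1)
  have "((\<lambda>z. cnorm ip (cfc (heat z) (x, 0) - (x, 0))) \<longlongrightarrow> 0) (at 0 within {z. Re z > 0})"
    using x by (intro heat_complex_tendsto) auto
  moreover have "filterlim complex_of_real (at 0 within {z. Re z > 0}) (at_right 0)"
    unfolding filterlim_at
  proof
    show "\<forall>\<^sub>F t in at_right 0. complex_of_real t \<in> {z. Re z > 0} \<and> complex_of_real t \<noteq> 0"
      using eventually_at_right_less[of "0::real"] by eventually_elim simp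
    show "(complex_of_real \<longlongrightarrow> 0) (at_right 0)" using tendsto_of_real[OF tendsto_ident_at, of 0] by simp
  qed
  ultimately have "((\<lambda>t. cnorm ip (cfc (heat (of_real t)) (x, 0) - (x, 0))) \<longlongrightarrow> 0) (at_right 0)"
    by (rule filterlim_compose)
  moreover have "\<forall>\<^sub>F t in at_right 0. cnorm ip (cfc (heat (of_real t)) (x, 0) - (x, 0)) = N (T t x - x)"
    using eventually_at_right_less[of "0::real"]
  proof eventually_elim
    case (elim t)
    have "T t 0 = 0" using fc_scale_arg[of _ 0 0] continuous_Re_heat[of t] elim by (simp add: T_def)
    then show ?case using heat_real_cfc[of x 0 t] x by (simp add: cnorm_def ipnorm_def)
  qed
  ultimately show "((\<lambda>t. N (T t x - x)) \<longlongrightarrow> 0) (at_right 0)" by (rule Lim_transform_eventually)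
qed

theorem generates: "generates_contractive_analytic_semigroup H ip D (\<lambda>u. - A u) (pi / 2)"
  unfolding generates_contractive_analytic_semigroup_def
proof (intro exI[of _ T] exI[of _ "\<lambda>z. cfc (heat z)"] conjI allI impI ballI C0 analytic)
  show "contractive H ip T" unfolding contractive_def using T_contractive by blast
  show "is_generator H ip T D (\<lambda>u. - A u)"
    unfolding is_generator_def
  proof (intro equalityI subsetI)
    fix p assume "p \<in> {(x, y). x \<in> H \<and> y \<in> H \<and> has_generator_at ip T x y}"
    then show "p \<in> {(x, - A x) | x. x \<in> D}" using generator_T_unique by auto
  next
    fix p assume "p \<in> {(x, - A x) | x. x \<in> D}"
    then show "p \<in> {(x, y). x \<in> H \<and> y \<in> H \<and> has_generator_at ip T x y}"
      using generator_T A_linear D_sub_H by (auto simp: linear_op_def)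
  qed
qed (simp add: heat_real_cfc)

end

section \<open>Weighted $L^2$ spaces\<close>

definition square_integrable :: "'a measure \<Rightarrow> ('a \<Rightarrow> real) \<Rightarrow> bool" where
  "square_integrable M f \<longleftrightarrow> f \<in> borel_measurable M \<and> integrable M (\<lambda>x. (f x)\<^sup>2)"

lemma square_integrable_measurable: "square_integrable M f \<Longrightarrow> f \<in> borel_measurable M"
  by (simp add: square_integrable_def)

lemma square_integrable_mult:
  assumes "square_integrable M f" "square_integrable M g" shows "integrable M (\<lambda>x. f x * g x)"
proof (rule Bochner_Integration.integrable_bound)
  show "integrable M (\<lambda>x. (f x)\<^sup>2 + (g x)\<^sup>2)" using assms by (auto simp: square_integrable_def)
  show "(\<lambda>x. f x * g x) \<in> borel_measurable M" using assms by (auto simp: square_integrable_def)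
  have "\<bar>a * b\<bar> \<le> a\<^sup>2 + b\<^sup>2" for a b :: real
    using sum_squares_bound[of "\<bar>a\<bar>" "\<bar>b\<bar>"] abs_ge_zero[of "a * b"] unfolding abs_mult power2_abs
    by linarith
  then show "AE x in M. norm (f x * g x) \<le> norm ((f x)\<^sup>2 + (g x)\<^sup>2)" by simp
qed

lemma square_integrable_add:
  assumes "square_integrable M f" "square_integrable M g" shows "square_integrable M (\<lambda>x. f x + g x)"
  using assms square_integrable_mult[OF assms]
  by (auto simp: square_integrable_def power2_sum mult.assoc)

lemma square_integrable_scale:
  "square_integrable M f \<Longrightarrow> square_integrable M (\<lambda>x. c * f x)"
  by (auto simp: square_integrable_def power_mult_distrib)

lemma square_integrable_diff:
  assumes "square_integrable M f" "square_integrable M g" shows "square_integrable M (\<lambda>x. f x - g x)"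
  using square_integrable_add[OF assms(1) square_integrable_scale[OF assms(2), of "-1"]] by simp

lemma square_integrable_cong_AE:
  assumes "square_integrable M f" "AE x in M. f x = g x" "g \<in> borel_measurable M"
  shows "square_integrable M g"
proof -
  have "AE x in M. (f x)\<^sup>2 = (g x)\<^sup>2" using assms(2) by eventually_elim simp
  then have "integrable M (\<lambda>x. (f x)\<^sup>2) = integrable M (\<lambda>x. (g x)\<^sup>2)"
    using assms by (intro integrable_cong_AE) (auto simp: square_integrable_def)
  then show ?thesis using assms by (simp add: square_integrable_def)
qed

lemma square_integrable_abs: "square_integrable M f \<Longrightarrow> square_integrable M (\<lambda>x. \<bar>f x\<bar>)"
  by (auto simp: square_integrable_def)

lemma quadratic_form_discriminant:
  fixes A B C :: real
  assumes quad: "\<And>s t. 0 \<le> s\<^sup>2 * A + 2 * s * t * B + t\<^sup>2 * C" and "0 \<le> A" "0 \<le> C"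
  shows "B\<^sup>2 \<le> A * C"
proof (cases "C = 0")
  case False
  then have C: "0 < C" using assms by simp
  have "0 \<le> C\<^sup>2 * A + 2 * C * (- B) * B + (- B)\<^sup>2 * C" by (rule quad)
  also have "\<dots> = C * (A * C - B\<^sup>2)" by (simp add: power2_eq_square algebra_simps)
  finally show ?thesis using C by (simp add: zero_le_mult_iff)
next
  case True
  have "B = 0"
  proof (rule ccontr)
    assume "B \<noteq> 0"
    \<comment> \<open>At \<open>s = 1\<close> this \<open>t\<close> gives the form the value
      \<open>A - 2 * (A + 1) < 0\<close>.\<close>
    then show False using quad[of 1 "- (A + 1) / B"] True \<open>0 \<le> A\<close> by simp
  qed
  then show ?thesis using True by simp
qed

lemma square_integrable_Cauchy_Schwarz:
  assumes f: "square_integrable M f" and g: "square_integrable M g"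
  shows "(\<integral>x. f x * g x \<partial>M)\<^sup>2 \<le> (\<integral>x. (f x)\<^sup>2 \<partial>M) * (\<integral>x. (g x)\<^sup>2 \<partial>M)"
proof -
  let ?A = "\<integral>x. (f x)\<^sup>2 \<partial>M" and ?B = "\<integral>x. f x * g x \<partial>M" and ?C = "\<integral>x. (g x)\<^sup>2 \<partial>M"
  have int: "integrable M (\<lambda>x. (f x)\<^sup>2)" "integrable M (\<lambda>x. f x * g x)" "integrable M (\<lambda>x. (g x)\<^sup>2)"
    using f g square_integrable_mult[OF f g] by (auto simp: square_integrable_def)
  have quad: "0 \<le> s\<^sup>2 * ?A + 2 * s * t * ?B + t\<^sup>2 * ?C" for s t
  proof -
    have "0 \<le> (\<integral>x. (s * f x + t * g x)\<^sup>2 \<partial>M)" by simp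
    also have "\<dots> = (\<integral>x. s\<^sup>2 * (f x)\<^sup>2 + 2 * s * t * (f x * g x) + t\<^sup>2 * (g x)\<^sup>2 \<partial>M)"
      by (simp add: power2_sum power_mult_distrib mult_ac add_ac)
    also have "\<dots> = s\<^sup>2 * ?A + 2 * s * t * ?B + t\<^sup>2 * ?C" using int by simp
    finally show ?thesis .
  qed
  show ?thesis by (rule quadratic_form_discriminant[OF quad]) simp_all
qed

lemma square_integrable_const: "finite_measure M \<Longrightarrow> square_integrable M (\<lambda>x. c)"
  by (auto simp: square_integrable_def intro: finite_measure.integrable_const)

lemma square_integrable_integrable:
  assumes "finite_measure M" "square_integrable M f" shows "integrable M f"
  using square_integrable_mult[OF assms(2) square_integrable_const[OF assms(1), of 1]] by simp

text \<open>The Riesz-Fischer argument: along a fast subsequence the increments are summable almost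
  everywhere, since a finite measure bounds their integrals by their \<open>L2\<close> norms.
  Fatou's lemma then controls the distance to the pointwise limit.\<close>

lemma L2_complete:
  fixes f :: "nat \<Rightarrow> 'a \<Rightarrow> real"
  assumes fin: "finite_measure M" and f: "\<And>n. square_integrable M (f n)"
    and Cauchy: "\<And>e. e > 0 \<Longrightarrow> \<exists>K. \<forall>m\<ge>K. \<forall>n\<ge>K. (\<integral>x. (f m x - f n x)\<^sup>2 \<partial>M) < e"
  obtains g where "square_integrable M g" "(\<lambda>n. \<integral>x. (f n x - g x)\<^sup>2 \<partial>M) \<longlonglongrightarrow> 0"
proof -
  have fm [measurable]: "f n \<in> borel_measurable M" for n using f by (rule square_integrable_measurable)
  \<comment> \<open>The integrals are squared norms; their square roots are bounded by the summable
    \<open>(1/2)^k\<close>.\<close>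
  have "\<exists>K. \<forall>m\<ge>K. \<forall>n\<ge>K. (\<integral>x. (f m x - f n x)\<^sup>2 \<partial>M) < (1/4)^k" for k :: nat
    by (rule Cauchy) simp
  then obtain K where K: "\<And>k m n. m \<ge> K k \<Longrightarrow> n \<ge> K k \<Longrightarrow> (\<integral>x. (f m x - f n x)\<^sup>2 \<partial>M) < (1/4)^k"
    by metis
  \<comment> \<open>Partial sums turn the thresholds into a nondecreasing sequence that dominates
    all earlier ones.\<close>
  define r where "r k = (\<Sum>i\<le>k. K i)" for k
  have r_ge: "K k \<le> r j" if "k \<le> j" for k j
    unfolding r_def using that by (intro member_le_sum) auto
  define d where "d k x = f (r (Suc k)) x - f (r k) x" for k x
  have dm [measurable]: "d k \<in> borel_measurable M" for k unfolding d_def by measurable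
  have d2: "square_integrable M (d k)" for k
    unfolding d_def by (intro square_integrable_diff f)
  have d_int: "(\<integral>x. \<bar>d k x\<bar> \<partial>M) \<le> sqrt (measure M (space M)) * (1/2)^k" for k
  proof -
    have "(\<integral>x. \<bar>d k x\<bar> * 1 \<partial>M)\<^sup>2 \<le> (\<integral>x. \<bar>d k x\<bar>\<^sup>2 \<partial>M) * (\<integral>x. 1\<^sup>2 \<partial>M)"
      by (intro square_integrable_Cauchy_Schwarz square_integrable_abs d2 square_integrable_const fin)
    also have "\<dots> \<le> (1/4)^k * measure M (space M)"
    proof (rule mult_mono)
      show "(\<integral>x. \<bar>d k x\<bar>\<^sup>2 \<partial>M) \<le> (1/4)^k"
        using K[OF r_ge[of k "Suc k"] r_ge[of k k]] by (simp add: d_def)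
    qed auto
    finally have "sqrt ((\<integral>x. \<bar>d k x\<bar> \<partial>M)\<^sup>2) \<le> sqrt ((1/4)^k * measure M (space M))"
      by (intro real_sqrt_le_mono) simp
    then show ?thesis by (simp add: real_sqrt_mult real_sqrt_power real_sqrt_divide mult.commute)
  qed
  have d_integrable: "integrable M (\<lambda>x. \<bar>d k x\<bar>)" for k
    by (intro square_integrable_integrable[OF fin] square_integrable_abs d2)
  have "(\<integral>\<^sup>+ x. (\<Sum>k. ennreal \<bar>d k x\<bar>) \<partial>M) = (\<Sum>k. \<integral>\<^sup>+ x. ennreal \<bar>d k x\<bar> \<partial>M)"
    by (rule nn_integral_suminf) measurable
  also have "\<dots> = (\<Sum>k. ennreal (\<integral>x. \<bar>d k x\<bar> \<partial>M))"
    by (intro suminf_cong nn_integral_eq_integral d_integrable AE_I2) auto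
  also have "\<dots> \<noteq> \<infinity>"
  proof -
    have "summable (\<lambda>k. \<integral>x. \<bar>d k x\<bar> \<partial>M)"
    proof (rule summable_comparison_test')
      show "summable (\<lambda>k. sqrt (measure M (space M)) * (1/2)^k)"
        by (intro summable_mult summable_geometric) simp
      show "norm (\<integral>x. \<bar>d k x\<bar> \<partial>M) \<le> sqrt (measure M (space M)) * (1/2)^k" for k
        using d_int[of k] by simp
    qed
    then show ?thesis using ennreal_suminf_neq_top by force
  qed
  finally have "AE x in M. (\<Sum>k. ennreal \<bar>d k x\<bar>) \<noteq> \<infinity>"
    by (intro nn_integral_PInf_AE) measurable
  then have lim: "AE x in M. (\<lambda>k. f (r k) x) \<longlonglongrightarrow> lim (\<lambda>k. f (r k) x)"
  proof eventually_elim
    case (elim x)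
    then have "summable (\<lambda>k. \<bar>d k x\<bar>)" by (intro summable_suminf_not_top) auto
    then have "summable (\<lambda>k. d k x)" by (rule summable_rabs_cancel)
    then have "convergent (\<lambda>n. \<Sum>k<n. d k x)" by (simp add: summable_iff_convergent)
    then have "convergent (\<lambda>n. f (r 0) x + (\<Sum>k<n. d k x))" by (intro convergent_add convergent_const)
    also have "(\<lambda>n. f (r 0) x + (\<Sum>k<n. d k x)) = (\<lambda>n. f (r n) x)"
      using sum_lessThan_telescope[of "\<lambda>k. f (r k) x"] by (simp add: d_def)
    finally show ?case by (simp add: convergent_LIMSEQ_iff)
  qed
  define g where "g x = lim (\<lambda>k. f (r k) x)" for x
  have gm [measurable]: "g \<in> borel_measurable M" unfolding g_def by (rule borel_measurable_lim_metric) measurable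
  have nn: "(\<integral>\<^sup>+ x. ennreal ((f n x - g x)\<^sup>2) \<partial>M) \<le> ennreal ((1/4)^k)" if n: "n \<ge> K k" for n k
  proof -
    have "(\<integral>\<^sup>+ x. ennreal ((f n x - g x)\<^sup>2) \<partial>M) = (\<integral>\<^sup>+ x. liminf (\<lambda>j. ennreal ((f n x - f (r j) x)\<^sup>2)) \<partial>M)"
    proof (rule nn_integral_cong_AE)
      show "AE x in M. ennreal ((f n x - g x)\<^sup>2) = liminf (\<lambda>j. ennreal ((f n x - f (r j) x)\<^sup>2))"
        using lim
      proof eventually_elim
        case (elim x)
        then have "(\<lambda>j. ennreal ((f n x - f (r j) x)\<^sup>2)) \<longlonglongrightarrow> ennreal ((f n x - g x)\<^sup>2)"
          unfolding g_def by (intro tendsto_ennrealI tendsto_intros)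
        then show ?case by (rule lim_imp_Liminf[OF trivial_limit_sequentially, symmetric])
      qed
    qed
    also have "\<dots> \<le> liminf (\<lambda>j. \<integral>\<^sup>+ x. ennreal ((f n x - f (r j) x)\<^sup>2) \<partial>M)"
      by (rule nn_integral_liminf) measurable
    also have "\<dots> \<le> liminf (\<lambda>j. ennreal ((1/4)^k))"
    proof (rule Liminf_mono)
      show "\<forall>\<^sub>F j in sequentially. (\<integral>\<^sup>+ x. ennreal ((f n x - f (r j) x)\<^sup>2) \<partial>M) \<le> ennreal ((1/4)^k)"
        using eventually_ge_at_top[of k]
      proof eventually_elim
        case (elim j)
        have "integrable M (\<lambda>x. (f n x - f (r j) x)\<^sup>2)"
          using square_integrable_diff[OF f f] by (simp add: square_integrable_def)
        then show ?case using K[OF n r_ge[OF elim]] by (simp add: nn_integral_eq_integral)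
      qed
    qed
    also have "\<dots> = ennreal ((1/4)^k)" by (simp add: Liminf_const)
    finally show ?thesis .
  qed
  have diff: "square_integrable M (\<lambda>x. f n x - g x)" "(\<integral>x. (f n x - g x)\<^sup>2 \<partial>M) \<le> (1/4)^k" if "n \<ge> K k" for n k
  proof -
    have "(\<integral>\<^sup>+ x. ennreal ((f n x - g x)\<^sup>2) \<partial>M) < \<infinity>"
      using nn[OF that] by (rule order.strict_trans1) simp
    then have int: "integrable M (\<lambda>x. (f n x - g x)\<^sup>2)"
      by (intro integrableI_nonneg) auto
    then show "square_integrable M (\<lambda>x. f n x - g x)" by (simp add: square_integrable_def)
    have "ennreal (\<integral>x. (f n x - g x)\<^sup>2 \<partial>M) \<le> ennreal ((1/4)^k)"
      using nn[OF that] int by (simp add: nn_integral_eq_integral)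
    then show "(\<integral>x. (f n x - g x)\<^sup>2 \<partial>M) \<le> (1/4)^k" by (simp add: ennreal_le_iff)
  qed
  have "square_integrable M g"
    using square_integrable_diff[OF f[of "K 0"] diff(1)[of 0 "K 0"]] by simp
  moreover have "(\<lambda>n. \<integral>x. (f n x - g x)\<^sup>2 \<partial>M) \<longlonglongrightarrow> 0"
  proof (rule tendstoI)
    fix e :: real assume "e > 0"
    then obtain k where k: "(1/4 :: real)^k < e" using real_arch_pow_inv[of e "1/4"] by auto
    show "\<forall>\<^sub>F n in sequentially. dist (\<integral>x. (f n x - g x)\<^sup>2 \<partial>M) 0 < e"
      using eventually_ge_at_top[of "K k"]
    proof eventually_elim
      case (elim n)
      then show ?case using diff(2)[OF elim] k by simp
    qed
  qed
  ultimately show ?thesis by (rule that)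
qed

section \<open>Classes of functions and the weighted space as a Hilbert space\<close>

lemma finite_M01: "finite_measure M01"
  by (rule finite_measure_lebesgue_on) simp

lemma l0_eqI: assumes "AE x in M01. rep_l0 u x = rep_l0 v x" shows "u = v"
  using Quotient_rel_rep[OF Quotient_l0, of u v] assms rep_l0_measurable by (auto simp: ae_eq_def)

lemma rep_l0_0: "AE x in M01. rep_l0 0 x = 0"
  unfolding zero_l0_def by (rule rep_abs_l0) simp

lemma rep_l0_add: "AE x in M01. rep_l0 (u + v) x = rep_l0 u x + rep_l0 v x"
  unfolding plus_l0_def map_fun_def comp_def
  by (rule rep_abs_l0) (intro borel_measurable_add rep_l0_measurable)

lemma rep_l0_diff: "AE x in M01. rep_l0 (u - v) x = rep_l0 u x - rep_l0 v x"
  unfolding minus_l0_def map_fun_def comp_def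
  by (rule rep_abs_l0) (intro borel_measurable_diff rep_l0_measurable)

lemma rep_l0_scale: "AE x in M01. rep_l0 (c *\<^sub>R u) x = c * rep_l0 u x"
  unfolding scaleR_l0_def map_fun_def comp_def id_def
  by (rule rep_abs_l0) (intro borel_measurable_times borel_measurable_const rep_l0_measurable)

locale weight =
  fixes a :: "real \<Rightarrow> real" and B :: real
  assumes a_measurable [measurable]: "a \<in> borel_measurable M01"
    and a_pos: "\<And>x. x \<in> {0<..<1} \<Longrightarrow> 0 < a x"
    and a_bounded: "\<And>x. x \<in> {0<..<1} \<Longrightarrow> a x \<le> B"
begin

text \<open>Division by \<open>sqrt (a x)\<close> maps the weighted space isometrically onto
  unweighted \<open>L2\<close>, from which completeness is taken over.\<close>

definition wrep :: "l0 \<Rightarrow> real \<Rightarrow> real" where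
  "wrep u x = rep_l0 u x / sqrt (a x)"

lemma wrep_measurable [measurable]: "wrep u \<in> borel_measurable M01"
  using rep_l0_measurable[of u] unfolding wrep_def by measurable

lemma wrep_mult: "x \<in> {0<..<1} \<Longrightarrow> wrep u x * wrep v x = rep_l0 u x * rep_l0 v x / a x"
  using a_pos[of x] by (simp add: wrep_def)

text \<open>Boundedness of \<open>a\<close> makes the weighted norm control the unweighted one, so
  the weighted condition already implies membership in \<open>L2\<close>.\<close>

lemma L2w_iff: "u \<in> L2w a \<longleftrightarrow> square_integrable M01 (wrep u)"
proof -
  have eq: "integrable M01 (\<lambda>x. (wrep u x)\<^sup>2) = integrable M01 (\<lambda>x. (rep_l0 u x)\<^sup>2 / a x)"
    by (rule Bochner_Integration.integrable_cong) (auto simp: power2_eq_square wrep_mult)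
  moreover have "integrable M01 (\<lambda>x. (rep_l0 u x)\<^sup>2)" if "integrable M01 (\<lambda>x. (rep_l0 u x)\<^sup>2 / a x)"
  proof (rule Bochner_Integration.integrable_bound)
    show "integrable M01 (\<lambda>x. B * ((rep_l0 u x)\<^sup>2 / a x))" using that by (intro integrable_mult_right)
    show "(\<lambda>x. (rep_l0 u x)\<^sup>2) \<in> borel_measurable M01" using rep_l0_measurable[of u] by measurable
    show "AE x in M01. norm ((rep_l0 u x)\<^sup>2) \<le> norm (B * ((rep_l0 u x)\<^sup>2 / a x))"
    proof (rule AE_I2)
      fix x assume x: "x \<in> space M01"
      then have "(rep_l0 u x)\<^sup>2 * a x \<le> (rep_l0 u x)\<^sup>2 * B" using a_bounded by (intro mult_left_mono) auto
      then have "(rep_l0 u x)\<^sup>2 \<le> B * ((rep_l0 u x)\<^sup>2 / a x)" using a_pos[of x] x by (simp add: field_simps)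
      then show "norm ((rep_l0 u x)\<^sup>2) \<le> norm (B * ((rep_l0 u x)\<^sup>2 / a x))"
        unfolding real_norm_def abs_of_nonneg[OF zero_le_power2] by (rule order_trans[OF _ abs_ge_self])
    qed
  qed
  ultimately show ?thesis
    using wrep_measurable by (auto simp: L2w_def L2_def square_integrable_def)
qed

lemma ipw_wrep: "ipw a u v = (\<integral>x. wrep u x * wrep v x \<partial>M01)"
  unfolding ipw_def by (rule Bochner_Integration.integral_cong) (auto simp: wrep_mult)

lemma wrep_add: "AE x in M01. wrep (u + v) x = wrep u x + wrep v x"
  using rep_l0_add[of u v] by eventually_elim (simp add: wrep_def add_divide_distrib)

lemma wrep_diff: "AE x in M01. wrep (u - v) x = wrep u x - wrep v x"
  using rep_l0_diff[of u v] by eventually_elim (simp add: wrep_def diff_divide_distrib)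

lemma wrep_scale: "AE x in M01. wrep (c *\<^sub>R u) x = c * wrep u x"
  using rep_l0_scale[of c u] by eventually_elim (simp add: wrep_def)

lemma wrep_0: "AE x in M01. wrep 0 x = 0"
  using rep_l0_0 by eventually_elim (simp add: wrep_def)

lemma wrep_abs:
  assumes f: "f \<in> borel_measurable M01" shows "AE x in M01. wrep (abs_l0 (\<lambda>x. f x * sqrt (a x))) x = f x"
proof -
  note f [measurable]
  have "AE x in M01. rep_l0 (abs_l0 (\<lambda>x. f x * sqrt (a x))) x = f x * sqrt (a x)"
    by (rule rep_abs_l0) measurable
  moreover have "AE x in M01. x \<in> {0<..<1}" by (rule AE_I2) simp
  ultimately show ?thesis
  proof eventually_elim
    case (elim x)
    then show ?case using a_pos[of x] by (simp add: wrep_def)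
  qed
qed

lemma L2w_subspace: "subspace (L2w a)"
proof (rule subspaceI)
  show "0 \<in> L2w a"
    unfolding L2w_iff
  proof (rule square_integrable_cong_AE)
    show "square_integrable M01 (\<lambda>x. 0)" by (rule square_integrable_const[OF finite_M01])
    show "AE x in M01. 0 = wrep 0 x" using wrep_0 by eventually_elim simp
  qed simp
  show "u + v \<in> L2w a" if "u \<in> L2w a" "v \<in> L2w a" for u v
    unfolding L2w_iff
  proof (rule square_integrable_cong_AE)
    show "square_integrable M01 (\<lambda>x. wrep u x + wrep v x)" using that by (auto simp: L2w_iff intro: square_integrable_add)
    show "AE x in M01. wrep u x + wrep v x = wrep (u + v) x" using wrep_add[of u v] by eventually_elim simp
  qed simp
  show "c *\<^sub>R u \<in> L2w a" if "u \<in> L2w a" for u c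
    unfolding L2w_iff
  proof (rule square_integrable_cong_AE)
    show "square_integrable M01 (\<lambda>x. c * wrep u x)" using that by (auto simp: L2w_iff intro: square_integrable_scale)
    show "AE x in M01. c * wrep u x = wrep (c *\<^sub>R u) x" using wrep_scale[of c u] by eventually_elim simp
  qed simp
qed

lemma L2w_integrable: "u \<in> L2w a \<Longrightarrow> v \<in> L2w a \<Longrightarrow> integrable M01 (\<lambda>x. wrep u x * wrep v x)"
  unfolding L2w_iff by (rule square_integrable_mult)

lemma ip_space_L2w: "ip_space (L2w a) (ipw a)"
proof
  show "subspace (L2w a)" by (rule L2w_subspace)
  fix u v w assume uvw: "u \<in> L2w a" "v \<in> L2w a" "w \<in> L2w a"
  have "ipw a (u + v) w = (\<integral>x. wrep u x * wrep w x + wrep v x * wrep w x \<partial>M01)"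
    unfolding ipw_wrep
  proof (rule integral_cong_AE)
    show "AE x in M01. wrep (u + v) x * wrep w x = wrep u x * wrep w x + wrep v x * wrep w x"
      using wrep_add[of u v] by eventually_elim (simp add: algebra_simps)
  qed measurable
  then show "ipw a (u + v) w = ipw a u w + ipw a v w"
    using uvw L2w_integrable by (simp add: ipw_wrep)
next
  fix u v c assume uv: "u \<in> L2w a" "v \<in> L2w a"
  have "ipw a (c *\<^sub>R u) v = (\<integral>x. c * (wrep u x * wrep v x) \<partial>M01)"
    unfolding ipw_wrep
  proof (rule integral_cong_AE)
    show "AE x in M01. wrep (c *\<^sub>R u) x * wrep v x = c * (wrep u x * wrep v x)"
      using wrep_scale[of c u] by eventually_elim simp
  qed measurable
  then show "ipw a (c *\<^sub>R u) v = c * ipw a u v" by (simp add: ipw_wrep)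
next
  show "ipw a u v = ipw a v u" for u v by (simp add: ipw_def mult.commute)
  show "0 \<le> ipw a u u" for u by (simp add: ipw_wrep)
  fix u assume u: "u \<in> L2w a" "ipw a u u = 0"
  have "AE x in M01. wrep u x * wrep u x = 0"
    using u L2w_integrable[of u u] by (subst integral_nonneg_eq_0_iff_AE[symmetric]) (auto simp: ipw_wrep)
  moreover have "AE x in M01. x \<in> {0<..<1}" by (rule AE_I2) simp
  moreover note rep_l0_0
  ultimately have "AE x in M01. rep_l0 u x = rep_l0 0 x"
  proof eventually_elim
    case (elim x)
    then show ?case using a_pos[of x] by (simp add: wrep_def)
  qed
  then show "u = 0" by (rule l0_eqI)
qed

lemma ipnorm_diff: "(ipnorm (ipw a) (u - v))\<^sup>2 = (\<integral>x. (wrep u x - wrep v x)\<^sup>2 \<partial>M01)"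
proof -
  have "(ipnorm (ipw a) (u - v))\<^sup>2 = (\<integral>x. (wrep (u - v) x)\<^sup>2 \<partial>M01)"
    by (simp add: ipnorm_def ipw_wrep flip: power2_eq_square)
  also have "\<dots> = (\<integral>x. (wrep u x - wrep v x)\<^sup>2 \<partial>M01)"
  proof (rule integral_cong_AE)
    show "AE x in M01. (wrep (u - v) x)\<^sup>2 = (wrep u x - wrep v x)\<^sup>2"
      using wrep_diff[of u v] by eventually_elim simp
  qed measurable
  finally show ?thesis .
qed

lemma hilbert_L2w: "hilbert (L2w a) (ipw a)"
proof -
  interpret ip_space "L2w a" "ipw a" by (rule ip_space_L2w)
  show ?thesis
  proof
    fix X :: "nat \<Rightarrow> l0"
    assume X: "\<And>n. X n \<in> L2w a"
      and Cauchy: "\<And>e. 0 < e \<Longrightarrow> \<exists>K. \<forall>m\<ge>K. \<forall>n\<ge>K. N (X m - X n) < e"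
    have "\<exists>K. \<forall>m\<ge>K. \<forall>n\<ge>K. (\<integral>x. (wrep (X m) x - wrep (X n) x)\<^sup>2 \<partial>M01) < e" if e: "e > 0" for e
    proof -
      obtain K where K: "\<forall>m\<ge>K. \<forall>n\<ge>K. N (X m - X n) < sqrt e" using Cauchy[of "sqrt e"] e by auto
      have "(N (X m - X n))\<^sup>2 < (sqrt e)\<^sup>2" if "m \<ge> K" "n \<ge> K" for m n
        using K that X by (intro power_strict_mono N_nonneg) auto
      then show ?thesis using e by (auto simp: ipnorm_diff)
    qed
    then obtain g where g: "square_integrable M01 g"
      and lim: "(\<lambda>n. \<integral>x. (wrep (X n) x - g x)\<^sup>2 \<partial>M01) \<longlonglongrightarrow> 0"
      using L2_complete[OF finite_M01, of "\<lambda>n. wrep (X n)"] X unfolding L2w_iff by blast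
    have gm [measurable]: "g \<in> borel_measurable M01" using g by (rule square_integrable_measurable)
    define l where "l = abs_l0 (\<lambda>x. g x * sqrt (a x))"
    have l: "AE x in M01. wrep l x = g x" unfolding l_def by (rule wrep_abs[OF gm])
    have "l \<in> L2w a" unfolding L2w_iff
    proof (rule square_integrable_cong_AE[OF g])
      show "AE x in M01. g x = wrep l x" using l by eventually_elim simp
    qed simp
    moreover have "(\<lambda>n. N (X n - l)) \<longlonglongrightarrow> 0"
    proof -
      have "(N (X n - l))\<^sup>2 = (\<integral>x. (wrep (X n) x - g x)\<^sup>2 \<partial>M01)" for n
        unfolding ipnorm_diff
      proof (rule integral_cong_AE)
        show "AE x in M01. (wrep (X n) x - wrep l x)\<^sup>2 = (wrep (X n) x - g x)\<^sup>2"
          using l by eventually_elim simp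
      qed measurable
      then have "(\<lambda>n. (N (X n - l))\<^sup>2) \<longlonglongrightarrow> 0" using lim by simp
      then have "(\<lambda>n. sqrt ((N (X n - l))\<^sup>2)) \<longlonglongrightarrow> sqrt 0" by (rule tendsto_real_sqrt)
      then show ?thesis using N_nonneg X \<open>l \<in> L2w a\<close> by simp
    qed
    ultimately show "\<exists>l\<in>L2w a. (\<lambda>n. N (X n - l)) \<longlonglongrightarrow> 0" by blast
  qed
qed

end

section \<open>Test functions and the fundamental lemma\<close>

text \<open>Peeling off the innermost derivative lets closure under sums, products and affine
  substitution be proved by induction with \<open>f\<close> generalised, instead of through a
  Leibniz formula for the iterated \<open>deriv\<close>.\<close>

primrec ndiff :: "nat \<Rightarrow> (real \<Rightarrow> real) \<Rightarrow> bool" where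
  "ndiff 0 f \<longleftrightarrow> True"
| "ndiff (Suc n) f \<longleftrightarrow> (\<forall>x. f field_differentiable at x) \<and> ndiff n (deriv f)"

definition smooth :: "(real \<Rightarrow> real) \<Rightarrow> bool" where
  "smooth f \<longleftrightarrow> (\<forall>n. ndiff n f)"

lemma ndiff_iff: "ndiff n f \<longleftrightarrow> (\<forall>k<n. \<forall>x. (deriv ^^ k) f field_differentiable at x)"
proof (induction n arbitrary: f)
  case (Suc n)
  have "(\<forall>k<Suc n. \<forall>x. (deriv ^^ k) f field_differentiable at x)
    \<longleftrightarrow> (\<forall>x. f field_differentiable at x) \<and> (\<forall>k<n. \<forall>x. (deriv ^^ k) (deriv f) field_differentiable at x)"
    by (auto simp: less_Suc_eq_0_disj funpow_swap1)
  then show ?case using Suc[of "deriv f"] by simp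
qed simp

lemma smooth_iff: "smooth f \<longleftrightarrow> (\<forall>k x. (deriv ^^ k) f field_differentiable at x)"
  unfolding smooth_def ndiff_iff by auto

lemma smooth_iff_deriv: "smooth f \<longleftrightarrow> (\<forall>x. f field_differentiable at x) \<and> smooth (deriv f)"
  unfolding smooth_def by (metis ndiff.simps nat.exhaust)

lemma smooth_differentiable: "smooth f \<Longrightarrow> f field_differentiable at x"
  using smooth_iff_deriv by blast

lemma smooth_DERIV: "smooth f \<Longrightarrow> (f has_real_derivative deriv f x) (at x)"
  using smooth_differentiable DERIV_deriv_iff_field_differentiable by blast

lemma smooth_deriv: "smooth f \<Longrightarrow> smooth (deriv f)"
  using smooth_iff_deriv by blast

lemma smooth_continuous: "smooth f \<Longrightarrow> continuous_on S f"
  using smooth_differentiable field_differentiable_imp_continuous_at continuous_at_imp_continuous_on by blast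

lemma ndiff_Suc_imp: "ndiff (Suc n) f \<Longrightarrow> ndiff n f"
  by (simp add: ndiff_iff del: ndiff.simps)

lemma ndiff_add: "ndiff n f \<Longrightarrow> ndiff n g \<Longrightarrow> ndiff n (\<lambda>x. f x + g x)"
proof (induction n arbitrary: f g)
  case (Suc n)
  then have "deriv (\<lambda>x. f x + g x) = (\<lambda>x. deriv f x + deriv g x)" by (intro ext) (auto intro: deriv_add)
  then show ?case using Suc by (auto intro: field_differentiable_add)
qed simp

lemma ndiff_mult: "ndiff n f \<Longrightarrow> ndiff n g \<Longrightarrow> ndiff n (\<lambda>x. f x * g x)"
proof (induction n arbitrary: f g)
  case (Suc n)
  then have "deriv (\<lambda>x. f x * g x) = (\<lambda>x. f x * deriv g x + deriv f x * g x)"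
    by (intro ext) (auto intro: deriv_mult)
  moreover have "ndiff n (\<lambda>x. f x * deriv g x + deriv f x * g x)"
    using Suc.prems ndiff_Suc_imp[of n f] ndiff_Suc_imp[of n g] by (intro ndiff_add Suc.IH) auto
  ultimately show ?case using Suc.prems by (auto intro: field_differentiable_mult)
qed simp

lemma ndiff_const: "ndiff n (\<lambda>x. c)"
  by (induction n arbitrary: c) auto

lemma ndiff_affine: "ndiff n f \<Longrightarrow> ndiff n (\<lambda>x. f (s * x + t))"
proof (induction n arbitrary: f)
  case (Suc n)
  have D: "((\<lambda>x. f (s * x + t)) has_field_derivative s * deriv f (s * x + t)) (at x)" for x
  proof -
    have "(f has_field_derivative deriv f (s * x + t)) (at (s * x + t))"
      using Suc.prems DERIV_deriv_iff_field_differentiable by auto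
    moreover have "((\<lambda>x. s * x + t) has_field_derivative s) (at x)" by (auto intro!: derivative_eq_intros)
    ultimately show ?thesis using DERIV_chain2 by (metis mult.commute)
  qed
  then have "deriv (\<lambda>x. f (s * x + t)) = (\<lambda>x. s * deriv f (s * x + t))" by (intro ext DERIV_imp_deriv)
  moreover have "ndiff n (\<lambda>x. s * deriv f (s * x + t))"
    using Suc by (intro ndiff_mult ndiff_const) auto
  ultimately show ?case using D by (auto simp: field_differentiable_def)
qed simp

lemma smooth_add: "smooth f \<Longrightarrow> smooth g \<Longrightarrow> smooth (\<lambda>x. f x + g x)"
  by (simp add: smooth_def ndiff_add)

lemma smooth_mult: "smooth f \<Longrightarrow> smooth g \<Longrightarrow> smooth (\<lambda>x. f x * g x)"
  by (simp add: smooth_def ndiff_mult)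

lemma smooth_cmult: "smooth f \<Longrightarrow> smooth (\<lambda>x. c * f x)"
  by (simp add: smooth_def ndiff_mult ndiff_const)

lemma smooth_affine: "smooth f \<Longrightarrow> smooth (\<lambda>x. f (s * x + t))"
  by (simp add: smooth_def ndiff_affine)

text \<open>The functions \<open>x \<mapsto> p(1/x) exp(-1/x)\<close>, extended by zero to \<open>x \<le> 0\<close>: a class closed under
  differentiation.\<close>

definition flat :: "real poly \<Rightarrow> real \<Rightarrow> real" where
  "flat p x = (if 0 < x then poly p (1 / x) * exp (- (1 / x)) else 0)"

lemma poly_exp_decay: "((\<lambda>y::real. poly p y * exp (- y)) \<longlongrightarrow> 0) at_top"
proof -
  have "((\<lambda>y. \<Sum>i\<le>degree p. coeff p i * (y ^ i / exp y)) \<longlongrightarrow> (\<Sum>i\<le>degree p. coeff p i * 0)) at_top"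
    by (intro tendsto_sum tendsto_mult tendsto_const tendsto_power_div_exp_0)
  moreover have "(\<Sum>i\<le>degree p. coeff p i * (y ^ i / exp y)) = poly p y * exp (- y)" for y
    by (simp add: poly_altdef sum_distrib_right exp_minus divide_inverse mult.assoc)
  ultimately show ?thesis by simp
qed

text \<open>In the variable \<open>y = 1 / x\<close> the derivative in \<open>x\<close> is
  \<open>- y\<^sup>2\<close> times the derivative in \<open>y\<close>, and the latter sends
  \<open>p(y) exp(-y)\<close> to \<open>(p' - p)(y) exp(-y)\<close>. At 0 exponential decay beats
  every polynomial.\<close>

lemma flat_DERIV: "(flat p has_real_derivative flat ([:0, 0, 1:] * (p - pderiv p)) x) (at x)"
proof -
  consider "x > 0" | "x < 0" | "x = 0" by linarith
  then show ?thesis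
  proof cases
    case 1
    have "((\<lambda>x. poly p (1 / x) * exp (- (1 / x))) has_real_derivative
       poly (pderiv p) (1 / x) * (- (1 / x\<^sup>2)) * exp (- (1 / x)) + poly p (1 / x) * (exp (- (1 / x)) * (1 / x\<^sup>2))) (at x)"
      using 1 by (auto intro!: derivative_eq_intros DERIV_chain2[OF poly_DERIV] simp: power2_eq_square)
    moreover have "poly (pderiv p) (1 / x) * (- (1 / x\<^sup>2)) * exp (- (1 / x)) + poly p (1 / x) * (exp (- (1 / x)) * (1 / x\<^sup>2))
      = flat ([:0, 0, 1:] * (p - pderiv p)) x"
      using 1 by (simp add: flat_def power2_eq_square algebra_simps diff_divide_distrib)
    ultimately have "((\<lambda>x. poly p (1 / x) * exp (- (1 / x))) has_real_derivative flat ([:0, 0, 1:] * (p - pderiv p)) x) (at x)"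
      by simp
    then show ?thesis
      by (rule has_field_derivative_transform_within_open[of _ _ _ "{0<..}"]) (use 1 in \<open>auto simp: flat_def\<close>)
  next
    case 2
    have "((\<lambda>x. 0) has_real_derivative flat ([:0, 0, 1:] * (p - pderiv p)) x) (at x)"
      using 2 by (simp add: flat_def)
    then show ?thesis
      by (rule has_field_derivative_transform_within_open[of _ _ _ "{..<0}"]) (use 2 in \<open>auto simp: flat_def\<close>)
  next
    case 3
    have "((\<lambda>h. (flat p h - flat p 0) / h) \<longlongrightarrow> 0) (at 0)"
      unfolding filterlim_at_split
    proof
      show "((\<lambda>h. (flat p h - flat p 0) / h) \<longlongrightarrow> 0) (at_left 0)"
      proof (rule Lim_transform_eventually)
        show "\<forall>\<^sub>F h in at_left (0::real). 0 = (flat p h - flat p 0) / h"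
          using eventually_at_left_real[of "-1" "0::real"] by (auto elim!: eventually_mono simp: flat_def)
      qed simp
      \<comment> \<open>With \<open>y = 1 / h\<close> the right difference quotient at 0 is
        \<open>y * p(y) * exp(-y)\<close>.\<close>
      have "((\<lambda>h. poly ([:0, 1:] * p) (inverse h) * exp (- inverse h)) \<longlongrightarrow> 0) (at_right 0)"
        by (rule filterlim_compose[OF poly_exp_decay filterlim_inverse_at_top_right])
      then show "((\<lambda>h. (flat p h - flat p 0) / h) \<longlongrightarrow> 0) (at_right 0)"
      proof (rule Lim_transform_eventually)
        show "\<forall>\<^sub>F h in at_right (0::real). poly ([:0, 1:] * p) (inverse h) * exp (- inverse h) = (flat p h - flat p 0) / h"
          using eventually_at_right_less[of "0::real"]
          by (auto elim!: eventually_mono simp: flat_def divide_inverse)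
      qed
    qed
    then have "((\<lambda>h. (flat p (0 + h) - flat p 0) / h) \<longlongrightarrow> flat ([:0, 0, 1:] * (p - pderiv p)) 0) (at 0)"
      by (simp add: flat_def)
    then show ?thesis unfolding 3 DERIV_def .
  qed
qed

lemma flat_smooth: "smooth (flat p)"
proof -
  have "ndiff n (flat p)" for n
  proof (induction n arbitrary: p)
    case (Suc n)
    have "deriv (flat p) = flat ([:0, 0, 1:] * (p - pderiv p))"
      by (intro ext DERIV_imp_deriv flat_DERIV)
    then show ?case using Suc flat_DERIV by (auto simp: field_differentiable_def)
  qed simp
  then show ?thesis by (simp add: smooth_def)
qed

text \<open>Supports are enclosed in one closed interval inside \<open>{c<..<d}\<close>. The
  variable interval allows the fundamental lemma to be applied away from the end points, where only
  local integrability is known.\<close>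

definition test_on :: "real \<Rightarrow> real \<Rightarrow> (real \<Rightarrow> real) \<Rightarrow> bool" where
  "test_on c d \<phi> \<longleftrightarrow> smooth \<phi> \<and> (\<exists>k l. c < k \<and> k \<le> l \<and> l < d \<and> (\<forall>x. x \<notin> {k..l} \<longrightarrow> \<phi> x = 0))"

lemma test_function_iff: "test_function \<phi> \<longleftrightarrow> test_on 0 1 \<phi>"
proof
  assume "test_on 0 1 \<phi>"
  then obtain k l where "smooth \<phi>" "0 < k" "k \<le> l" "l < 1" "\<forall>x. x \<notin> {k..l} \<longrightarrow> \<phi> x = 0"
    by (auto simp: test_on_def)
  then show "test_function \<phi>"
    unfolding test_function_def by (intro conjI exI[of _ "{k..l}"]) (auto simp: smooth_iff)
next
  assume "test_function \<phi>"
  then obtain K where s: "smooth \<phi>" and K: "compact K" "K \<subseteq> {0<..<1}" "\<And>x. x \<notin> K \<Longrightarrow> \<phi> x = 0"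
    by (auto simp: test_function_def smooth_iff)
  show "test_on 0 1 \<phi>"
  proof (cases "K = {}")
    case True
    then show ?thesis using s K unfolding test_on_def by (intro conjI exI[of _ "1/2"]) auto
  next
    case False
    obtain k where k: "k \<in> K" "\<And>x. x \<in> K \<Longrightarrow> k \<le> x" using compact_attains_inf[OF K(1) False] by auto
    obtain l where l: "l \<in> K" "\<And>x. x \<in> K \<Longrightarrow> x \<le> l" using compact_attains_sup[OF K(1) False] by auto
    have "0 < k" "k \<le> l" "l < 1" using k l K(2) by auto
    moreover have "\<phi> x = 0" if "x \<notin> {k..l}" for x using K(3)[of x] k l that by auto
    ultimately show ?thesis using s unfolding test_on_def by blast
  qed
qed

lemma test_on_mono: "test_on c d \<phi> \<Longrightarrow> c' \<le> c \<Longrightarrow> d \<le> d' \<Longrightarrow> test_on c' d' \<phi>"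
  unfolding test_on_def by (meson le_less_trans less_le_trans)

lemma test_on_smooth: "test_on c d \<phi> \<Longrightarrow> smooth \<phi>"
  by (simp add: test_on_def)

lemma test_on_zero: "test_on c d \<phi> \<Longrightarrow> x \<le> c \<or> d \<le> x \<Longrightarrow> \<phi> x = 0"
  unfolding test_on_def by force

lemma test_on_cmult: "test_on c d \<phi> \<Longrightarrow> test_on c d (\<lambda>x. r * \<phi> x)"
  unfolding test_on_def by (auto intro: smooth_cmult)

lemma test_on_add: assumes "test_on c d \<phi>" "test_on c d \<psi>" shows "test_on c d (\<lambda>x. \<phi> x + \<psi> x)"
proof -
  obtain k l where 1: "c < k" "k \<le> l" "l < d" "\<forall>x. x \<notin> {k..l} \<longrightarrow> \<phi> x = 0" using assms(1) by (auto simp: test_on_def)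
  obtain k' l' where 2: "c < k'" "k' \<le> l'" "l' < d" "\<forall>x. x \<notin> {k'..l'} \<longrightarrow> \<psi> x = 0" using assms(2) by (auto simp: test_on_def)
  have "\<phi> x + \<psi> x = 0" if "x \<notin> {min k k'..max l l'}" for x using 1(4)[rule_format, of x] 2(4)[rule_format, of x] that by (auto simp: min_def max_def split: if_splits)
  then show ?thesis
    using assms 1 2 unfolding test_on_def
    by (intro conjI smooth_add exI[of _ "min k k'"] exI[of _ "max l l'"]) auto
qed

lemma test_on_deriv: assumes "test_on c d \<phi>" shows "test_on c d (deriv \<phi>)"
proof -
  obtain k l where 1: "c < k" "k \<le> l" "l < d" "\<And>x. x \<notin> {k..l} \<Longrightarrow> \<phi> x = 0" using assms by (auto simp: test_on_def)
  have "deriv \<phi> x = 0" if x: "x \<notin> {k..l}" for x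
  proof -
    have "((\<lambda>x. 0) has_real_derivative 0) (at x)" by simp
    then have "(\<phi> has_real_derivative 0) (at x)"
      by (rule has_field_derivative_transform_within_open[of _ _ _ "- {k..l}"]) (use 1 x in auto)
    then show ?thesis by (rule DERIV_imp_deriv)
  qed
  then show ?thesis using 1 assms unfolding test_on_def by (auto intro: smooth_deriv)
qed

lemma test_on_funpow_deriv: "test_on c d \<phi> \<Longrightarrow> test_on c d ((deriv ^^ k) \<phi>)"
  by (induction k) (auto intro: test_on_deriv)

section \<open>Integration over the unit interval\<close>

lemma M01_borel_measurable: "f \<in> borel_measurable borel \<Longrightarrow> f \<in> borel_measurable M01"
  by (intro measurable_restrict_space1 measurable_completion) simp

lemma M01_continuous_integrable:
  fixes f :: "real \<Rightarrow> real"
  assumes "continuous_on {0..1} f" shows "integrable M01 f"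
proof -
  obtain C where C: "\<forall>x\<in>{0..1}. \<bar>f x\<bar> \<le> C"
    using compact_imp_bounded[OF compact_continuous_image[OF assms compact_Icc]] by (auto simp: bounded_iff)
  show ?thesis
  proof (rule finite_measure.integrable_const_bound[OF finite_M01])
    show "AE x in M01. norm (f x) \<le> C" using C by (intro AE_I2) auto
    show "f \<in> borel_measurable M01"
      by (intro continuous_imp_measurable_on_sets_lebesgue continuous_on_subset[OF assms]) auto
  qed
qed

lemma M01_FTC:
  fixes F f :: "real \<Rightarrow> real"
  assumes D: "\<And>x. x \<in> {0..1} \<Longrightarrow> (F has_real_derivative f x) (at x within {0..1})"
    and f: "continuous_on {0..1} f"
  shows "(\<integral>x. f x \<partial>M01) = F 1 - F 0"
proof -
  have "(f has_integral (\<integral>x. f x \<partial>M01)) {0<..<1}"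
    by (rule has_integral_integral_lebesgue_on[OF M01_continuous_integrable[OF f]]) simp
  then have "(f has_integral (\<integral>x. f x \<partial>M01)) {0..1}"
    using has_integral_open_interval[of f _ 0 1] by simp
  moreover have "(f has_integral (F 1 - F 0)) {0..1}"
    using D by (intro fundamental_theorem_of_calculus) (auto simp: has_real_derivative_iff_has_vector_derivative)
  ultimately show ?thesis by (rule has_integral_unique)
qed

lemma test_on_integrable: "test_on c d \<phi> \<Longrightarrow> integrable M01 \<phi>"
  by (intro M01_continuous_integrable smooth_continuous test_on_smooth)

lemma test_on_bounded:
  assumes "test_on c d \<phi>" obtains C where "\<And>x. \<bar>\<phi> x\<bar> \<le> C"
proof -
  obtain k l where kl: "\<And>x. x \<notin> {k..l} \<Longrightarrow> \<phi> x = 0" using assms by (auto simp: test_on_def)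
  have "compact (\<phi> ` {k..l})"
    by (intro compact_continuous_image smooth_continuous test_on_smooth[OF assms]) simp
  then obtain C where C: "\<forall>x\<in>{k..l}. \<bar>\<phi> x\<bar> \<le> C" by (auto dest!: compact_imp_bounded simp: bounded_iff)
  have "\<bar>\<phi> x\<bar> \<le> max C 0" for x using C kl[of x] by (cases "x \<in> {k..l}") (auto simp: le_max_iff_disj)
  then show ?thesis using that by blast
qed

lemma test_on_integrable_mult:
  assumes "test_on c d \<phi>" and q: "integrable M01 q" shows "integrable M01 (\<lambda>x. q x * \<phi> x)"
proof -
  obtain C where C: "\<And>x. \<bar>\<phi> x\<bar> \<le> C" using test_on_bounded[OF assms(1)] by blast
  show ?thesis
  proof (rule Bochner_Integration.integrable_bound)
    show "integrable M01 (\<lambda>x. C * q x)" using q by simp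
    show "(\<lambda>x. q x * \<phi> x) \<in> borel_measurable M01" using q test_on_integrable[OF assms(1)] by auto
    have "0 \<le> C" using C[of 0] by simp
    have "\<bar>q x\<bar> * \<bar>\<phi> x\<bar> \<le> \<bar>q x\<bar> * C" for x by (rule mult_left_mono[OF C]) simp
    then show "AE x in M01. norm (q x * \<phi> x) \<le> norm (C * q x)"
      using \<open>0 \<le> C\<close> by (intro AE_I2) (simp add: abs_mult mult.commute)
  qed
qed

text \<open>With \<open>m = n + 1\<close> the two arguments are \<open>m * (x - c) - 1\<close> and
  \<open>m * (d - x) - 1\<close>. The shift by 1 keeps the support away from \<open>c\<close> and
  \<open>d\<close>; as \<open>m\<close> grows, both factors tend to 1 inside the interval. The
  affine form suits \<open>smooth_affine\<close>.\<close>

definition bump :: "real \<Rightarrow> real \<Rightarrow> nat \<Rightarrow> real \<Rightarrow> real" where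
  "bump c d n x = flat 1 (real (Suc n) * x + (- real (Suc n) * c - 1)) * flat 1 (- real (Suc n) * x + (real (Suc n) * d - 1))"

lemma flat_1_bounds: "0 \<le> flat 1 x" "flat 1 x \<le> 1"
  by (auto simp: flat_def)

lemma bump_bounds: "0 \<le> bump c d n x" "bump c d n x \<le> 1"
  unfolding bump_def using flat_1_bounds by (auto intro: mult_le_one)

lemma flat_nonpos: "x \<le> 0 \<Longrightarrow> flat p x = 0"
  by (simp add: flat_def)

lemma bump_zero: assumes "x \<le> c \<or> d \<le> x" shows "bump c d n x = 0"
  using assms
proof
  assume "x \<le> c"
  then have "real (Suc n) * x \<le> real (Suc n) * c" by (intro mult_left_mono) auto
  then have "flat 1 (real (Suc n) * x + (- real (Suc n) * c - 1)) = 0" by (intro flat_nonpos) linarith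
  then show ?thesis by (simp only: bump_def mult_zero_left)
next
  assume "d \<le> x"
  then have "real (Suc n) * d \<le> real (Suc n) * x" by (intro mult_left_mono) auto
  then have "flat 1 (- real (Suc n) * x + (real (Suc n) * d - 1)) = 0" by (intro flat_nonpos) linarith
  then show ?thesis by (simp only: bump_def mult_zero_right)
qed

lemma bump_test_on: assumes "c < d" shows "test_on c d (bump c d n)"
proof -
  have s: "smooth (bump c d n)" unfolding bump_def by (intro smooth_mult smooth_affine flat_smooth)
  \<comment> \<open>The midpoint \<open>?h\<close> keeps the enclosing interval nonempty when
    \<open>c + 1 / ?m\<close> exceeds \<open>d - 1 / ?m\<close>.\<close>
  let ?m = "real (Suc n)" and ?h = "(c + d) / 2"
  have "bump c d n x = 0" if "x \<notin> {min (c + 1 / ?m) ?h..max (d - 1 / ?m) ?h}" for x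
  proof -
    have "x \<le> c + 1 / ?m \<or> d - 1 / ?m \<le> x" using that by auto
    then have "?m * x \<le> ?m * (c + 1 / ?m) \<or> ?m * (d - 1 / ?m) \<le> ?m * x"
      by (metis mult_left_mono of_nat_0_le_iff)
    then have "?m * x \<le> ?m * c + 1 \<or> ?m * d - 1 \<le> ?m * x"
      by (simp add: distrib_left right_diff_distrib del: of_nat_Suc)
    then show ?thesis by (auto simp: bump_def flat_def simp del: of_nat_Suc)
  qed
  then show ?thesis
    unfolding test_on_def using s assms
    by (intro conjI exI[of _ "min (c + 1 / ?m) ?h"] exI[of _ "max (d - 1 / ?m) ?h"]) (auto simp: min_def max_def)
qed

lemma bump_tendsto:
  assumes "c < x" "x < d" shows "(\<lambda>n. bump c d n x) \<longlonglongrightarrow> 1"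
proof -
  have lim: "(\<lambda>n. flat 1 (real (Suc n) * y - 1)) \<longlonglongrightarrow> 1" if y: "0 < y" for y :: real
  proof -
    have top: "filterlim (\<lambda>n. real (Suc n) * y - 1) at_top sequentially"
    proof -
      have "filterlim (\<lambda>n. real (Suc n)) at_top sequentially"
        by (rule filterlim_compose[OF filterlim_real_sequentially filterlim_Suc])
      then have "filterlim (\<lambda>n. y * real (Suc n)) at_top sequentially"
        using y by (intro filterlim_tendsto_pos_mult_at_top[OF tendsto_const]) auto
      then have "filterlim (\<lambda>n. -1 + y * real (Suc n)) at_top sequentially"
        by (intro filterlim_tendsto_add_at_top[OF tendsto_const])
      then show ?thesis by (simp add: mult.commute)
    qed
    have "((\<lambda>z::real. exp (- inverse z)) \<longlongrightarrow> exp (- 0)) at_top"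
      by (intro tendsto_intros tendsto_inverse_0_at_top filterlim_ident)
    moreover have "\<forall>\<^sub>F z in at_top. exp (- inverse z) = flat 1 z"
      using eventually_gt_at_top[of "0::real"] by eventually_elim (simp add: flat_def inverse_eq_divide)
    ultimately have "((\<lambda>z. flat 1 z) \<longlongrightarrow> exp (- 0)) at_top" by (rule Lim_transform_eventually)
    then have "((\<lambda>z. flat 1 z) \<longlongrightarrow> 1) at_top" by simp
    then show ?thesis using top by (rule filterlim_compose)
  qed
  have "(\<lambda>n. flat 1 (real (Suc n) * (x - c) - 1) * flat 1 (real (Suc n) * (d - x) - 1)) \<longlonglongrightarrow> 1 * 1"
    using assms by (intro tendsto_mult lim) auto
  then show ?thesis unfolding bump_def by (simp add: algebra_simps)
qed

lemma bump_integral_tendsto: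
  assumes q: "integrable M01 q"
  shows "(\<lambda>n. \<integral>x. q x * bump c d n x \<partial>M01) \<longlonglongrightarrow> (\<integral>x. q x * indicator {c<..<d} x \<partial>M01)"
proof (rule integral_dominated_convergence)
  have [measurable]: "q \<in> borel_measurable M01" using q by simp
  show "(\<lambda>x. q x * indicator {c<..<d} x) \<in> borel_measurable M01"
    by (rule borel_measurable_times[OF _ M01_borel_measurable]) auto
  show "(\<lambda>x. q x * bump c d n x) \<in> borel_measurable M01" for n
  proof -
    have "smooth (bump c d n)" unfolding bump_def by (intro smooth_mult smooth_affine flat_smooth)
    then have "bump c d n \<in> borel_measurable M01"
      by (intro continuous_imp_measurable_on_sets_lebesgue smooth_continuous) auto
    then show ?thesis by measurable
  qed
  show "integrable M01 (\<lambda>x. norm (q x))" using q by simp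
  show "AE x in M01. (\<lambda>n. q x * bump c d n x) \<longlonglongrightarrow> q x * indicator {c<..<d} x"
  proof (rule AE_I2)
    fix x
    have "(\<lambda>n. bump c d n x) \<longlonglongrightarrow> indicator {c<..<d} x"
      using bump_tendsto[of c x d] bump_zero[of x c d] by (cases "c < x \<and> x < d") (auto simp: not_less)
    then show "(\<lambda>n. q x * bump c d n x) \<longlonglongrightarrow> q x * indicator {c<..<d} x" by (intro tendsto_intros)
  qed
  show "AE x in M01. norm (q x * bump c d n x) \<le> norm (q x)" for n
    using bump_bounds[of c d n] by (intro AE_I2) (auto simp: abs_mult mult_left_le)
qed

text \<open>As \<open>ennreal\<close> truncates negative values, the factors \<open>s = 1\<close>
  and \<open>s = -1\<close> produce the positive and the negative part of \<open>g\<close>. The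
  measures with these densities agree on all half-lines, hence everywhere, and densities are unique
  almost everywhere.\<close>

lemma AE_zero_if_half_lines:
  fixes g :: "real \<Rightarrow> real"
  assumes g: "integrable lborel g" and zero: "\<And>x. (\<integral>t. g t * indicator {x<..} t \<partial>lborel) = 0"
  shows "AE x in lborel. g x = 0"
proof -
  have gm [measurable]: "g \<in> borel_measurable borel" using g by simp
  have emeasure: "emeasure (density lborel (\<lambda>t. ennreal (s * g t))) {x<..}
      = ennreal (\<integral>t. max 0 (s * g t) * indicator {x<..} t \<partial>lborel)" for s x
  proof -
    have "emeasure (density lborel (\<lambda>t. ennreal (s * g t))) {x<..} = (\<integral>\<^sup>+t. ennreal (s * g t) * indicator {x<..} t \<partial>lborel)"
      by (rule emeasure_density) auto
    also have "\<dots> = (\<integral>\<^sup>+t. ennreal (max 0 (s * g t) * indicator {x<..} t) \<partial>lborel)"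
      by (intro nn_integral_cong) (auto simp: max_def ennreal_neg split: split_indicator)
    also have "\<dots> = ennreal (\<integral>t. max 0 (s * g t) * indicator {x<..} t \<partial>lborel)"
    proof (rule nn_integral_eq_integral)
      show "integrable lborel (\<lambda>t. max 0 (s * g t) * indicator {x<..} t)"
        by (rule Bochner_Integration.integrable_bound[of _ "\<lambda>t. s * g t"])
          (use g in \<open>auto simp: max_def split: split_indicator\<close>)
    qed auto
    finally show ?thesis .
  qed
  have "density lborel (\<lambda>t. ennreal (1 * g t)) = density lborel (\<lambda>t. ennreal (-1 * g t))"
  proof (rule measure_eqI_lessThan)
    fix x
    show "emeasure (density lborel (\<lambda>t. ennreal (1 * g t))) {x<..} < \<infinity>" unfolding emeasure by simp
    have int: "integrable lborel (\<lambda>t. max 0 (s * g t) * indicator {x<..} t)" for s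
      by (rule Bochner_Integration.integrable_bound[of _ "\<lambda>t. s * g t"])
        (use g in \<open>auto simp: max_def split: split_indicator\<close>)
    have "(\<integral>t. max 0 (1 * g t) * indicator {x<..} t \<partial>lborel) - (\<integral>t. max 0 (-1 * g t) * indicator {x<..} t \<partial>lborel)
      = (\<integral>t. max 0 (1 * g t) * indicator {x<..} t - max 0 (-1 * g t) * indicator {x<..} t \<partial>lborel)"
      by (rule Bochner_Integration.integral_diff[symmetric]) (rule int)+
    also have "\<dots> = (\<integral>t. g t * indicator {x<..} t \<partial>lborel)"
      by (rule Bochner_Integration.integral_cong) (auto split: split_indicator)
    also have "\<dots> = 0" by (rule zero)
    finally show "emeasure (density lborel (\<lambda>t. ennreal (1 * g t))) {x<..} = emeasure (density lborel (\<lambda>t. ennreal (-1 * g t))) {x<..}"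
      unfolding emeasure by simp
  qed auto
  then have "AE t in lborel. ennreal (1 * g t) = ennreal (-1 * g t)"
    by (subst (asm) sigma_finite_measure.density_unique_iff[OF sigma_finite_lborel]) auto
  then show ?thesis
  proof eventually_elim
    case (elim t)
    then show ?case by (cases "0 \<le> g t") (auto simp: ennreal_neg)
  qed
qed

text \<open>The functions \<open>bump\<close> approximate indicators boundedly, so \<open>q\<close>
  integrates to 0 over all intervals \<open>{k<..<d}\<close> with \<open>k \<ge> c\<close>; these
  play the role of half-lines for the truncation \<open>p\<close> of \<open>q\<close>.\<close>

lemma AE_zero_if_orthogonal_to_tests:
  assumes q: "integrable M01 q" and cd: "0 \<le> c" "d \<le> 1"
    and orth: "\<And>\<phi>. test_on c d \<phi> \<Longrightarrow> (\<integral>x. q x * \<phi> x \<partial>M01) = 0"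
  shows "AE x in M01. x \<in> {c<..<d} \<longrightarrow> q x = 0"
proof -
  have intervals: "(\<integral>x. q x * indicator {k<..<d} x \<partial>M01) = 0" if k: "c \<le> k" for k
  proof (cases "k < d")
    case True
    have "(\<integral>x. q x * bump k d n x \<partial>M01) = 0" for n
      using test_on_mono[OF bump_test_on[OF True] k order_refl] by (rule orth)
    then show ?thesis using LIMSEQ_unique[OF bump_integral_tendsto[OF q, of k d]] by force
  qed simp
  define p where "p t = indicator {c<..<d} t * q t" for t
  have p_ind: "indicator {0<..<1} t * (q t * indicator {c<..<d} t) = p t" for t :: real
    using cd by (auto simp: p_def split: split_indicator)
  have qi: "integrable M01 (\<lambda>x. q x * indicator {k<..<d} x)" for k
    by (rule Bochner_Integration.integrable_bound[OF q])
      (use q in \<open>auto intro!: borel_measurable_times[OF _ M01_borel_measurable] split: split_indicator\<close>)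
  have p: "integrable lebesgue p"
    using qi[of c] by (subst (asm) integrable_restrict_space) (auto simp: p_ind)
  \<comment> \<open>\<open>p\<close> is only Lebesgue measurable, while the half-line argument
    compares Borel measures; a Borel function equal to \<open>p\<close> almost everywhere takes its
    place.\<close>
  obtain g where g [measurable]: "g \<in> borel_measurable lborel" and pg: "AE x in lborel. p x = g x"
    using completion_ex_borel_measurable_real[of p lborel] p by auto
  have pg': "AE x in lebesgue. p x = g x" using pg by (rule AE_completion)
  have gl: "g \<in> borel_measurable lebesgue" using g by (rule measurable_completion)
  have "integrable lebesgue g"
    using p integrable_cong_AE[of p lebesgue g] pg' gl by auto
  then have gi: "integrable lborel g" using g by (simp add: integrable_completion)
  have "AE x in lborel. g x = 0"
  proof (rule AE_zero_if_half_lines[OF gi])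
    fix x :: real
    have "(\<integral>t. g t * indicator {x<..} t \<partial>lborel) = (\<integral>t. g t * indicator {x<..} t \<partial>lebesgue)"
      by (rule integral_completion[symmetric]) measurable
    also have "\<dots> = (\<integral>t. p t * indicator {x<..} t \<partial>lebesgue)"
    proof (rule integral_cong_AE)
      show "AE t in lebesgue. g t * indicator {x<..} t = p t * indicator {x<..} t"
        using pg' by eventually_elim simp
      have ind: "indicator {x<..} \<in> borel_measurable lebesgue" by (rule measurable_completion) simp
      show "(\<lambda>t. g t * indicator {x<..} t) \<in> borel_measurable lebesgue"
        by (rule borel_measurable_times[OF gl ind])
      show "(\<lambda>t. p t * indicator {x<..} t) \<in> borel_measurable lebesgue"
        by (rule borel_measurable_times[OF borel_measurable_integrable[OF p] ind])
    qed
    also have "\<dots> = (\<integral>t. indicator {0<..<1} t *\<^sub>R (q t * indicator {max c x<..<d} t) \<partial>lebesgue)"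
      using cd by (intro Bochner_Integration.integral_cong) (auto simp: p_def indicator_def)
    also have "\<dots> = (\<integral>t. q t * indicator {max c x<..<d} t \<partial>M01)"
      by (rule integral_restrict_space[symmetric]) simp
    also have "\<dots> = 0" by (rule intervals) simp
    finally show "(\<integral>t. g t * indicator {x<..} t \<partial>lborel) = 0" .
  qed
  then have "AE x in lborel. p x = 0" using pg by eventually_elim simp
  then have "AE x in lebesgue. p x = 0" by (rule AE_completion)
  then have "AE x in lebesgue. x \<in> {0<..<1} \<longrightarrow> x \<in> {c<..<d} \<longrightarrow> q x = 0"
    by eventually_elim (auto simp: p_def indicator_def)
  then show ?thesis by (subst AE_restrict_space_iff) auto
qed

section \<open>Antiderivatives of test functions and the lemma of du Bois-Reymond\<close>

lemma smooth_constant: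
  assumes F: "smooth F" and "u \<le> v" and zero: "\<And>t. u < t \<Longrightarrow> t < v \<Longrightarrow> deriv F t = 0"
  shows "F u = F v"
proof (cases "u = v")
  case False
  then have "u < v" using assms by simp
  moreover have "continuous_on {u..v} F" by (rule smooth_continuous[OF F])
  moreover have "(F has_real_derivative 0) (at t)" if "u < t" "t < v" for t
    using smooth_DERIV[OF F, of t] zero[OF that] by simp
  ultimately show ?thesis using DERIV_isconst_end[of u v F] by auto
qed simp

lemma smooth_antiderivative:
  assumes s: "smooth \<psi>"
  obtains F where "smooth F" "deriv F = \<psi>" "F 0 = 0" "F 1 = (\<integral>x. \<psi> x \<partial>M01)"
proof -
  have "isCont \<psi> x" for x
    using smooth_differentiable[OF s] field_differentiable_imp_continuous_at by blast
  then obtain G where G: "\<And>x. (G has_real_derivative \<psi> x) (at x)"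
    using einterval_antiderivative[of "-\<infinity>" "\<infinity>" \<psi>]
    by (auto simp: has_real_derivative_iff_has_vector_derivative)
  define F where "F x = G x - G 0" for x
  have D: "(F has_real_derivative \<psi> x) (at x)" for x
    unfolding F_def by (auto intro!: derivative_eq_intros G)
  then have der: "deriv F = \<psi>" by (intro ext DERIV_imp_deriv)
  have F: "smooth F" using smooth_iff_deriv[of F] der s D by (auto simp: field_differentiable_def)
  have "(\<integral>x. \<psi> x \<partial>M01) = F 1 - F 0"
    by (rule M01_FTC[OF has_field_derivative_at_within[OF D] smooth_continuous[OF s]])
  then show ?thesis using that[OF F der] by (simp add: F_def)
qed

text \<open>An antiderivative is constant on either side of the support: 0 on the left by
  normalisation, and 0 on the right because the mean vanishes.\<close>

lemma test_on_antiderivative: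
  assumes \<psi>: "test_on c d \<psi>" and cd: "0 \<le> c" "d \<le> 1" and mean: "(\<integral>x. \<psi> x \<partial>M01) = 0"
  obtains \<phi> where "test_on c d \<phi>" "deriv \<phi> = \<psi>"
proof -
  obtain k l where kl: "c < k" "k \<le> l" "l < d" "\<And>x. x \<notin> {k..l} \<Longrightarrow> \<psi> x = 0"
    using \<psi> by (auto simp: test_on_def)
  obtain \<phi> where \<phi>: "smooth \<phi>" "deriv \<phi> = \<psi>" "\<phi> 0 = 0" "\<phi> 1 = (\<integral>x. \<psi> x \<partial>M01)"
    using smooth_antiderivative[OF test_on_smooth[OF \<psi>]] by blast
  note const = smooth_constant[OF \<phi>(1), unfolded \<phi>(2)]
  have "\<phi> x = 0" if x: "x \<notin> {k..l}" for x
  proof -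
    from x consider "x < k" | "l < x" by fastforce
    then show ?thesis
    proof cases
      case 1
      then have "\<phi> x = \<phi> 0"
        using const[of x 0] const[of 0 x] kl cd by (cases "x \<le> 0") auto
      then show ?thesis using \<phi> by simp
    next
      case 2
      then have "\<phi> x = \<phi> 1"
        using const[of x 1] const[of 1 x] kl cd by (cases "x \<le> 1") auto
      then show ?thesis using \<phi> mean by simp
    qed
  qed
  then have "test_on c d \<phi>" using kl \<phi>(1) unfolding test_on_def by blast
  then show ?thesis using \<phi>(2) that by blast
qed

text \<open>By parts, the vanishing first moment of \<open>\<psi>\<close> says that its
  antiderivative again has mean zero, so \<open>test_on_antiderivative\<close> applies
  twice.\<close>

lemma test_on_antiderivative2:
  assumes \<psi>: "test_on c d \<psi>" and cd: "0 \<le> c" "d \<le> 1"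
    and mean: "(\<integral>x. \<psi> x \<partial>M01) = 0" "(\<integral>x. x * \<psi> x \<partial>M01) = 0"
  obtains \<phi> where "test_on c d \<phi>" "(deriv ^^ 2) \<phi> = \<psi>"
proof -
  obtain \<eta> where \<eta>: "test_on c d \<eta>" "deriv \<eta> = \<psi>" using test_on_antiderivative[OF \<psi> cd mean(1)] by blast
  have s: "smooth \<eta>" using \<eta> test_on_smooth by blast
  have "(\<integral>x. \<eta> x + x * \<psi> x \<partial>M01) = 1 * \<eta> 1 - 0 * \<eta> 0"
  proof (rule M01_FTC)
    show "((\<lambda>x. x * \<eta> x) has_real_derivative \<eta> x + x * \<psi> x) (at x within {0..1})" for x
      using smooth_DERIV[OF s, of x] unfolding \<eta>(2)
      by (auto intro!: derivative_eq_intros intro: has_field_derivative_at_within)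
    show "continuous_on {0..1} (\<lambda>x. \<eta> x + x * \<psi> x)"
      by (intro continuous_intros smooth_continuous s test_on_smooth[OF \<psi>])
  qed
  moreover have "\<eta> 1 = 0" using test_on_zero[OF \<eta>(1), of 1] cd by simp
  moreover have "integrable M01 \<eta>" "integrable M01 (\<lambda>x. x * \<psi> x)"
    using test_on_integrable[OF \<eta>(1)] test_on_integrable_mult[OF \<psi>, of "\<lambda>x. x"]
      M01_continuous_integrable[OF continuous_on_id] by auto
  ultimately have "(\<integral>x. \<eta> x \<partial>M01) = 0" using mean(2) by simp
  then obtain \<phi> where "test_on c d \<phi>" "deriv \<phi> = \<eta>" using test_on_antiderivative[OF \<eta>(1) cd] by blast
  then show ?thesis using that[of \<phi>] \<eta>(2) by (simp add: numeral_2_eq_2)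
qed

lemma test_on_positive_integral:
  assumes cd: "0 \<le> c" "c < d" "d \<le> 1"
  obtains \<psi> where "test_on c d \<psi>" "\<And>x. 0 \<le> \<psi> x" "0 < (\<integral>x. \<psi> x \<partial>M01)"
proof -
  have "(\<lambda>n. \<integral>x. 1 * bump c d n x \<partial>M01) \<longlonglongrightarrow> (\<integral>x. 1 * indicator {c<..<d} x \<partial>M01)"
    by (rule bump_integral_tendsto) (simp add: finite_measure.integrable_const[OF finite_M01])
  moreover have "(\<integral>x. 1 * indicator {c<..<d} x \<partial>M01) = d - c"
  proof -
    have "(\<integral>x. 1 * indicator {c<..<d} x \<partial>M01) = measure M01 ({c<..<d} \<inter> space M01)" by simp
    also have "{c<..<d} \<inter> space M01 = {c<..<d}" using cd by auto
    also have "measure M01 {c<..<d} = measure lebesgue {c<..<d}" using cd by (intro measure_restrict_space) auto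
    also have "\<dots> = d - c" using cd by simp
    finally show ?thesis .
  qed
  ultimately have "\<forall>\<^sub>F n in sequentially. 0 < (\<integral>x. bump c d n x \<partial>M01)"
    using cd by (intro order_tendstoD(1)) auto
  then obtain n where "0 < (\<integral>x. bump c d n x \<partial>M01)" by (auto simp: eventually_sequentially)
  then show ?thesis using that[OF bump_test_on[OF cd(2)], of n] bump_bounds(1) by blast
qed

text \<open>Two nonnegative bumps in the outer thirds of the interval have centres of mass separated
  by \<open>k < l\<close>. Hence the matrix of their zeroth and first moments has positive
  determinant \<open>?D\<close>, and inverting it gives functions dual to the two moments.\<close>

lemma test_on_moments:
  assumes cd: "0 \<le> c" "c < d" "d \<le> 1"
  obtains \<theta>1 \<theta>2 where "test_on c d \<theta>1" "test_on c d \<theta>2"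
    "(\<integral>x. \<theta>1 x \<partial>M01) = 1" "(\<integral>x. x * \<theta>1 x \<partial>M01) = 0" "(\<integral>x. \<theta>2 x \<partial>M01) = 0" "(\<integral>x. x * \<theta>2 x \<partial>M01) = 1"
proof -
  define k where "k = (2 * c + d) / 3"
  define l where "l = (c + 2 * d) / 3"
  have kl: "c < k" "k < l" "l < d" using cd by (auto simp: k_def l_def)
  obtain \<psi>1 where 1: "test_on c k \<psi>1" "\<And>x. 0 \<le> \<psi>1 x" "0 < (\<integral>x. \<psi>1 x \<partial>M01)"
    using test_on_positive_integral[of c k] kl cd by auto
  obtain \<psi>2 where 2: "test_on l d \<psi>2" "\<And>x. 0 \<le> \<psi>2 x" "0 < (\<integral>x. \<psi>2 x \<partial>M01)"
    using test_on_positive_integral[of l d] kl cd by auto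
  let ?A1 = "\<integral>x. \<psi>1 x \<partial>M01" and ?A2 = "\<integral>x. \<psi>2 x \<partial>M01"
  let ?B1 = "\<integral>x. x * \<psi>1 x \<partial>M01" and ?B2 = "\<integral>x. x * \<psi>2 x \<partial>M01"
  have i: "integrable M01 \<psi>1" "integrable M01 \<psi>2" using 1(1) 2(1) by (auto intro: test_on_integrable)
  have xi: "integrable M01 (\<lambda>x. x)" by (intro M01_continuous_integrable continuous_intros)
  have j: "integrable M01 (\<lambda>x. x * \<psi>1 x)" "integrable M01 (\<lambda>x. x * \<psi>2 x)"
    using test_on_integrable_mult[OF 1(1) xi] test_on_integrable_mult[OF 2(1) xi] by auto
  have "?B1 \<le> (\<integral>x. k * \<psi>1 x \<partial>M01)"
  proof (rule integral_mono[OF j(1)])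
    show "integrable M01 (\<lambda>x. k * \<psi>1 x)" using i by simp
    show "x * \<psi>1 x \<le> k * \<psi>1 x" for x
      using 1(2)[of x] test_on_zero[OF 1(1), of x] by (cases "x \<le> k") (auto intro: mult_right_mono)
  qed
  then have B1: "?B1 \<le> k * ?A1" by simp
  have "(\<integral>x. l * \<psi>2 x \<partial>M01) \<le> ?B2"
  proof (rule integral_mono[OF _ j(2)])
    show "integrable M01 (\<lambda>x. l * \<psi>2 x)" using i by simp
    show "l * \<psi>2 x \<le> x * \<psi>2 x" for x
      using 2(2)[of x] test_on_zero[OF 2(1), of x] by (cases "l \<le> x") (auto intro: mult_right_mono)
  qed
  then have B2: "l * ?A2 \<le> ?B2" by simp
  let ?D = "?A1 * ?B2 - ?A2 * ?B1"
  have "0 < ?A1 * ?A2 * (l - k)" using 1 2 kl by simp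
  also have "\<dots> = ?A1 * (l * ?A2) - ?A2 * (k * ?A1)" by (simp add: algebra_simps)
  also have "\<dots> \<le> ?D" using B1 B2 1(3) 2(3) by (intro diff_mono mult_left_mono) auto
  finally have D: "?D \<noteq> 0" by simp
  have t: "test_on c d \<psi>1" "test_on c d \<psi>2"
    using test_on_mono[OF 1(1), of c d] test_on_mono[OF 2(1), of c d] kl by auto
  have comb: "(\<integral>x. r * \<psi>1 x + s * \<psi>2 x \<partial>M01) = r * ?A1 + s * ?A2"
    "(\<integral>x. x * (r * \<psi>1 x + s * \<psi>2 x) \<partial>M01) = r * ?B1 + s * ?B2" for r s
  proof -
    show "(\<integral>x. r * \<psi>1 x + s * \<psi>2 x \<partial>M01) = r * ?A1 + s * ?A2" using i by simp
    have "(\<integral>x. x * (r * \<psi>1 x + s * \<psi>2 x) \<partial>M01) = (\<integral>x. r * (x * \<psi>1 x) + s * (x * \<psi>2 x) \<partial>M01)"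
      by (simp add: algebra_simps)
    then show "(\<integral>x. x * (r * \<psi>1 x + s * \<psi>2 x) \<partial>M01) = r * ?B1 + s * ?B2" using j by simp
  qed
  let ?\<theta>1 = "\<lambda>x. ?B2 / ?D * \<psi>1 x + (- ?B1 / ?D) * \<psi>2 x"
  let ?\<theta>2 = "\<lambda>x. (- ?A2 / ?D) * \<psi>1 x + ?A1 / ?D * \<psi>2 x"
  have alg: "b2 / D * a1 + (- b1 / D) * a2 = 1" "b2 / D * b1 + (- b1 / D) * b2 = 0"
    "(- a2 / D) * a1 + a1 / D * a2 = 0" "(- a2 / D) * b1 + a1 / D * b2 = 1"
    if "D = a1 * b2 - a2 * b1" "D \<noteq> 0" for a1 a2 b1 b2 D :: real
    using that by (auto simp: field_simps)
  show ?thesis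
  proof (rule that[of ?\<theta>1 ?\<theta>2])
    show "test_on c d ?\<theta>1" "test_on c d ?\<theta>2" by (intro test_on_add test_on_cmult t)+
  qed (unfold comb, (rule alg[OF refl D])+)
qed

text \<open>Subtracting multiples of the dual functions \<open>\<theta>1\<close> and
  \<open>\<theta>2\<close> from a test function \<open>\<psi>\<close> leaves a second derivative of
  a test function, to which \<open>q\<close> is orthogonal. So \<open>q\<close> acts on
  \<open>\<psi>\<close> only through the moments of \<open>\<psi>\<close>, with coefficients given
  by the pairings of \<open>q\<close> with \<open>\<theta>1\<close> and
  \<open>\<theta>2\<close>.\<close>

lemma du_Bois_Reymond_second_order:
  assumes q: "integrable M01 q" and cd: "0 \<le> c" "c < d" "d \<le> 1"
    and orth: "\<And>\<phi>. test_on c d \<phi> \<Longrightarrow> (\<integral>x. q x * (deriv ^^ 2) \<phi> x \<partial>M01) = 0"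
  obtains \<alpha> \<beta> where "AE x in M01. x \<in> {c<..<d} \<longrightarrow> q x = \<alpha> + \<beta> * x"
proof -
  obtain \<theta>1 \<theta>2 where \<theta>: "test_on c d \<theta>1" "test_on c d \<theta>2"
    "(\<integral>x. \<theta>1 x \<partial>M01) = 1" "(\<integral>x. x * \<theta>1 x \<partial>M01) = 0" "(\<integral>x. \<theta>2 x \<partial>M01) = 0" "(\<integral>x. x * \<theta>2 x \<partial>M01) = 1"
    using test_on_moments[OF cd] by blast
  define \<alpha> where "\<alpha> = (\<integral>x. q x * \<theta>1 x \<partial>M01)"
  define \<beta> where "\<beta> = (\<integral>x. q x * \<theta>2 x \<partial>M01)"
  have xi: "integrable M01 (\<lambda>x. x)" by (intro M01_continuous_integrable continuous_intros)
  have ci: "integrable M01 (\<lambda>x. r)" for r :: real by (rule finite_measure.integrable_const[OF finite_M01])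
  have mi: "integrable M01 \<phi>" "integrable M01 (\<lambda>x. x * \<phi> x)" "integrable M01 (\<lambda>x. q x * \<phi> x)" if "test_on c d \<phi>" for \<phi>
    using test_on_integrable[OF that] test_on_integrable_mult[OF that xi] test_on_integrable_mult[OF that q] by auto
  have "AE x in M01. x \<in> {c<..<d} \<longrightarrow> q x - (\<alpha> + \<beta> * x) = 0"
  proof (rule AE_zero_if_orthogonal_to_tests)
    show "integrable M01 (\<lambda>x. q x - (\<alpha> + \<beta> * x))" using q xi ci by simp
    fix \<psi> assume \<psi>: "test_on c d \<psi>"
    define m where "m = (\<integral>x. \<psi> x \<partial>M01)"
    define n where "n = (\<integral>x. x * \<psi> x \<partial>M01)"
    let ?\<eta> = "\<lambda>x. \<psi> x + ((- m) * \<theta>1 x + (- n) * \<theta>2 x)"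
    have \<eta>: "test_on c d ?\<eta>" by (intro test_on_add test_on_cmult \<psi> \<theta>)
    have "(\<integral>x. ?\<eta> x \<partial>M01) = 0" using mi[OF \<psi>] mi[OF \<theta>(1)] mi[OF \<theta>(2)] \<theta> by (simp add: m_def)
    moreover have "(\<integral>x. x * ?\<eta> x \<partial>M01) = (\<integral>x. x * \<psi> x + ((- m) * (x * \<theta>1 x) + (- n) * (x * \<theta>2 x)) \<partial>M01)"
      by (simp add: algebra_simps)
    then have "(\<integral>x. x * ?\<eta> x \<partial>M01) = 0" using mi[OF \<psi>] mi[OF \<theta>(1)] mi[OF \<theta>(2)] \<theta> by (simp add: n_def)
    ultimately obtain \<phi> where \<phi>: "test_on c d \<phi>" "(deriv ^^ 2) \<phi> = ?\<eta>"
      using test_on_antiderivative2[OF \<eta>] cd by auto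
    have "0 = (\<integral>x. q x * ?\<eta> x \<partial>M01)" using orth[OF \<phi>(1)] \<phi>(2) by simp
    also have "\<dots> = (\<integral>x. q x * \<psi> x + ((- m) * (q x * \<theta>1 x) + (- n) * (q x * \<theta>2 x)) \<partial>M01)"
      by (simp add: algebra_simps)
    also have "\<dots> = (\<integral>x. q x * \<psi> x \<partial>M01) + ((- m) * \<alpha> + (- n) * \<beta>)"
      using mi[OF \<psi>] mi[OF \<theta>(1)] mi[OF \<theta>(2)] by (simp add: \<alpha>_def \<beta>_def)
    finally have e: "(\<integral>x. q x * \<psi> x \<partial>M01) = m * \<alpha> + n * \<beta>" by simp
    have "(\<integral>x. (q x - (\<alpha> + \<beta> * x)) * \<psi> x \<partial>M01) = (\<integral>x. q x * \<psi> x - (\<alpha> * \<psi> x + \<beta> * (x * \<psi> x)) \<partial>M01)"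
      by (simp add: algebra_simps)
    also have "\<dots> = (\<integral>x. q x * \<psi> x \<partial>M01) - (\<alpha> * m + \<beta> * n)" using mi[OF \<psi>] by (simp add: m_def n_def)
    finally show "(\<integral>x. (q x - (\<alpha> + \<beta> * x)) * \<psi> x \<partial>M01) = 0" using e by simp
  qed (use cd in auto)
  then have "AE x in M01. x \<in> {c<..<d} \<longrightarrow> q x = \<alpha> + \<beta> * x" by eventually_elim simp
  then show ?thesis by (rule that)
qed

section \<open>Primitives\<close>

text \<open>Truncating the integrand instead of the domain keeps all integrals over the single
  measure \<open>M01\<close>, as Fubini and congruence almost everywhere require.\<close>

definition prim :: "(real \<Rightarrow> real) \<Rightarrow> real \<Rightarrow> real" where
  "prim f x = (\<integral>t. (if t \<le> x then f t else 0) \<partial>M01)"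

lemma M01_If_integrable:
  fixes f :: "real \<Rightarrow> real"
  assumes f: "integrable M01 f" and P: "{t. P t} \<in> sets borel"
  shows "integrable M01 (\<lambda>t. if P t then f t else 0)"
proof (rule Bochner_Integration.integrable_bound[OF f])
  have "(\<lambda>t. f t * indicator {t. P t} t) \<in> borel_measurable M01"
    using f P by (intro borel_measurable_times[OF _ M01_borel_measurable]) auto
  also have "(\<lambda>t. f t * indicator {t. P t} t) = (\<lambda>t. if P t then f t else 0)" by (auto simp: indicator_def)
  finally show "(\<lambda>t. if P t then f t else 0) \<in> borel_measurable M01" .
qed auto

lemma prim_integrand:
  "integrable M01 f \<Longrightarrow> integrable M01 (\<lambda>t. if t \<le> x then f t else 0)" for f :: "real \<Rightarrow> real"
  using M01_If_integrable[of f "\<lambda>t. t \<le> x"] by (simp flip: atMost_def)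

lemma prim_has_integral:
  assumes f: "integrable M01 f" and x: "x \<in> {0..1}"
  shows "(f has_integral prim f x) {0..x}"
proof -
  have "((\<lambda>t. if t \<le> x then f t else 0) has_integral prim f x) {0<..<1}"
    unfolding prim_def by (rule has_integral_integral_lebesgue_on[OF prim_integrand[OF f]]) simp
  then have "((\<lambda>t. if t \<le> x then f t else 0) has_integral prim f x) {0..1}"
    using has_integral_open_interval[of "\<lambda>t. if t \<le> x then f t else 0" _ 0 1] by simp
  then have "((\<lambda>t. if t \<in> {0..x} then f t else 0) has_integral prim f x) {0..1}"
    by (rule has_integral_eq[rotated]) auto
  then show ?thesis using x by (subst (asm) has_integral_restrict) auto
qed

lemma prim_cong: "(\<And>t. t \<in> {0<..<1} \<Longrightarrow> f t = g t) \<Longrightarrow> prim f x = prim g x"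
  unfolding prim_def by (rule Bochner_Integration.integral_cong) auto

lemma prim_0 [simp]: "prim f 0 = 0"
proof -
  have "prim f 0 = (\<integral>t. 0 \<partial>M01)" unfolding prim_def by (rule Bochner_Integration.integral_cong) auto
  then show ?thesis by simp
qed

lemma prim_1: "prim f 1 = (\<integral>t. f t \<partial>M01)"
  unfolding prim_def by (rule Bochner_Integration.integral_cong) auto

lemma prim_add: "integrable M01 f \<Longrightarrow> integrable M01 g \<Longrightarrow> prim (\<lambda>t. f t + g t) x = prim f x + prim g x"
  unfolding prim_def
  by (subst Bochner_Integration.integral_add[symmetric]) (auto intro: prim_integrand intro!: Bochner_Integration.integral_cong)

lemma prim_cmult: "prim (\<lambda>t. c * f t) x = c * prim f x"
proof -
  have "prim (\<lambda>t. c * f t) x = (\<integral>t. c * (if t \<le> x then f t else 0) \<partial>M01)"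
    unfolding prim_def by (rule Bochner_Integration.integral_cong) auto
  then show ?thesis by (simp add: prim_def)
qed

lemma prim_continuous:
  assumes f: "integrable M01 f" shows "continuous_on {0..1} (prim f)"
proof -
  have eq: "integral {0..x} f = prim f x" if "x \<in> {0..1}" for x
    using prim_has_integral[OF f that] by (rule integral_unique)
  have "f integrable_on {0..1}" using prim_has_integral[OF f, of 1] by auto
  then have "continuous_on {0..1} (\<lambda>x. integral {0..x} f)" by (rule indefinite_integral_continuous_1)
  then show ?thesis by (rule continuous_on_eq) (use eq in auto)
qed

lemma prim_integrable: "integrable M01 f \<Longrightarrow> integrable M01 (prim f)"
  by (rule M01_continuous_integrable[OF prim_continuous])

lemma prim_DERIV:
  assumes f: "continuous_on {0..1} f" and x: "x \<in> {0..1}"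
  shows "(prim f has_real_derivative f x) (at x within {0..1})"
proof -
  have eq: "integral {0..x} f = prim f x" if "x \<in> {0..1}" for x
    using prim_has_integral[OF M01_continuous_integrable[OF f] that] by (rule integral_unique)
  have "((\<lambda>x. integral {0..x} f) has_real_derivative f x) (at x within {0..1})"
    by (rule integral_has_real_derivative[OF f x])
  then show ?thesis
    by (rule has_field_derivative_transform_within[of _ _ _ _ 1]) (use eq x in auto)
qed

lemma prim_FTC:
  assumes D: "\<And>x. x \<in> {0..1} \<Longrightarrow> (F has_real_derivative f x) (at x within {0..1})"
    and f: "continuous_on {0..1} f" and x: "x \<in> {0..1}"
  shows "prim f x = F x - F 0"
proof -
  have "(f has_integral (F x - F 0)) {0..x}"
  proof (rule fundamental_theorem_of_calculus)
    show "(F has_vector_derivative f y) (at y within {0..x})" if "y \<in> {0..x}" for y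
      using D[of y] that x has_field_derivative_subset[of F "f y" y "{0..1}" "{0..x}"]
      by (auto simp: has_real_derivative_iff_has_vector_derivative)
  qed (use x in auto)
  with prim_has_integral[OF M01_continuous_integrable[OF f] x] show ?thesis by (rule has_integral_unique)
qed

lemma prim_const: "x \<in> {0..1} \<Longrightarrow> prim (\<lambda>t. c) x = c * x"
  using prim_FTC[of "\<lambda>x. c * x" "\<lambda>t. c" x] by (auto intro!: derivative_eq_intros)

text \<open>Up to the null set of the single point \<open>t\<close>, the conditions
  \<open>t \<le> x\<close> and \<open>x \<le> t\<close> are complementary. This evaluates the second
  inner integral in \<open>prim_by_parts\<close>.\<close>

lemma prim_strict:
  assumes g: "integrable M01 g"
  shows "(\<integral>x. (if t \<le> x then g x else 0) \<partial>M01) = (\<integral>x. g x \<partial>M01) - prim g t"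
proof -
  have "AE x in lebesgue. x \<noteq> t" by (rule AE_completion[OF AE_lborel_singleton])
  then have ne: "AE x in M01. x \<noteq> t" by (subst AE_restrict_space_iff) auto
  have "(\<integral>x. (if t \<le> x then g x else 0) \<partial>M01) = (\<integral>x. g x - (if x \<le> t then g x else 0) \<partial>M01)"
  proof (rule integral_cong_AE)
    show "AE x in M01. (if t \<le> x then g x else 0) = g x - (if x \<le> t then g x else 0)"
      using ne by eventually_elim auto
    show "(\<lambda>x. if t \<le> x then g x else 0) \<in> borel_measurable M01"
      using M01_If_integrable[OF g, of "\<lambda>x. t \<le> x"] by (simp flip: atLeast_def)
    show "(\<lambda>x. g x - (if x \<le> t then g x else 0)) \<in> borel_measurable M01"
      using prim_integrand[OF g, of t] g by auto
  qed
  also have "\<dots> = (\<integral>x. g x \<partial>M01) - prim g t"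
    unfolding prim_def by (rule Bochner_Integration.integral_diff[OF g prim_integrand[OF g]])
  finally show ?thesis .
qed

lemma M01_bounded_mult:
  assumes f: "integrable M01 f" and g: "continuous_on {0..1} g"
  shows "integrable M01 (\<lambda>x. f x * (g x :: real))"
proof -
  obtain C where C: "\<forall>x\<in>{0..1}. \<bar>g x\<bar> \<le> C"
    using compact_imp_bounded[OF compact_continuous_image[OF g compact_Icc]] by (auto simp: bounded_iff)
  show ?thesis
  proof (rule Bochner_Integration.integrable_bound)
    show "integrable M01 (\<lambda>x. C * f x)" using f by simp
    show "(\<lambda>x. f x * g x) \<in> borel_measurable M01" using f M01_continuous_integrable[OF g] by auto
    have "0 \<le> C" using C by force
    have "\<bar>f x\<bar> * \<bar>g x\<bar> \<le> \<bar>f x\<bar> * C" if "x \<in> {0<..<1}" for x using C that by (intro mult_left_mono) auto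
    then show "AE x in M01. norm (f x * g x) \<le> norm (C * f x)"
      using \<open>0 \<le> C\<close> by (intro AE_I2) (simp add: abs_mult mult.commute)
  qed
qed

lemma prim_by_parts:
  assumes f: "integrable M01 f" and g: "integrable M01 g"
  shows "(\<integral>x. prim f x * g x \<partial>M01) + (\<integral>x. f x * prim g x \<partial>M01) = (\<integral>x. f x \<partial>M01) * (\<integral>x. g x \<partial>M01)"
proof -
  have fg: "integrable M01 (\<lambda>x. f x * prim g x)" by (rule M01_bounded_mult[OF f prim_continuous[OF g]])
  interpret fm: finite_measure M01 by (rule finite_M01)
  interpret pair_sigma_finite M01 M01 by standard
  have idm: "(\<lambda>x::real. x) \<in> M01 \<rightarrow>\<^sub>M borel" by (rule M01_borel_measurable) simp
  have [measurable]: "f \<in> borel_measurable M01" "g \<in> borel_measurable M01" using f g by auto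
  have m1: "(\<lambda>p. f (fst p)) \<in> borel_measurable (M01 \<Otimes>\<^sub>M M01)"
    by (rule measurable_compose[OF measurable_fst]) simp
  have m2: "(\<lambda>p. g (snd p)) \<in> borel_measurable (M01 \<Otimes>\<^sub>M M01)"
    by (rule measurable_compose[OF measurable_snd]) simp
  have m3: "fst \<in> borel_measurable (M01 \<Otimes>\<^sub>M M01)" "snd \<in> borel_measurable (M01 \<Otimes>\<^sub>M M01)"
    using measurable_compose[OF measurable_fst idm] measurable_compose[OF measurable_snd idm] by (auto simp: comp_def)
  let ?h = "\<lambda>t x. if t \<le> x then f t * g x else 0"
  have hm: "(\<lambda>p. ?h (fst p) (snd p)) \<in> borel_measurable (M01 \<Otimes>\<^sub>M M01)"
    using m1 m2 m3 by measurable
  have int: "integrable (M01 \<Otimes>\<^sub>M M01) (\<lambda>p. f (fst p) * g (snd p))"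
  proof (rule Fubini_integrable)
    show "(\<lambda>p. f (fst p) * g (snd p)) \<in> borel_measurable (M01 \<Otimes>\<^sub>M M01)" using m1 m2 by measurable
    show "integrable M01 (\<lambda>x. \<integral>y. norm (f (fst (x, y)) * g (snd (x, y))) \<partial>M01)"
      using f by (simp add: abs_mult)
    show "AE x in M01. integrable M01 (\<lambda>y. f (fst (x, y)) * g (snd (x, y)))" using g by simp
  qed
  have "integrable (M01 \<Otimes>\<^sub>M M01) (\<lambda>p. ?h (fst p) (snd p))"
    by (rule Bochner_Integration.integrable_bound[OF int hm]) auto
  then have "integrable (M01 \<Otimes>\<^sub>M M01) (case_prod ?h)" by (simp add: case_prod_beta')
  then have F: "(\<integral>x. (\<integral>t. ?h t x \<partial>M01) \<partial>M01) = (\<integral>t. (\<integral>x. ?h t x \<partial>M01) \<partial>M01)" by (rule Fubini_integral)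
  have 1: "(\<integral>t. ?h t x \<partial>M01) = prim f x * g x" for x
  proof -
    have "(\<integral>t. ?h t x \<partial>M01) = (\<integral>t. (if t \<le> x then f t else 0) * g x \<partial>M01)"
      by (rule Bochner_Integration.integral_cong) auto
    then show ?thesis by (simp add: prim_def)
  qed
  have 2: "(\<integral>x. ?h t x \<partial>M01) = f t * ((\<integral>x. g x \<partial>M01) - prim g t)" for t
  proof -
    have "(\<integral>x. ?h t x \<partial>M01) = (\<integral>x. f t * (if t \<le> x then g x else 0) \<partial>M01)"
      by (rule Bochner_Integration.integral_cong) auto
    then show ?thesis by (simp add: prim_strict[OF g])
  qed
  have "(\<integral>x. prim f x * g x \<partial>M01) = (\<integral>t. f t * ((\<integral>x. g x \<partial>M01) - prim g t) \<partial>M01)"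
    using F unfolding 1 2 .
  also have "\<dots> = (\<integral>t. f t * (\<integral>x. g x \<partial>M01) - f t * prim g t \<partial>M01)" by (simp add: right_diff_distrib)
  also have "\<dots> = (\<integral>t. f t \<partial>M01) * (\<integral>x. g x \<partial>M01) - (\<integral>t. f t * prim g t \<partial>M01)"
    using f fg by simp
  finally show ?thesis by simp
qed

lemma prim_test:
  assumes \<phi>: "test_on 0 1 \<phi>" and x: "x \<in> {0..1}" shows "prim (deriv \<phi>) x = \<phi> x"
proof -
  have "prim (deriv \<phi>) x = \<phi> x - \<phi> 0"
    by (rule prim_FTC) (use x in \<open>auto intro: has_field_derivative_at_within smooth_DERIV smooth_continuous
        smooth_deriv test_on_smooth[OF \<phi>]\<close>)
  then show ?thesis using test_on_zero[OF \<phi>, of 0] by simp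
qed

lemma prim_test_by_parts:
  assumes f: "integrable M01 f" and \<phi>: "test_on 0 1 \<phi>"
  shows "(\<integral>x. prim f x * deriv \<phi> x \<partial>M01) = - (\<integral>x. f x * \<phi> x \<partial>M01)"
proof -
  have d: "integrable M01 (deriv \<phi>)" by (rule test_on_integrable[OF test_on_deriv[OF \<phi>]])
  have "(\<integral>x. deriv \<phi> x \<partial>M01) = 0"
    using prim_test[OF \<phi>, of 1] test_on_zero[OF \<phi>, of 1] by (simp add: prim_1)
  moreover have "(\<integral>x. f x * prim (deriv \<phi>) x \<partial>M01) = (\<integral>x. f x * \<phi> x \<partial>M01)"
    by (rule Bochner_Integration.integral_cong) (auto simp: prim_test[OF \<phi>])
  ultimately show ?thesis using prim_by_parts[OF f d] by simp
qed

lemma prim2_test_by_parts: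
  assumes f: "integrable M01 f" and \<phi>: "test_on 0 1 \<phi>"
  shows "(\<integral>x. prim (prim f) x * (deriv ^^ 2) \<phi> x \<partial>M01) = (\<integral>x. f x * \<phi> x \<partial>M01)"
  using prim_test_by_parts[OF prim_integrable[OF f] test_on_deriv[OF \<phi>]] prim_test_by_parts[OF f \<phi>]
  by (simp add: numeral_2_eq_2)

lemma AE_zero_continuous:
  fixes f :: "real \<Rightarrow> real"
  assumes f: "continuous_on {0..1} f" and ae: "AE x in M01. f x = 0" and x: "x \<in> {0..1}"
  shows "f x = 0"
proof -
  have c: "continuous_on {0..1} (\<lambda>x. \<bar>f x\<bar>)" by (intro continuous_intros f)
  have "(\<integral>x. \<bar>f x\<bar> \<partial>M01) = 0" using ae by (intro integral_eq_zero_AE) auto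
  then have "prim (\<lambda>x. \<bar>f x\<bar>) 1 = 0" by (simp add: prim_1)
  then have "((\<lambda>x. \<bar>f x\<bar>) has_integral 0) {0..1}"
    using prim_has_integral[OF M01_continuous_integrable[OF c], of 1] by simp
  then have "\<bar>f x\<bar> = 0"
    using has_integral_0_cbox_imp_0[of 0 1 "\<lambda>x. \<bar>f x\<bar>" x] c x by simp
  then show ?thesis by simp
qed

text \<open>Truncating both densities at \<open>x\<close> reduces this to
  \<open>prim_by_parts\<close> on the whole interval. There \<open>e - e 0\<close> appears in place
  of \<open>e\<close>, and the terms with \<open>e 0\<close> cancel.\<close>

lemma prim_product_rule:
  assumes D: "\<And>x. x \<in> {0..1} \<Longrightarrow> (e has_real_derivative e' x) (at x within {0..1})"
    and e': "continuous_on {0..1} e'" and f: "integrable M01 f" and x: "x \<in> {0..1}"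
  shows "prim (\<lambda>t. e' t * prim f t + e t * f t) x = e x * prim f x"
proof -
  have e: "continuous_on {0..1} e" using D by (meson DERIV_continuous_on)
  let ?f = "\<lambda>t. if t \<le> x then f t else 0" and ?g = "\<lambda>t. if t \<le> x then e' t else 0"
  have fi: "integrable M01 ?f" by (rule prim_integrand[OF f])
  have ei: "integrable M01 e'" by (rule M01_continuous_integrable[OF e'])
  have gi: "integrable M01 ?g" by (rule prim_integrand[OF ei])
  have pf: "prim ?f y = prim f y" "prim ?g y = prim e' y" if "y \<le> x" for y
    using that by (auto simp: prim_def intro!: Bochner_Integration.integral_cong)
  have pe: "prim e' y = e y - e 0" if "y \<in> {0..1}" for y by (rule prim_FTC[OF D e' that])
  have i1: "integrable M01 (\<lambda>t. e' t * prim f t)" by (rule M01_bounded_mult[OF ei prim_continuous[OF f]])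
  have i2: "integrable M01 (\<lambda>t. e t * f t)" using M01_bounded_mult[OF f e] by (simp add: mult.commute)
  have "(\<integral>t. prim ?f t * ?g t \<partial>M01) = prim (\<lambda>t. e' t * prim f t) x"
    by (subst (2) prim_def, rule Bochner_Integration.integral_cong) (auto simp: pf mult.commute)
  moreover have "(\<integral>t. ?f t * prim ?g t \<partial>M01) = prim (\<lambda>t. e t * f t + (- e 0) * f t) x"
    by (subst (2) prim_def, rule Bochner_Integration.integral_cong) (auto simp: pf pe algebra_simps)
  moreover have "prim (\<lambda>t. e t * f t + (- e 0) * f t) x = prim (\<lambda>t. e t * f t) x + (- e 0) * prim f x"
    using prim_add[OF i2, of "\<lambda>t. (- e 0) * f t" x] f prim_cmult[of "- e 0" f x] by simp
  moreover have "(\<integral>t. ?f t \<partial>M01) = prim f x" "(\<integral>t. ?g t \<partial>M01) = e x - e 0"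
    using pe[OF x] by (auto simp: prim_def)
  ultimately have "prim (\<lambda>t. e' t * prim f t) x + (prim (\<lambda>t. e t * f t) x + (- e 0) * prim f x) = prim f x * (e x - e 0)"
    using prim_by_parts[OF fi gi] by simp
  then show ?thesis using prim_add[OF i1 i2, of x] by (simp add: algebra_simps)
qed

text \<open>An antiderivative of a normalised nonnegative test function rises from 0 to 1 across the
  unit interval; its own derivatives are test functions, hence bounded.\<close>

lemma smooth_step:
  obtains s :: "real \<Rightarrow> real" and C :: real where "smooth s"
    "\<And>y. y \<le> 0 \<Longrightarrow> s y = 0" "\<And>y. 1 \<le> y \<Longrightarrow> s y = 1" "\<And>y. \<bar>s y\<bar> \<le> 1"
    "\<And>y. y \<le> 0 \<or> 1 \<le> y \<Longrightarrow> deriv s y = 0" "\<And>y. y \<le> 0 \<or> 1 \<le> y \<Longrightarrow> deriv (deriv s) y = 0"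
    "\<And>y. \<bar>deriv s y\<bar> \<le> C" "\<And>y. \<bar>deriv (deriv s) y\<bar> \<le> C" "0 \<le> C"
proof -
  obtain \<psi>0 where \<psi>0: "test_on 0 1 \<psi>0" "\<And>x. 0 \<le> \<psi>0 x" "0 < (\<integral>x. \<psi>0 x \<partial>M01)"
    using test_on_positive_integral[of 0 1] by auto
  define \<psi> where "\<psi> = (\<lambda>x. inverse (\<integral>x. \<psi>0 x \<partial>M01) * \<psi>0 x)"
  have \<psi>: "test_on 0 1 \<psi>" unfolding \<psi>_def by (rule test_on_cmult[OF \<psi>0(1)])
  have \<psi>_pos: "0 \<le> \<psi> x" for x unfolding \<psi>_def using \<psi>0 by simp
  have \<psi>_mean: "(\<integral>x. \<psi> x \<partial>M01) = 1" unfolding \<psi>_def using \<psi>0 by simp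
  obtain s where s: "smooth s" and der: "deriv s = \<psi>" and s0: "s 0 = 0" and "s 1 = (\<integral>x. \<psi> x \<partial>M01)"
    using smooth_antiderivative[OF test_on_smooth[OF \<psi>]] by blast
  then have s1: "s 1 = 1" using \<psi>_mean by simp
  note const = smooth_constant[OF s, unfolded der]
  have D: "(s has_real_derivative \<psi> x) (at x)" for x using smooth_DERIV[OF s] der by simp
  have mono: "s x \<le> s y" if "x \<le> y" for x y
    using DERIV_nonneg_imp_nondecreasing[OF that, of s] D \<psi>_pos by blast
  have l: "s y = 0" if "y \<le> 0" for y
    using const[of y 0] test_on_zero[OF \<psi>] s0 that by (cases "y = 0") auto
  have r: "s y = 1" if "1 \<le> y" for y
    using const[of 1 y] test_on_zero[OF \<psi>] s1 that by (cases "y = 1") auto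
  have b: "\<bar>s y\<bar> \<le> 1" for y
    using mono[of 0 y] mono[of y 1] l[of y] r[of y] s0 s1 by (cases "y \<le> 0"; cases "1 \<le> y") auto
  obtain C1 where C1: "\<And>x. \<bar>\<psi> x\<bar> \<le> C1" using test_on_bounded[OF \<psi>] by blast
  obtain C2 where C2: "\<And>x. \<bar>deriv \<psi> x\<bar> \<le> C2" using test_on_bounded[OF test_on_deriv[OF \<psi>]] by blast
  have "0 \<le> max C1 C2" using C1[of 0] by (simp add: le_max_iff_disj) linarith
  then show ?thesis
    using that[of s "max C1 C2"] s l r b der test_on_zero[OF \<psi>] test_on_zero[OF test_on_deriv[OF \<psi>]] C1 C2
    by (auto simp: le_max_iff_disj)
qed


text \<open>On \<open>{c<..<d}\<close> the function \<open>\<gamma>\<close> differs from the double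
  primitive of the truncated \<open>g\<close> by an affine function. The moment conditions make
  \<open>\<mu>\<close> orthogonal to affine functions, and for the double primitive two integrations
  by parts are legitimate.\<close>

lemma Green_local:
  assumes \<gamma>: "integrable M01 \<gamma>" and cd: "0 < c" "c < d" "d < 1"
    and gt: "integrable M01 (\<lambda>t. if c \<le> t \<and> t \<le> d then g t else 0)"
    and weak: "\<And>\<phi>. test_on 0 1 \<phi> \<Longrightarrow> (\<integral>x. \<gamma> x * (deriv ^^ 2) \<phi> x \<partial>M01) = (\<integral>x. g x * \<phi> x \<partial>M01)"
    and \<mu>: "integrable M01 \<mu>" "(\<integral>x. \<mu> x \<partial>M01) = 0" "(\<integral>x. prim \<mu> x \<partial>M01) = 0"
    and off: "\<And>x. x \<in> {0<..<1} \<Longrightarrow> x \<notin> {c<..<d} \<Longrightarrow> \<mu> x = 0"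
      "\<And>x. x \<in> {0<..<1} \<Longrightarrow> x \<notin> {c<..<d} \<Longrightarrow> prim (prim \<mu>) x = 0"
  shows "(\<integral>x. \<gamma> x * \<mu> x \<partial>M01) = (\<integral>x. g x * prim (prim \<mu>) x \<partial>M01)"
proof -
  define h where "h t = (if c \<le> t \<and> t \<le> d then g t else 0)" for t
  have h: "integrable M01 h" using gt by (simp add: h_def[abs_def])
  have Kh: "continuous_on {0..1} (prim (prim h))" by (intro prim_continuous prim_integrable h)
  define q where "q x = \<gamma> x - prim (prim h) x" for x
  have q: "integrable M01 q" unfolding q_def using \<gamma> M01_continuous_integrable[OF Kh] by simp
  obtain \<alpha> \<beta> where ab: "AE x in M01. x \<in> {c<..<d} \<longrightarrow> q x = \<alpha> + \<beta> * x"
  proof (rule du_Bois_Reymond_second_order[OF q, of c d])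
    fix \<phi> assume \<phi>: "test_on c d \<phi>"
    then have \<phi>01: "test_on 0 1 \<phi>" using cd by (intro test_on_mono[OF \<phi>]) auto
    note d2 = test_on_funpow_deriv[OF \<phi>01, of 2]
    have "(\<integral>x. q x * (deriv ^^ 2) \<phi> x \<partial>M01)
      = (\<integral>x. \<gamma> x * (deriv ^^ 2) \<phi> x - prim (prim h) x * (deriv ^^ 2) \<phi> x \<partial>M01)"
      by (simp add: q_def left_diff_distrib)
    also have "\<dots> = (\<integral>x. \<gamma> x * (deriv ^^ 2) \<phi> x \<partial>M01) - (\<integral>x. prim (prim h) x * (deriv ^^ 2) \<phi> x \<partial>M01)"
      by (intro Bochner_Integration.integral_diff test_on_integrable_mult[OF d2] \<gamma> M01_continuous_integrable[OF Kh])
    also have "\<dots> = (\<integral>x. g x * \<phi> x \<partial>M01) - (\<integral>x. h x * \<phi> x \<partial>M01)"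
      by (simp only: weak[OF \<phi>01] prim2_test_by_parts[OF h \<phi>01])
    also have "(\<integral>x. h x * \<phi> x \<partial>M01) = (\<integral>x. g x * \<phi> x \<partial>M01)"
    proof (rule Bochner_Integration.integral_cong)
      show "h x * \<phi> x = g x * \<phi> x" for x
        using test_on_zero[OF \<phi>, of x] by (cases "c \<le> x \<and> x \<le> d") (auto simp: h_def)
    qed simp
    finally show "(\<integral>x. q x * (deriv ^^ 2) \<phi> x \<partial>M01) = 0" by simp
  qed (use cd in auto)
  have "AE x in M01. x \<in> {0<..<1}" by (rule AE_I2) simp
  with ab have ae: "AE x in M01. \<gamma> x * \<mu> x = prim (prim h) x * \<mu> x + (\<alpha> * \<mu> x + \<beta> * (x * \<mu> x))"
  proof eventually_elim
    case (elim x)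
    show ?case
    proof (cases "x \<in> {c<..<d}")
      case True
      then have "\<gamma> x = prim (prim h) x + (\<alpha> + \<beta> * x)" using elim(1) by (simp add: q_def)
      then show ?thesis by (simp add: algebra_simps)
    qed (use off(1) elim(2) in simp)
  qed
  have i1: "integrable M01 (\<lambda>x. prim (prim h) x * \<mu> x)"
    using M01_bounded_mult[OF \<mu>(1) Kh] by (simp add: mult.commute)
  have i2: "integrable M01 (\<lambda>x. x * \<mu> x)"
    using M01_bounded_mult[OF \<mu>(1) continuous_on_id] by (simp add: mult.commute)
  have "(\<integral>x. \<gamma> x * \<mu> x \<partial>M01) = (\<integral>x. prim (prim h) x * \<mu> x + (\<alpha> * \<mu> x + \<beta> * (x * \<mu> x)) \<partial>M01)"
  proof (rule integral_cong_AE[OF _ _ ae])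
    show "(\<lambda>x. \<gamma> x * \<mu> x) \<in> borel_measurable M01" using \<gamma> \<mu> by auto
    show "(\<lambda>x. prim (prim h) x * \<mu> x + (\<alpha> * \<mu> x + \<beta> * (x * \<mu> x))) \<in> borel_measurable M01"
      using i1 i2 \<mu> by auto
  qed
  also have "\<dots> = (\<integral>x. prim (prim h) x * \<mu> x \<partial>M01) + \<beta> * (\<integral>x. x * \<mu> x \<partial>M01)"
    using i1 i2 \<mu> by simp
  also have "(\<integral>x. x * \<mu> x \<partial>M01) = 0"
  proof -
    have 1: "integrable M01 (\<lambda>t. 1 :: real)" by (rule finite_measure.integrable_const[OF finite_M01])
    have "(\<integral>x. x * \<mu> x \<partial>M01) = (\<integral>x. prim (\<lambda>t. 1) x * \<mu> x \<partial>M01)"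
      by (rule Bochner_Integration.integral_cong) (auto simp: prim_const)
    then show ?thesis using prim_by_parts[OF 1 \<mu>(1)] \<mu> by simp
  qed
  also have "(\<integral>x. prim (prim h) x * \<mu> x \<partial>M01) = (\<integral>x. h x * prim (prim \<mu>) x \<partial>M01)"
    using prim_by_parts[OF prim_integrable[OF h] \<mu>(1)] prim_by_parts[OF h prim_integrable[OF \<mu>(1)]] \<mu> by simp
  also have "(\<integral>x. h x * prim (prim \<mu>) x \<partial>M01) = (\<integral>x. g x * prim (prim \<mu>) x \<partial>M01)"
  proof (rule Bochner_Integration.integral_cong)
    show "h x * prim (prim \<mu>) x = g x * prim (prim \<mu>) x" if "x \<in> space M01" for x
      using off(2)[of x] that by (cases "c \<le> x \<and> x \<le> d") (auto simp: h_def)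
  qed simp
  finally show ?thesis by simp
qed

section \<open>Hardy-type bounds for primitives\<close>

lemma continuous_square_integrable:
  assumes "continuous_on {0..1} f" shows "square_integrable M01 f"
  unfolding square_integrable_def
  using M01_continuous_integrable[OF assms] M01_continuous_integrable[of "\<lambda>x. (f x)\<^sup>2"] assms
  by (auto intro: continuous_intros)

lemma M01_If_Cauchy_Schwarz:
  assumes f: "square_integrable M01 f" and P: "{t. P t} \<in> sets borel"
  shows "(\<integral>t. (if P t then f t else 0) \<partial>M01)\<^sup>2
    \<le> (\<integral>t. (if P t then 1 else 0) \<partial>M01) * (\<integral>t. (if P t then (f t)\<^sup>2 else 0) \<partial>M01)"
proof -
  have sq: "square_integrable M01 (\<lambda>t. if P t then f t else 0)" if f: "square_integrable M01 f" for f
  proof -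
    have "integrable M01 f" by (rule square_integrable_integrable[OF finite_M01 f])
    then have "(\<lambda>t. if P t then f t else 0) \<in> borel_measurable M01" using M01_If_integrable[OF _ P] by auto
    moreover have "(\<lambda>t. (if P t then f t else 0)\<^sup>2) = (\<lambda>t. if P t then (f t)\<^sup>2 else 0)" by auto
    ultimately show ?thesis
      using M01_If_integrable[OF _ P, of "\<lambda>t. (f t)\<^sup>2"] f by (auto simp: square_integrable_def)
  qed
  have "(\<integral>t. (if P t then 1 else 0) * (if P t then f t else 0) \<partial>M01)\<^sup>2
    \<le> (\<integral>t. (if P t then 1 else 0)\<^sup>2 \<partial>M01) * (\<integral>t. (if P t then f t else 0)\<^sup>2 \<partial>M01)"
    by (rule square_integrable_Cauchy_Schwarz[OF sq[OF square_integrable_const[OF finite_M01]] sq[OF f]])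
  moreover have "(\<integral>t. (if P t then 1 else 0) * (if P t then f t else 0) \<partial>M01) = (\<integral>t. (if P t then f t else 0) \<partial>M01)"
    "(\<integral>t. (if P t then 1 else 0)\<^sup>2 \<partial>M01) = (\<integral>t. (if P t then 1 else (0::real)) \<partial>M01)"
    "(\<integral>t. (if P t then f t else 0)\<^sup>2 \<partial>M01) = (\<integral>t. (if P t then (f t)\<^sup>2 else 0) \<partial>M01)"
    by (auto intro!: Bochner_Integration.integral_cong)
  ultimately show ?thesis by simp
qed

lemma borel_half_lines: "{t::real. t \<le> x} \<in> sets borel" "{t::real. x < t} \<in> sets borel"
  by (simp_all flip: atMost_def greaterThan_def)

lemma integral_half_lines:
  assumes "x \<in> {0..1}"
  shows "(\<integral>t. (if t \<le> x then 1 else 0) \<partial>M01) = x" "(\<integral>t. (if x < t then 1 else 0) \<partial>M01) = 1 - x"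
proof -
  have i: "integrable M01 (\<lambda>t. 1 :: real)" by (rule finite_measure.integrable_const[OF finite_M01])
  show 1: "(\<integral>t. (if t \<le> x then 1 else 0) \<partial>M01) = x"
    using prim_const[OF assms, of 1] by (simp add: prim_def)
  have "(\<integral>t. (if x < t then 1 else 0) \<partial>M01) = (\<integral>t. 1 - (if t \<le> x then 1 else 0) \<partial>M01)"
    by (rule Bochner_Integration.integral_cong) auto
  also have "\<dots> = (\<integral>t. 1 \<partial>M01) - x"
    using 1 by (subst Bochner_Integration.integral_diff[OF i prim_integrand[OF i]]) simp
  also have "(\<integral>t. 1 \<partial>M01) = (1 :: real)" using prim_const[of 1 1] by (simp add: prim_1)
  finally show "(\<integral>t. (if x < t then 1 else 0) \<partial>M01) = 1 - x" .
qed

lemma prim_upper: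
  assumes f: "integrable M01 f" and "(\<integral>x. f x \<partial>M01) = 0"
  shows "prim f x = - (\<integral>t. (if x < t then f t else 0) \<partial>M01)"
proof -
  have "(\<integral>t. (if x < t then f t else 0) \<partial>M01) = (\<integral>t. f t - (if t \<le> x then f t else 0) \<partial>M01)"
    by (rule Bochner_Integration.integral_cong) auto
  also have "\<dots> = (\<integral>t. f t \<partial>M01) - prim f x"
    unfolding prim_def by (rule Bochner_Integration.integral_diff[OF f prim_integrand[OF f]])
  finally show ?thesis using assms by simp
qed

text \<open>Cauchy-Schwarz on the part left of \<open>x\<close>, or on the part right of it: since
  the mean is zero, the primitive vanishes at both end points.\<close>

lemma prim_square_bounds:
  assumes f: "square_integrable M01 f" and mean: "(\<integral>x. f x \<partial>M01) = 0" and x: "x \<in> {0..1}"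
  shows "(prim f x)\<^sup>2 \<le> x * (\<integral>t. (if t \<le> x then (f t)\<^sup>2 else 0) \<partial>M01)"
    and "(prim f x)\<^sup>2 \<le> (1 - x) * (\<integral>t. (if x < t then (f t)\<^sup>2 else 0) \<partial>M01)"
proof -
  show "(prim f x)\<^sup>2 \<le> x * (\<integral>t. (if t \<le> x then (f t)\<^sup>2 else 0) \<partial>M01)"
    using M01_If_Cauchy_Schwarz[OF f, of "\<lambda>t. t \<le> x"] borel_half_lines integral_half_lines(1)[OF x]
    by (simp add: prim_def)
  show "(prim f x)\<^sup>2 \<le> (1 - x) * (\<integral>t. (if x < t then (f t)\<^sup>2 else 0) \<partial>M01)"
    using M01_If_Cauchy_Schwarz[OF f, of "\<lambda>t. x < t"] borel_half_lines integral_half_lines(2)[OF x]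
      prim_upper[OF square_integrable_integrable[OF finite_M01 f] mean, of x]
    by simp
qed

text \<open>Two uses of \<open>prim_square_bounds\<close> from the nearer end point give the
  distance \<open>r\<close> to it in the first bound and \<open>r ^ 3\<close> in the second. Since
  \<open>r \<le> 2 * (x * (1 - x))\<close>, the constants are 2 and 8, and the weight
  \<open>x * (1 - x)\<close> treats both ends alike.\<close>

lemma prim_Hardy_bounds:
  assumes \<nu>: "square_integrable M01 \<nu>" and m: "(\<integral>x. \<nu> x \<partial>M01) = 0" "(\<integral>x. prim \<nu> x \<partial>M01) = 0"
    and x: "x \<in> {0..1}"
  defines "S \<equiv> \<integral>t. (\<nu> t)\<^sup>2 \<partial>M01"
  shows "(prim \<nu> x)\<^sup>2 \<le> 2 * (x * (1 - x)) * S" "(prim (prim \<nu>) x)\<^sup>2 \<le> 8 * (x * (1 - x)) ^ 3 * S"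
proof -
  have i: "integrable M01 \<nu>" by (rule square_integrable_integrable[OF finite_M01 \<nu>])
  have i2: "integrable M01 (\<lambda>t. (\<nu> t)\<^sup>2)" using \<nu> by (simp add: square_integrable_def)
  have S0: "0 \<le> S" unfolding S_def by simp
  have V: "square_integrable M01 (prim \<nu>)" by (rule continuous_square_integrable[OF prim_continuous[OF i]])
  have V2: "integrable M01 (\<lambda>t. (prim \<nu> t)\<^sup>2)" using V by (simp add: square_integrable_def)
  have part: "(\<integral>t. (if P t then (\<nu> t)\<^sup>2 else 0) \<partial>M01) \<le> S" if "{t. P t} \<in> sets borel" for P
    unfolding S_def by (rule integral_mono[OF M01_If_integrable[OF i2 that] i2]) auto
  have V1: "(prim \<nu> y)\<^sup>2 \<le> y * S" "(prim \<nu> y)\<^sup>2 \<le> (1 - y) * S" if y: "y \<in> {0..1}" for y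
  proof -
    show "(prim \<nu> y)\<^sup>2 \<le> y * S"
      using prim_square_bounds(1)[OF \<nu> m(1) y] mult_left_mono[OF part[OF borel_half_lines(1)[of y]], of y] y by simp
    show "(prim \<nu> y)\<^sup>2 \<le> (1 - y) * S"
      using prim_square_bounds(2)[OF \<nu> m(1) y] mult_left_mono[OF part[OF borel_half_lines(2)[of y]], of "1 - y"] y by simp
  qed
  have one: "integrable M01 (\<lambda>t. if t \<le> x then 1 else (0::real))" "integrable M01 (\<lambda>t. if x < t then 1 else (0::real))"
    using M01_If_integrable[OF finite_measure.integrable_const[OF finite_M01] borel_half_lines(1)]
      M01_If_integrable[OF finite_measure.integrable_const[OF finite_M01] borel_half_lines(2)] by auto
  have v1: "(prim (prim \<nu>) x)\<^sup>2 \<le> x ^ 3 * S"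
  proof -
    have "(\<integral>t. (if t \<le> x then (prim \<nu> t)\<^sup>2 else 0) \<partial>M01) \<le> (\<integral>t. (x * S) * (if t \<le> x then 1 else 0) \<partial>M01)"
    proof (rule integral_mono[OF M01_If_integrable[OF V2 borel_half_lines(1)] integrable_mult_right[OF one(1)]])
      show "(if t \<le> x then (prim \<nu> t)\<^sup>2 else 0) \<le> x * S * (if t \<le> x then 1 else 0)" if "t \<in> space M01" for t
        using V1(1)[of t] mult_right_mono[OF _ S0, of t x] that by auto
    qed
    also have "\<dots> = x * S * x" using integral_half_lines(1)[OF x] by simp
    finally have "x * (\<integral>t. (if t \<le> x then (prim \<nu> t)\<^sup>2 else 0) \<partial>M01) \<le> x * (x * S * x)"
      using x by (intro mult_left_mono) auto
    then show ?thesis using prim_square_bounds(1)[OF V m(2) x] by (simp add: power3_eq_cube mult_ac)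
  qed
  have v2: "(prim (prim \<nu>) x)\<^sup>2 \<le> (1 - x) ^ 3 * S"
  proof -
    have "(\<integral>t. (if x < t then (prim \<nu> t)\<^sup>2 else 0) \<partial>M01) \<le> (\<integral>t. ((1 - x) * S) * (if x < t then 1 else 0) \<partial>M01)"
    proof (rule integral_mono[OF M01_If_integrable[OF V2 borel_half_lines(2)] integrable_mult_right[OF one(2)]])
      show "(if x < t then (prim \<nu> t)\<^sup>2 else 0) \<le> (1 - x) * S * (if x < t then 1 else 0)" if "t \<in> space M01" for t
        using V1(2)[of t] mult_right_mono[OF _ S0, of "1 - t" "1 - x"] that by auto
    qed
    also have "\<dots> = (1 - x) * S * (1 - x)" using integral_half_lines(2)[OF x] by simp
    finally have "(1 - x) * (\<integral>t. (if x < t then (prim \<nu> t)\<^sup>2 else 0) \<partial>M01) \<le> (1 - x) * ((1 - x) * S * (1 - x))"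
      using x by (intro mult_left_mono) auto
    then show ?thesis using prim_square_bounds(2)[OF V m(2) x] by (simp add: power3_eq_cube mult_ac)
  qed
  show "(prim \<nu> x)\<^sup>2 \<le> 2 * (x * (1 - x)) * S" "(prim (prim \<nu>) x)\<^sup>2 \<le> 8 * (x * (1 - x)) ^ 3 * S"
  proof -
    \<comment> \<open>\<open>r\<close> is the distance of \<open>x\<close> to the nearer end
      point.\<close>
    obtain r where r: "0 \<le> r" "r \<le> 2 * (x * (1 - x))" "(prim \<nu> x)\<^sup>2 \<le> r * S" "(prim (prim \<nu>) x)\<^sup>2 \<le> r ^ 3 * S"
    proof (cases "x \<le> 1 / 2")
      case True
      then have "x * (1/2) \<le> x * (1 - x)" using x by (intro mult_left_mono) auto
      then show ?thesis using that[of x] V1(1)[OF x] v1 x by simp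
    next
      case False
      then have "(1/2) * (1 - x) \<le> x * (1 - x)" using x by (intro mult_right_mono) auto
      then show ?thesis using that[of "1 - x"] V1(2)[OF x] v2 x by simp
    qed
    show "(prim \<nu> x)\<^sup>2 \<le> 2 * (x * (1 - x)) * S"
      using r(3) mult_right_mono[OF r(2) S0] by simp
    have "r ^ 3 \<le> (2 * (x * (1 - x))) ^ 3" using r by (intro power_mono)
    then have "r ^ 3 * S \<le> (2 * (x * (1 - x))) ^ 3 * S" using S0 by (rule mult_right_mono)
    then show "(prim (prim \<nu>) x)\<^sup>2 \<le> 8 * (x * (1 - x)) ^ 3 * S" using r(4) by (simp add: power_mult_distrib)
  qed
qed

section \<open>Green formula\<close>

text \<open>For a smooth step \<open>s\<close>, the function \<open>s (x (1 - x) / \<delta> - 1)\<close> cuts off both end points at once.\<close>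

locale cutoff =
  fixes s :: "real \<Rightarrow> real" and C :: real and \<delta> :: real
  assumes s_smooth: "smooth s"
    and s_le_0: "\<And>y. y \<le> 0 \<Longrightarrow> s y = 0" and s_ge_1: "\<And>y. 1 \<le> y \<Longrightarrow> s y = 1" and s_bound: "\<And>y. \<bar>s y\<bar> \<le> 1"
    and s'_off: "\<And>y. y \<le> 0 \<or> 1 \<le> y \<Longrightarrow> deriv s y = 0"
    and s''_off: "\<And>y. y \<le> 0 \<or> 1 \<le> y \<Longrightarrow> deriv (deriv s) y = 0"
    and s'_bound: "\<And>y. \<bar>deriv s y\<bar> \<le> C" and s''_bound: "\<And>y. \<bar>deriv (deriv s) y\<bar> \<le> C" and C: "0 \<le> C"
    and \<delta>: "0 < \<delta>" "\<delta> \<le> 1/4"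
begin

definition arg :: "real \<Rightarrow> real" where "arg x = x * (1 - x) / \<delta> - 1"
definition e where "e x = s (arg x)"
definition e1 where "e1 x = deriv s (arg x) * ((1 - 2 * x) / \<delta>)"
definition e2 where "e2 x = deriv (deriv s) (arg x) * ((1 - 2 * x) / \<delta>)\<^sup>2 - deriv s (arg x) * (2 / \<delta>)"

lemma arg_DERIV: "(arg has_real_derivative (1 - 2 * x) / \<delta>) (at x within X)"
  unfolding arg_def[abs_def] using \<delta> by (auto intro!: derivative_eq_intros simp: field_simps)

lemma e_DERIV: "(e has_real_derivative e1 x) (at x within X)"
  unfolding e_def[abs_def] e1_def
  by (rule DERIV_chain2[OF smooth_DERIV[OF s_smooth] arg_DERIV])

lemma e1_DERIV: "(e1 has_real_derivative e2 x) (at x within X)"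
proof -
  have 1: "((\<lambda>x. deriv s (arg x)) has_real_derivative deriv (deriv s) (arg x) * ((1 - 2 * x) / \<delta>)) (at x within X)"
    by (rule DERIV_chain2[OF smooth_DERIV[OF smooth_deriv[OF s_smooth]] arg_DERIV])
  have 2: "((\<lambda>x. (1 - 2 * x) / \<delta>) has_real_derivative - (2 / \<delta>)) (at x within X)"
    using \<delta> by (auto intro!: derivative_eq_intros)
  have "p * k * k + - m * r = p * k\<^sup>2 - r * m" for p k m r :: real
    by (simp add: power2_eq_square)
  then show ?thesis
    unfolding e1_def[abs_def] e2_def by (rule DERIV_cong[OF DERIV_mult[OF 1 2]])
qed

lemma arg_continuous: "continuous_on X arg"
  by (rule DERIV_continuous_on[OF arg_DERIV])

lemma e1_continuous: "continuous_on X e1"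
  by (rule DERIV_continuous_on[OF e1_DERIV])

lemma e_continuous: "continuous_on X e"
  by (rule DERIV_continuous_on[OF e_DERIV])

lemma e2_continuous: "continuous_on X e2"
proof -
  have "continuous_on X (\<lambda>x. deriv s (arg x))" "continuous_on X (\<lambda>x. deriv (deriv s) (arg x))"
    by (auto intro!: continuous_on_compose2[OF smooth_continuous[of _ UNIV] arg_continuous] smooth_deriv s_smooth)
  then show ?thesis unfolding e2_def[abs_def] using \<delta> by (intro continuous_intros) auto
qed

text \<open>The set where \<open>0 < arg x < 1\<close>; outside it \<open>e1\<close> and
  \<open>e2\<close> vanish.\<close>

definition layer :: "real set" where "layer = {x. \<delta> < x * (1 - x) \<and> x * (1 - x) < 2 * \<delta>}"

lemma off_layer: assumes "x \<notin> layer" shows "e1 x = 0" "e2 x = 0"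
proof -
  have "arg x \<le> 0 \<or> 1 \<le> arg x" using assms \<delta> by (auto simp: layer_def arg_def field_simps)
  then show "e1 x = 0" "e2 x = 0" using s'_off s''_off by (auto simp: e1_def e2_def)
qed

lemma e_off: assumes "x \<in> {0<..<1}" "x \<notin> {\<delta><..<1 - \<delta>}" shows "e x = 0"
proof -
  have "x * (1 - x) \<le> \<delta>"
  proof (cases "x \<le> \<delta>")
    case True
    have "x * (1 - x) \<le> x * 1" using assms by (intro mult_left_mono) auto
    then show ?thesis using True by simp
  next
    case False
    then have "1 - x \<le> \<delta>" using assms by auto
    moreover have "x * (1 - x) \<le> 1 * (1 - x)" using assms by (intro mult_right_mono) auto
    ultimately show ?thesis by simp
  qed
  then show ?thesis using s_le_0 \<delta> by (simp add: e_def arg_def field_simps)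
qed

text \<open>On the left half of the interval \<open>x / 2 \<le> x * (1 - x) < 2 * \<delta>\<close>,
  and symmetrically on the right. So the layer lies in two strips of width
  \<open>4 * \<delta>\<close>, but outside those of width \<open>\<delta>\<close>.\<close>

lemma layer_sub: assumes "x \<in> {0<..<1}" "x \<in> layer" shows "x \<le> 4 * \<delta> \<or> 1 - 4 * \<delta> < x" "x \<in> {\<delta><..<1 - \<delta>}"
proof -
  have w: "\<delta> < x * (1 - x)" "x * (1 - x) < 2 * \<delta>" using assms by (auto simp: layer_def)
  show "x \<le> 4 * \<delta> \<or> 1 - 4 * \<delta> < x"
  proof (cases "x \<le> 1/2")
    case True
    have "x * (1/2) \<le> x * (1 - x)" using assms True by (intro mult_left_mono) auto
    then show ?thesis using w by simp
  next
    case False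
    have "(1/2) * (1 - x) \<le> x * (1 - x)" using assms False by (intro mult_right_mono) auto
    then show ?thesis using w by simp
  qed
  have "x * (1 - x) \<le> x * 1" "x * (1 - x) \<le> 1 * (1 - x)"
    using mult_nonneg_nonneg[of x x] mult_nonneg_nonneg[of "1 - x" "1 - x"] assms
    by (simp_all add: algebra_simps)
  then show "x \<in> {\<delta><..<1 - \<delta>}" using w by auto
qed

lemma e1_bound: assumes "x \<in> {0<..<1}" shows "\<bar>e1 x\<bar> \<le> C / \<delta>"
proof -
  have "\<bar>e1 x\<bar> = \<bar>deriv s (arg x)\<bar> * (\<bar>1 - 2 * x\<bar> / \<delta>)" using \<delta> by (simp add: e1_def abs_mult)
  also have "\<dots> \<le> C * (1 / \<delta>)" using \<delta> assms C by (intro mult_mono s'_bound divide_right_mono) auto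
  finally show ?thesis by simp
qed

lemma e2_bound: assumes "x \<in> {0<..<1}" shows "\<bar>e2 x\<bar> \<le> 3 * C / \<delta>\<^sup>2"
proof -
  have "\<bar>e2 x\<bar> \<le> \<bar>deriv (deriv s) (arg x)\<bar> * ((1 - 2 * x) / \<delta>)\<^sup>2 + \<bar>deriv s (arg x)\<bar> * (2 / \<delta>)"
    unfolding e2_def using \<delta> by (intro order_trans[OF abs_triangle_ineq4]) (simp add: abs_mult)
  also have "\<dots> \<le> C * (1 / \<delta>\<^sup>2) + C * (2 / \<delta>\<^sup>2)"
  proof (intro add_mono mult_mono s'_bound s''_bound C)
    have "\<bar>1 - 2 * x\<bar>\<^sup>2 \<le> 1" using assms by (intro power_le_one) auto
    then show "((1 - 2 * x) / \<delta>)\<^sup>2 \<le> 1 / \<delta>\<^sup>2" using \<delta> by (simp add: power_divide divide_right_mono)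
    \<comment> \<open>The term of lower order is absorbed, which explains 3 = 1 + 2.\<close>
    have "\<delta>\<^sup>2 \<le> \<delta>" using \<delta> by (simp add: power2_eq_square mult_left_le)
    then show "2 / \<delta> \<le> 2 / \<delta>\<^sup>2" using \<delta> by (intro divide_left_mono) auto
  qed (use \<delta> in auto)
  also have "\<dots> = 3 * C / \<delta>\<^sup>2" by (simp add: field_simps)
  finally show ?thesis .
qed

lemma layer_borel: "layer \<in> sets borel"
  unfolding layer_def by measurable

lemma layer_measure: "(\<integral>x. (if x \<in> layer then 1 else 0) \<partial>M01) \<le> 8 * \<delta>"
proof -
  have i: "integrable M01 (\<lambda>t. 1 :: real)" by (rule finite_measure.integrable_const[OF finite_M01])
  have i1: "integrable M01 (\<lambda>x. if x \<le> 4 * \<delta> then 1 else (0::real))" "integrable M01 (\<lambda>x. if 1 - 4 * \<delta> < x then 1 else (0::real))"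
    using M01_If_integrable[OF i borel_half_lines(1)] M01_If_integrable[OF i borel_half_lines(2)] by auto
  have "(\<integral>x. (if x \<in> layer then 1 else (0::real)) \<partial>M01) \<le> (\<integral>x. (if x \<le> 4 * \<delta> then 1 else 0) + (if 1 - 4 * \<delta> < x then 1 else 0) \<partial>M01)"
  proof (rule integral_mono)
    show "integrable M01 (\<lambda>x. if x \<in> layer then 1 else (0::real))"
      using M01_If_integrable[OF i, of "\<lambda>x. x \<in> layer"] layer_borel by simp
    show "integrable M01 (\<lambda>x. (if x \<le> 4 * \<delta> then 1 else 0) + (if 1 - 4 * \<delta> < x then 1 else (0::real)))"
      by (intro Bochner_Integration.integrable_add i1)
    show "(if x \<in> layer then 1 else 0) \<le> (if x \<le> 4 * \<delta> then 1 else 0) + (if 1 - 4 * \<delta> < x then 1 else (0::real))"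
      if "x \<in> space M01" for x using layer_sub(1)[of x] that by auto
  qed
  \<comment> \<open>By \<open>\<delta> \<le> 1/4\<close> the cut points \<open>4 * \<delta>\<close>
    and \<open>1 - 4 * \<delta>\<close> lie in the unit interval.\<close>
  also have "\<dots> = 4 * \<delta> + 4 * \<delta>"
    using integral_half_lines(1)[of "4 * \<delta>"] integral_half_lines(2)[of "1 - 4 * \<delta>"] \<delta>
    by (subst Bochner_Integration.integral_add[OF i1]) auto
  finally show ?thesis by simp
qed

text \<open>The powers of \<delta> balance exactly: on the layer \<open>e2\<close> is of order
  \<open>\<delta> ^ -2\<close> and \<open>(prim (prim \<nu>))\<^sup>2\<close> of order
  \<open>\<delta> ^ 3\<close>, likewise \<open>e1\<close> of order \<open>\<delta> ^ -1\<close> and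
  \<open>(prim \<nu>)\<^sup>2\<close> of order \<open>\<delta>\<close>. The squares are thus of
  order \<open>1 / \<delta>\<close> on a set of measure of order \<open>\<delta>\<close>. The second
  factor is only bounded, so smallness has to come from the first.\<close>

lemma layer_estimate:
  assumes \<nu>: "square_integrable M01 \<nu>" and m: "(\<integral>x. \<nu> x \<partial>M01) = 0" "(\<integral>x. prim \<nu> x \<partial>M01) = 0"
    and \<gamma>: "square_integrable M01 \<gamma>"
  shows "(\<integral>x. \<gamma> x * (e2 x * prim (prim \<nu>) x + 2 * (e1 x * prim \<nu> x)) \<partial>M01)\<^sup>2
    \<le> (\<integral>x. (if x \<in> layer then (\<gamma> x)\<^sup>2 else 0) \<partial>M01) * (9472 * C\<^sup>2 * (\<integral>x. (\<nu> x)\<^sup>2 \<partial>M01))"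
proof -
  let ?S = "\<integral>x. (\<nu> x)\<^sup>2 \<partial>M01"
  let ?\<rho> = "\<lambda>x. e2 x * prim (prim \<nu>) x + 2 * (e1 x * prim \<nu> x)"
  let ?\<gamma> = "\<lambda>x. if x \<in> layer then \<gamma> x else 0"
  have i: "integrable M01 \<nu>" by (rule square_integrable_integrable[OF finite_M01 \<nu>])
  have S0: "0 \<le> ?S" by simp
  have lb: "{x. x \<in> layer} \<in> sets borel" using layer_borel by simp
  have \<rho>: "continuous_on {0..1} ?\<rho>"
    by (intro continuous_intros e1_continuous e2_continuous prim_continuous prim_integrable i)
  have \<gamma>l: "square_integrable M01 ?\<gamma>"
  proof -
    have "integrable M01 ?\<gamma>" by (rule M01_If_integrable[OF square_integrable_integrable[OF finite_M01 \<gamma>] lb])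
    moreover have "(\<lambda>t. (?\<gamma> t)\<^sup>2) = (\<lambda>t. if t \<in> layer then (\<gamma> t)\<^sup>2 else 0)" by auto
    ultimately show ?thesis
      using M01_If_integrable[OF _ lb, of "\<lambda>t. (\<gamma> t)\<^sup>2"] \<gamma> by (auto simp: square_integrable_def)
  qed
  have "(\<integral>x. \<gamma> x * ?\<rho> x \<partial>M01) = (\<integral>x. ?\<gamma> x * ?\<rho> x \<partial>M01)"
    by (rule Bochner_Integration.integral_cong) (auto simp: off_layer)
  then have "(\<integral>x. \<gamma> x * ?\<rho> x \<partial>M01)\<^sup>2 \<le> (\<integral>x. (?\<gamma> x)\<^sup>2 \<partial>M01) * (\<integral>x. (?\<rho> x)\<^sup>2 \<partial>M01)"
    using square_integrable_Cauchy_Schwarz[OF \<gamma>l continuous_square_integrable[OF \<rho>]] by simp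
  also have "(\<integral>x. (?\<gamma> x)\<^sup>2 \<partial>M01) = (\<integral>x. (if x \<in> layer then (\<gamma> x)\<^sup>2 else 0) \<partial>M01)"
    by (rule Bochner_Integration.integral_cong) auto
  also have "(\<integral>x. (if x \<in> layer then (\<gamma> x)\<^sup>2 else 0) \<partial>M01) * (\<integral>x. (?\<rho> x)\<^sup>2 \<partial>M01)
    \<le> (\<integral>x. (if x \<in> layer then (\<gamma> x)\<^sup>2 else 0) \<partial>M01) * (9472 * C\<^sup>2 * ?S)"
  proof (rule mult_left_mono)
    \<comment> \<open>\<open>1184 = 2 * 3\<^sup>2 * 64 + 2 * 2\<^sup>2 * 4\<close>, and \<open>9472 = 1184 * 8\<close> by the measure of the layer\<close>
    let ?c = "1184 * C\<^sup>2 * ?S / \<delta>"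
    have pointwise: "(?\<rho> x)\<^sup>2 \<le> ?c" if x: "x \<in> {0<..<1}" "x \<in> layer" for x
    proof -
      have x01: "x \<in> {0..1}" using x by auto
      have w: "0 \<le> x * (1 - x)" "x * (1 - x) \<le> 2 * \<delta>" using x by (auto simp: layer_def)
      have V: "(prim \<nu> x)\<^sup>2 \<le> 4 * \<delta> * ?S"
      proof -
        have "2 * (x * (1 - x)) * ?S \<le> 2 * (2 * \<delta>) * ?S" using w S0 by (intro mult_right_mono mult_left_mono) auto
        then show ?thesis using prim_Hardy_bounds(1)[OF \<nu> m x01] by simp
      qed
      have v: "(prim (prim \<nu>) x)\<^sup>2 \<le> 64 * \<delta> ^ 3 * ?S"
      proof -
        have "(x * (1 - x)) ^ 3 \<le> (2 * \<delta>) ^ 3" using w by (intro power_mono)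
        then have "8 * (x * (1 - x)) ^ 3 * ?S \<le> 8 * (2 * \<delta>) ^ 3 * ?S" using S0 by (intro mult_right_mono mult_left_mono) auto
        then show ?thesis using prim_Hardy_bounds(2)[OF \<nu> m x01] by (simp add: power_mult_distrib)
      qed
      have E2: "(e2 x)\<^sup>2 \<le> (3 * C / \<delta>\<^sup>2)\<^sup>2" using power_mono[OF e2_bound[OF x(1)], of 2] by simp
      have E1: "(e1 x)\<^sup>2 \<le> (C / \<delta>)\<^sup>2" using power_mono[OF e1_bound[OF x(1)], of 2] by simp
      have "(p + q)\<^sup>2 \<le> 2 * p\<^sup>2 + 2 * q\<^sup>2" for p q :: real
        using sum_squares_bound[of p q] by (simp add: power2_sum)
      then have "(?\<rho> x)\<^sup>2 \<le> 2 * (e2 x * prim (prim \<nu>) x)\<^sup>2 + 2 * (2 * (e1 x * prim \<nu> x))\<^sup>2" .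
      also have "\<dots> = 2 * ((e2 x)\<^sup>2 * (prim (prim \<nu>) x)\<^sup>2) + 8 * ((e1 x)\<^sup>2 * (prim \<nu> x)\<^sup>2)"
        by (simp add: power_mult_distrib)
      also have "\<dots> \<le> 2 * ((3 * C / \<delta>\<^sup>2)\<^sup>2 * (64 * \<delta> ^ 3 * ?S)) + 8 * ((C / \<delta>)\<^sup>2 * (4 * \<delta> * ?S))"
        by (intro add_mono mult_left_mono mult_mono E1 E2 v V) auto
      also have "\<dots> = ?c" using \<delta> by (simp add: field_simps power2_eq_square power3_eq_cube)
      finally show ?thesis .
    qed
    have lay: "integrable M01 (\<lambda>x. ?c * (if x \<in> layer then 1 else 0))"
      by (intro integrable_mult_right M01_If_integrable[OF finite_measure.integrable_const[OF finite_M01] lb])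
    have "(\<integral>x. (?\<rho> x)\<^sup>2 \<partial>M01) \<le> (\<integral>x. ?c * (if x \<in> layer then 1 else 0) \<partial>M01)"
    proof (rule integral_mono[OF _ lay])
      show "integrable M01 (\<lambda>x. (?\<rho> x)\<^sup>2)" using continuous_square_integrable[OF \<rho>] by (simp add: square_integrable_def)
      show "(?\<rho> x)\<^sup>2 \<le> ?c * (if x \<in> layer then 1 else 0)" if "x \<in> space M01" for x
        using pointwise[of x] off_layer[of x] that by (cases "x \<in> layer") auto
    qed
    also have "\<dots> = ?c * (\<integral>x. (if x \<in> layer then 1 else 0) \<partial>M01)" by simp
    also have "\<dots> \<le> ?c * (8 * \<delta>)" using layer_measure \<delta> S0 by (intro mult_left_mono) auto
    also have "\<dots> = 9472 * C\<^sup>2 * ?S" using \<delta> by simp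
    finally show "(\<integral>x. (?\<rho> x)\<^sup>2 \<partial>M01) \<le> 9472 * C\<^sup>2 * ?S" .
  qed (auto intro!: Bochner_Integration.integral_nonneg)
  finally show ?thesis .
qed

text \<open>With \<open>v = prim (prim \<nu>)\<close>, \<open>Green_local\<close> is applied to
  \<open>\<mu> = (e v)''\<close>, which vanishes near the end points. The moment conditions for
  \<open>\<mu>\<close> hold because \<open>e\<close> and \<open>e1\<close> vanish at 1.\<close>

lemma Green_cutoff:
  assumes \<gamma>: "square_integrable M01 \<gamma>" and \<nu>: "square_integrable M01 \<nu>"
    and g: "\<And>c d. 0 < c \<Longrightarrow> d < 1 \<Longrightarrow> integrable M01 (\<lambda>t. if c \<le> t \<and> t \<le> d then g t else 0)"
    and weak: "\<And>\<phi>. test_on 0 1 \<phi> \<Longrightarrow> (\<integral>x. \<gamma> x * (deriv ^^ 2) \<phi> x \<partial>M01) = (\<integral>x. g x * \<phi> x \<partial>M01)"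
  shows "(\<integral>x. \<gamma> x * (e x * \<nu> x) \<partial>M01) + (\<integral>x. \<gamma> x * (e2 x * prim (prim \<nu>) x + 2 * (e1 x * prim \<nu> x)) \<partial>M01)
    = (\<integral>x. g x * (e x * prim (prim \<nu>) x) \<partial>M01)"
proof -
  have \<nu>i: "integrable M01 \<nu>" by (rule square_integrable_integrable[OF finite_M01 \<nu>])
  have \<gamma>i: "integrable M01 \<gamma>" by (rule square_integrable_integrable[OF finite_M01 \<gamma>])
  have V: "continuous_on {0..1} (prim \<nu>)" "continuous_on {0..1} (prim (prim \<nu>))"
    by (intro prim_continuous prim_integrable \<nu>i)+
  have Vi: "integrable M01 (prim \<nu>)" by (rule prim_integrable[OF \<nu>i])
  \<comment> \<open>\<open>\<mu>1\<close> is the derivative of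
    \<open>e1 * prim (prim \<nu>)\<close>, and \<open>\<mu>2\<close> that of
    \<open>e * prim \<nu>\<close>; each is a case of \<open>prim_product_rule\<close>.\<close>
  define \<mu>1 where "\<mu>1 x = e2 x * prim (prim \<nu>) x + e1 x * prim \<nu> x" for x
  define \<mu>2 where "\<mu>2 x = e1 x * prim \<nu> x + e x * \<nu> x" for x
  define \<mu> where "\<mu> x = \<mu>1 x + \<mu>2 x" for x
  have i1: "integrable M01 \<mu>1"
    unfolding \<mu>1_def by (intro M01_continuous_integrable continuous_intros e1_continuous e2_continuous V)
  have "integrable M01 (\<lambda>x. e x * \<nu> x)"
    using M01_bounded_mult[OF \<nu>i e_continuous] by (simp add: mult.commute)
  then have i2: "integrable M01 \<mu>2"
    unfolding \<mu>2_def
    by (rule Bochner_Integration.integrable_add[OF M01_continuous_integrable[OF continuous_on_mult[OF e1_continuous V(1)]]])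
  have i: "integrable M01 \<mu>" unfolding \<mu>_def using i1 i2 by simp
  have p1: "prim \<mu> x = e1 x * prim (prim \<nu>) x + e x * prim \<nu> x" if "x \<in> {0..1}" for x
    using prim_add[OF i1 i2, of x] prim_product_rule[OF e1_DERIV e2_continuous Vi that]
      prim_product_rule[OF e_DERIV e1_continuous \<nu>i that]
    by (simp add: \<mu>_def[abs_def] \<mu>1_def[abs_def] \<mu>2_def[abs_def])
  have p2: "prim (prim \<mu>) x = e x * prim (prim \<nu>) x" if "x \<in> {0..1}" for x
  proof -
    have "prim (prim \<mu>) x = prim (\<lambda>t. e1 t * prim (prim \<nu>) t + e t * prim \<nu> t) x"
      by (rule prim_cong) (use p1 in auto)
    then show ?thesis using prim_product_rule[OF e_DERIV e1_continuous Vi that] by simp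
  qed
  have e01: "e 1 = 0" "e1 1 = 0" using s_le_0 s'_off by (auto simp: e_def e1_def arg_def)
  have "(\<integral>x. \<gamma> x * \<mu> x \<partial>M01) = (\<integral>x. g x * prim (prim \<mu>) x \<partial>M01)"
  proof (rule Green_local[OF \<gamma>i, of \<delta> "1 - \<delta>"])
    show "(\<integral>x. \<mu> x \<partial>M01) = 0" using p1[of 1] e01 by (simp add: prim_1)
    show "(\<integral>x. prim \<mu> x \<partial>M01) = 0" using p2[of 1] e01 by (simp add: prim_1)
    fix x :: real assume x: "x \<in> {0<..<1}" "x \<notin> {\<delta><..<1 - \<delta>}"
    then have "x \<notin> layer" using layer_sub(2) by blast
    then show "\<mu> x = 0" using off_layer[of x] e_off[OF x] by (simp add: \<mu>_def \<mu>1_def \<mu>2_def)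
    show "prim (prim \<mu>) x = 0" using p2[of x] e_off[OF x] x by simp
  qed (use \<delta> g weak i in auto)
  moreover have "(\<integral>x. g x * prim (prim \<mu>) x \<partial>M01) = (\<integral>x. g x * (e x * prim (prim \<nu>) x) \<partial>M01)"
    by (rule Bochner_Integration.integral_cong) (auto simp: p2)
  moreover have "(\<integral>x. \<gamma> x * \<mu> x \<partial>M01) = (\<integral>x. \<gamma> x * (e x * \<nu> x) + \<gamma> x * (e2 x * prim (prim \<nu>) x + 2 * (e1 x * prim \<nu> x)) \<partial>M01)"
    by (rule Bochner_Integration.integral_cong) (auto simp: \<mu>_def \<mu>1_def \<mu>2_def algebra_simps)
  moreover have "\<dots> = (\<integral>x. \<gamma> x * (e x * \<nu> x) \<partial>M01) + (\<integral>x. \<gamma> x * (e2 x * prim (prim \<nu>) x + 2 * (e1 x * prim \<nu> x)) \<partial>M01)"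
  proof (rule Bochner_Integration.integral_add)
    show "integrable M01 (\<lambda>x. \<gamma> x * (e x * \<nu> x))"
      using M01_bounded_mult[OF square_integrable_mult[OF \<gamma> \<nu>] e_continuous] by (simp add: mult_ac)
    show "integrable M01 (\<lambda>x. \<gamma> x * (e2 x * prim (prim \<nu>) x + 2 * (e1 x * prim \<nu> x)))"
      by (intro M01_bounded_mult[OF \<gamma>i] continuous_intros e1_continuous e2_continuous V)
  qed
  ultimately show ?thesis by simp
qed

end

text \<open>As the cutoffs tend to 1, the main terms converge by dominated convergence, with
  \<open>gv\<close> as majorant on the right. The error is controlled by the integral of
  \<open>\<gamma>\<^sup>2\<close> over the layer, which tends to 0 because every interior point
  eventually leaves the layer.\<close>

theorem Green_formula:
  assumes \<gamma>: "square_integrable M01 \<gamma>" and \<nu>: "square_integrable M01 \<nu>"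
    and m: "(\<integral>x. \<nu> x \<partial>M01) = 0" "(\<integral>x. prim \<nu> x \<partial>M01) = 0"
    and g: "\<And>c d. 0 < c \<Longrightarrow> d < 1 \<Longrightarrow> integrable M01 (\<lambda>t. if c \<le> t \<and> t \<le> d then g t else 0)"
    and gv: "integrable M01 (\<lambda>x. g x * prim (prim \<nu>) x)"
    and weak: "\<And>\<phi>. test_on 0 1 \<phi> \<Longrightarrow> (\<integral>x. \<gamma> x * (deriv ^^ 2) \<phi> x \<partial>M01) = (\<integral>x. g x * \<phi> x \<partial>M01)"
  shows "(\<integral>x. \<gamma> x * \<nu> x \<partial>M01) = (\<integral>x. g x * prim (prim \<nu>) x \<partial>M01)"
proof -
  obtain s C where s: "smooth s"
    "\<And>y. y \<le> 0 \<Longrightarrow> s y = 0" "\<And>y. 1 \<le> y \<Longrightarrow> s y = 1" "\<And>y. \<bar>s y\<bar> \<le> (1::real)"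
    "\<And>y. y \<le> 0 \<or> 1 \<le> y \<Longrightarrow> deriv s y = 0" "\<And>y. y \<le> 0 \<or> 1 \<le> y \<Longrightarrow> deriv (deriv s) y = 0"
    "\<And>y. \<bar>deriv s y\<bar> \<le> C" "\<And>y. \<bar>deriv (deriv s) y\<bar> \<le> C" "0 \<le> C"
    by (rule smooth_step) blast
  define \<delta> where "\<delta> n = inverse (real (Suc n)) * (1 / 4)" for n
  have \<delta>: "0 < \<delta> n" "\<delta> n \<le> 1 / 4" for n by (auto simp: \<delta>_def field_simps)
  have cut: "cutoff s C (\<delta> n)" for n using s \<delta>[of n] by unfold_locales auto
  have \<delta>lim: "\<delta> \<longlonglongrightarrow> 0"
    unfolding \<delta>_def using tendsto_mult_right[OF LIMSEQ_inverse_real_of_nat, of "1 / 4"] by simp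
  let ?v = "prim (prim \<nu>)"
  let ?e = "\<lambda>n. cutoff.e s (\<delta> n)"
  let ?\<rho> = "\<lambda>n x. cutoff.e2 s (\<delta> n) x * ?v x + 2 * (cutoff.e1 s (\<delta> n) x * prim \<nu> x)"
  have far: "\<forall>\<^sub>F n in sequentially. 2 * \<delta> n < x * (1 - x)" if "x \<in> {0<..<1}" for x
  proof -
    have "(\<lambda>n. 2 * \<delta> n) \<longlonglongrightarrow> 2 * 0" by (intro tendsto_intros \<delta>lim)
    moreover have "2 * 0 < x * (1 - x)" using that by simp
    ultimately show ?thesis by (rule order_tendstoD(2))
  qed
  have e_lim: "(\<lambda>n. ?e n x) \<longlonglongrightarrow> 1" if x: "x \<in> {0<..<1}" for x
  proof (rule Lim_transform_eventually[OF tendsto_const])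
    show "\<forall>\<^sub>F n in sequentially. 1 = ?e n x"
      using far[OF x]
    proof eventually_elim
      case (elim n)
      then have "1 \<le> x * (1 - x) / \<delta> n - 1" using \<delta>[of n] by (simp add: field_simps)
      then show ?case using s(3) by (simp add: cutoff.e_def[OF cut] cutoff.arg_def[OF cut])
    qed
  qed
  have e_bound: "\<bar>?e n x\<bar> \<le> 1" for n x using s(4) by (simp add: cutoff.e_def[OF cut])
  have dct: "(\<lambda>n. \<integral>x. f x * ?e n x \<partial>M01) \<longlonglongrightarrow> (\<integral>x. f x \<partial>M01)" if f: "integrable M01 f" for f
  proof (rule integral_dominated_convergence)
    show "f \<in> borel_measurable M01" "integrable M01 (\<lambda>x. norm (f x))" using f by auto
    show "(\<lambda>x. f x * ?e n x) \<in> borel_measurable M01" for n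
      using M01_bounded_mult[OF f cutoff.e_continuous[OF cut]] by auto
    show "AE x in M01. (\<lambda>n. f x * ?e n x) \<longlonglongrightarrow> f x"
      using tendsto_mult_left[OF e_lim] by (intro AE_I2) fastforce
    show "AE x in M01. norm (f x * ?e n x) \<le> norm (f x)" for n
      using e_bound by (intro AE_I2) (simp add: abs_mult mult_left_le)
  qed
  have A: "(\<lambda>n. \<integral>x. \<gamma> x * (?e n x * \<nu> x) \<partial>M01) \<longlonglongrightarrow> (\<integral>x. \<gamma> x * \<nu> x \<partial>M01)"
    using dct[OF square_integrable_mult[OF \<gamma> \<nu>]] by (simp add: mult_ac)
  have G: "(\<lambda>n. \<integral>x. g x * (?e n x * ?v x) \<partial>M01) \<longlonglongrightarrow> (\<integral>x. g x * ?v x \<partial>M01)"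
    using dct[OF gv] by (simp add: mult_ac)
  have \<gamma>2: "integrable M01 (\<lambda>x. (\<gamma> x)\<^sup>2)" using \<gamma> by (simp add: square_integrable_def)
  have L: "(\<lambda>n. \<integral>x. (if x \<in> cutoff.layer (\<delta> n) then (\<gamma> x)\<^sup>2 else 0) \<partial>M01) \<longlonglongrightarrow> (\<integral>x. 0 \<partial>M01)"
  proof (rule integral_dominated_convergence)
    show "(\<lambda>x. if x \<in> cutoff.layer (\<delta> n) then (\<gamma> x)\<^sup>2 else 0) \<in> borel_measurable M01" for n
      using M01_If_integrable[OF \<gamma>2, of "\<lambda>x. x \<in> cutoff.layer (\<delta> n)"] cutoff.layer_borel[OF cut] by auto
    show "AE x in M01. (\<lambda>n. if x \<in> cutoff.layer (\<delta> n) then (\<gamma> x)\<^sup>2 else 0) \<longlonglongrightarrow> 0"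
    proof (rule AE_I2)
      fix x assume "x \<in> space M01"
      then have x: "x \<in> {0<..<1}" by simp
      show "(\<lambda>n. if x \<in> cutoff.layer (\<delta> n) then (\<gamma> x)\<^sup>2 else 0) \<longlonglongrightarrow> 0"
      proof (rule Lim_transform_eventually[OF tendsto_const])
        show "\<forall>\<^sub>F n in sequentially. 0 = (if x \<in> cutoff.layer (\<delta> n) then (\<gamma> x)\<^sup>2 else 0)"
          using far[OF x] by eventually_elim (simp add: cutoff.layer_def[OF cut])
      qed
    qed
  qed (use \<gamma>2 in auto)
  have "(\<lambda>n. (\<integral>x. \<gamma> x * ?\<rho> n x \<partial>M01)\<^sup>2) \<longlonglongrightarrow> 0"
  proof (rule tendsto_sandwich[of "\<lambda>_. 0"])
    show "\<forall>\<^sub>F n in sequentially. (\<integral>x. \<gamma> x * ?\<rho> n x \<partial>M01)\<^sup>2 \<le>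
      (\<integral>x. (if x \<in> cutoff.layer (\<delta> n) then (\<gamma> x)\<^sup>2 else 0) \<partial>M01) * (9472 * C\<^sup>2 * (\<integral>x. (\<nu> x)\<^sup>2 \<partial>M01))"
      by (intro always_eventually allI cutoff.layer_estimate[OF cut \<nu> m \<gamma>])
    show "(\<lambda>n. (\<integral>x. (if x \<in> cutoff.layer (\<delta> n) then (\<gamma> x)\<^sup>2 else 0) \<partial>M01) * (9472 * C\<^sup>2 * (\<integral>x. (\<nu> x)\<^sup>2 \<partial>M01))) \<longlonglongrightarrow> 0"
      using tendsto_mult_right[OF L] by simp
  qed auto
  then have "(\<lambda>n. sqrt ((\<integral>x. \<gamma> x * ?\<rho> n x \<partial>M01)\<^sup>2)) \<longlonglongrightarrow> sqrt 0" by (rule tendsto_real_sqrt)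
  then have "(\<lambda>n. \<integral>x. \<gamma> x * ?\<rho> n x \<partial>M01) \<longlonglongrightarrow> 0" by (simp add: tendsto_rabs_zero_iff)
  from tendsto_add[OF A this]
  have "(\<lambda>n. \<integral>x. g x * (?e n x * ?v x) \<partial>M01) \<longlonglongrightarrow> (\<integral>x. \<gamma> x * \<nu> x \<partial>M01)"
    using cutoff.Green_cutoff[OF cut \<gamma> \<nu> g weak] by simp
  then show ?thesis using LIMSEQ_unique[OF _ G] by blast
qed

section \<open>Weak derivatives and boundary conditions\<close>

lemma smooth_funpow_deriv: "smooth \<phi> \<Longrightarrow> smooth ((deriv ^^ k) \<phi>)"
  by (induction k) (auto intro: smooth_deriv)

lemma M01_lebesgue_on:
  fixes f :: "real \<Rightarrow> real"
  assumes "K \<in> sets lebesgue" "K \<subseteq> {0<..<1}"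
  shows "integrable (lebesgue_on K) f \<longleftrightarrow> integrable M01 (\<lambda>t. if t \<in> K then f t else 0)"
proof -
  have "integrable (lebesgue_on K) f \<longleftrightarrow> integrable lebesgue (\<lambda>x. indicator K x *\<^sub>R f x)"
    using assms by (intro integrable_restrict_space) auto
  also have "(\<lambda>x. indicator K x *\<^sub>R f x) = (\<lambda>x. indicator {0<..<1} x *\<^sub>R (if x \<in> K then f x else 0))"
    using assms by (auto simp: indicator_def fun_eq_iff)
  also have "integrable lebesgue \<dots> \<longleftrightarrow> integrable M01 (\<lambda>t. if t \<in> K then f t else 0)"
    by (rule integrable_restrict_space[symmetric]) simp
  finally show ?thesis .
qed

lemma compact_lebesgue: "compact K \<Longrightarrow> K \<in> sets lebesgue" for K :: "real set"
  by (simp add: borel_compact)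

lemma loc_integrable_iff:
  "loc_integrable u \<longleftrightarrow> (\<forall>K. compact K \<and> K \<subseteq> {0<..<1} \<longrightarrow> integrable M01 (\<lambda>t. if t \<in> K then rep_l0 u t else 0))"
  unfolding loc_integrable_def using M01_lebesgue_on[OF compact_lebesgue] by blast

lemma loc_integrableI: "integrable M01 (rep_l0 u) \<Longrightarrow> loc_integrable u"
  unfolding loc_integrable_iff
  using M01_If_integrable[of "rep_l0 u" "\<lambda>t. t \<in> K" for K] by (auto simp: borel_compact)

lemma loc_integrable_Icc:
  assumes "loc_integrable u" "0 < c" "d < 1"
  shows "integrable M01 (\<lambda>t. if c \<le> t \<and> t \<le> d then rep_l0 u t else 0)"
proof -
  have "{c..d} \<subseteq> {0<..<1}" using assms by auto
  then have "integrable M01 (\<lambda>t. if t \<in> {c..d} then rep_l0 u t else 0)"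
    using assms(1) unfolding loc_integrable_iff by blast
  then show ?thesis by simp
qed

lemma L2_iff: "u \<in> L2 \<longleftrightarrow> square_integrable M01 (rep_l0 u)"
  using rep_l0_measurable by (auto simp: L2_def square_integrable_def)

lemma L2_integrable: "u \<in> L2 \<Longrightarrow> integrable M01 (rep_l0 u)"
  unfolding L2_iff by (rule square_integrable_integrable[OF finite_M01])

lemma abs_l0_L2: assumes "square_integrable M01 f" shows "abs_l0 f \<in> L2"
  unfolding L2_iff
proof (rule square_integrable_cong_AE[OF assms])
  show "AE x in M01. f x = rep_l0 (abs_l0 f) x"
    using rep_abs_l0[OF square_integrable_measurable[OF assms]] by eventually_elim simp
qed (rule rep_l0_measurable)

lemma rep_integral_cong:
  assumes "AE x in M01. rep_l0 u x = f x" "f \<in> borel_measurable M01" "q \<in> borel_measurable M01"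
  shows "(\<integral>x. rep_l0 u x * q x \<partial>M01) = (\<integral>x. f x * q x \<partial>M01)"
proof (rule integral_cong_AE)
  show "(\<lambda>x. rep_l0 u x * q x) \<in> borel_measurable M01" "(\<lambda>x. f x * q x) \<in> borel_measurable M01"
    using assms rep_l0_measurable by (auto intro: borel_measurable_times)
  show "AE x in M01. rep_l0 u x * q x = f x * q x" using assms(1) by eventually_elim simp
qed

text \<open>Needed to evaluate the description operator in \<open>dist_deriv\<close>. Locally
  integrable functions may fail to be integrable on the whole interval, so the two candidates are
  truncated and compared on the exhaustion by \<open>{c n<..<1 - c n}\<close>.\<close>

lemma has_dist_deriv_unique:
  assumes g: "has_dist_deriv k u g" and h: "has_dist_deriv k u h" shows "g = h"
proof -
  have lg: "loc_integrable g" and lh: "loc_integrable h" using g h by (auto simp: has_dist_deriv_def)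
  define c where "c n = inverse (real (Suc (Suc n)))" for n
  have c: "0 < c n" for n by (simp add: c_def)
  have "AE x in M01. x \<in> {c n<..<1 - c n} \<longrightarrow> rep_l0 g x = rep_l0 h x" for n
  proof -
    let ?cut = "\<lambda>u t. if c n \<le> t \<and> t \<le> 1 - c n then rep_l0 u t else 0"
    have ig: "integrable M01 (?cut g)" and ih: "integrable M01 (?cut h)"
      using loc_integrable_Icc[OF lg, of "c n" "1 - c n"] loc_integrable_Icc[OF lh, of "c n" "1 - c n"] c[of n] by auto
    have "AE x in M01. x \<in> {c n<..<1 - c n} \<longrightarrow> ?cut g x - ?cut h x = 0"
    proof (rule AE_zero_if_orthogonal_to_tests)
      show "integrable M01 (\<lambda>x. ?cut g x - ?cut h x)" using ig ih by simp
      fix \<phi> assume \<phi>: "test_on (c n) (1 - c n) \<phi>"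
      have \<phi>01: "test_on 0 1 \<phi>" using c[of n] by (intro test_on_mono[OF \<phi>]) auto
      have cut: "(\<integral>x. ?cut w x * \<phi> x \<partial>M01) = (\<integral>x. rep_l0 w x * \<phi> x \<partial>M01)" for w
        using test_on_zero[OF \<phi>] by (intro Bochner_Integration.integral_cong) auto
      have eq: "(\<integral>x. rep_l0 u x * (deriv ^^ k) \<phi> x \<partial>M01) = (- 1) ^ k * (\<integral>x. rep_l0 w x * \<phi> x \<partial>M01)"
        if "has_dist_deriv k u w" for w
        using that \<phi>01 unfolding has_dist_deriv_def test_function_iff by blast
      have "(- 1) ^ k * (\<integral>x. rep_l0 g x * \<phi> x \<partial>M01) = (- 1) ^ k * (\<integral>x. rep_l0 h x * \<phi> x \<partial>M01)"
        using eq[OF g] eq[OF h] by (rule trans[OF sym])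
      then have "(\<integral>x. rep_l0 g x * \<phi> x \<partial>M01) = (\<integral>x. rep_l0 h x * \<phi> x \<partial>M01)" by simp
      moreover have "(\<integral>x. (?cut g x - ?cut h x) * \<phi> x \<partial>M01) = (\<integral>x. ?cut g x * \<phi> x - ?cut h x * \<phi> x \<partial>M01)"
        by (simp add: left_diff_distrib)
      moreover have "\<dots> = (\<integral>x. ?cut g x * \<phi> x \<partial>M01) - (\<integral>x. ?cut h x * \<phi> x \<partial>M01)"
        by (intro Bochner_Integration.integral_diff test_on_integrable_mult[OF \<phi>01] ig ih)
      ultimately show "(\<integral>x. (?cut g x - ?cut h x) * \<phi> x \<partial>M01) = 0" by (simp add: cut)
    qed (use c[of n] in auto)
    then show ?thesis by eventually_elim auto
  qed
  then have "AE x in M01. \<forall>n. x \<in> {c n<..<1 - c n} \<longrightarrow> rep_l0 g x = rep_l0 h x"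
    unfolding AE_all_countable by blast
  moreover have "AE x in M01. x \<in> {0<..<1}" by (rule AE_I2) simp
  ultimately have "AE x in M01. rep_l0 g x = rep_l0 h x"
  proof eventually_elim
    case (elim x)
    then have "0 < min x (1 - x)" by simp
    then obtain n where n: "inverse (real (Suc n)) < min x (1 - x)" using reals_Archimedean by blast
    have "c n < inverse (real (Suc n))" unfolding c_def by (intro less_imp_inverse_less) auto
    then have "x \<in> {c n<..<1 - c n}" using n by auto
    then show ?case using elim(1) by blast
  qed
  then show ?thesis by (rule l0_eqI)
qed

lemma dist_deriv_eq: "has_dist_deriv k u g \<Longrightarrow> dist_deriv k u = g"
  unfolding dist_deriv_def using has_dist_deriv_unique by blast

text \<open>Here \<open>\<phi>\<close> need not vanish at the end points; the two moment conditions
  on \<open>h\<close> remove the boundary terms instead.\<close>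

lemma prim2_smooth_by_parts:
  assumes h: "integrable M01 h" and m: "(\<integral>x. h x \<partial>M01) = 0" "(\<integral>x. prim h x \<partial>M01) = 0" and \<phi>: "smooth \<phi>"
  shows "(\<integral>x. prim (prim h) x * (deriv ^^ 2) \<phi> x \<partial>M01) = (\<integral>x. h x * \<phi> x \<partial>M01)"
proof -
  have ibp: "(\<integral>x. prim f x * deriv \<psi> x \<partial>M01) = - (\<integral>x. f x * \<psi> x \<partial>M01)"
    if f: "integrable M01 f" "(\<integral>x. f x \<partial>M01) = 0" and \<psi>: "smooth \<psi>" for f \<psi>
  proof -
    have d: "continuous_on {0..1} (deriv \<psi>)" by (intro smooth_continuous smooth_deriv \<psi>)
    have p: "prim (deriv \<psi>) x = \<psi> x - \<psi> 0" if "x \<in> {0..1}" for x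
      by (rule prim_FTC[where F=\<psi>, OF _ d that]) (rule has_field_derivative_at_within[OF smooth_DERIV[OF \<psi>]])
    have "(\<integral>x. f x * prim (deriv \<psi>) x \<partial>M01) = (\<integral>x. f x * \<psi> x - f x * \<psi> 0 \<partial>M01)"
      by (rule Bochner_Integration.integral_cong) (auto simp: p right_diff_distrib)
    also have "\<dots> = (\<integral>x. f x * \<psi> x \<partial>M01)"
      using f M01_bounded_mult[OF f(1) smooth_continuous[OF \<psi>]] by simp
    finally show ?thesis
      using prim_by_parts[OF f(1) M01_continuous_integrable[OF d]] f(2) by simp
  qed
  show ?thesis
    using ibp[OF prim_integrable[OF h] m(2) smooth_deriv[OF \<phi>]] ibp[OF h m(1) \<phi>] by (simp add: numeral_2_eq_2)
qed

lemma moment_prim: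
  assumes h: "integrable M01 h" "(\<integral>x. h x \<partial>M01) = 0"
  shows "(\<integral>x. prim h x \<partial>M01) = - (\<integral>x. x * h x \<partial>M01)"
proof -
  have 1: "integrable M01 (\<lambda>t. 1 :: real)" by (rule finite_measure.integrable_const[OF finite_M01])
  have "(\<integral>x. prim (\<lambda>t. 1) x * h x \<partial>M01) = (\<integral>x. x * h x \<partial>M01)"
    by (rule Bochner_Integration.integral_cong) (auto simp: prim_const)
  then show ?thesis using prim_by_parts[OF 1 h(1)] h(2) by simp
qed

lemma smooth_poly: "smooth (\<lambda>x. poly p x)"
proof -
  have "ndiff n (poly p)" for n
  proof (induction n arbitrary: p)
    case (Suc n)
    have "deriv (poly p) = poly (pderiv p)" by (intro ext DERIV_imp_deriv poly_DERIV)
    moreover have "poly p field_differentiable at x" for x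
      using poly_DERIV field_differentiable_def by blast
    ultimately show ?case using Suc by simp
  qed simp
  then show ?thesis by (simp add: smooth_def)
qed

text \<open>An affine function orthogonal to \<open>1\<close> and \<open>x\<close> is orthogonal to
  itself.\<close>

lemma affine_zero:
  assumes "(\<integral>x. \<alpha> + \<beta> * x \<partial>M01) = 0" "(\<integral>x. (\<alpha> + \<beta> * x) * x \<partial>M01) = 0" and x: "x \<in> {0..1}"
  shows "\<alpha> + \<beta> * x = 0"
proof (rule AE_zero_continuous[where f="\<lambda>x. \<alpha> + \<beta> * x", OF _ _ x])
  have c: "continuous_on {0..1} (\<lambda>x. \<alpha> + \<beta> * x)" by (intro continuous_intros)
  have i: "integrable M01 (\<lambda>x. \<alpha> + \<beta> * x)" "integrable M01 (\<lambda>x. (\<alpha> + \<beta> * x) * x)"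
    "integrable M01 (\<lambda>x. (\<alpha> + \<beta> * x)\<^sup>2)"
    by (intro M01_continuous_integrable continuous_intros)+
  have "(\<integral>x. (\<alpha> + \<beta> * x)\<^sup>2 \<partial>M01) = (\<integral>x. \<alpha> * (\<alpha> + \<beta> * x) + \<beta> * ((\<alpha> + \<beta> * x) * x) \<partial>M01)"
    by (rule Bochner_Integration.integral_cong) (auto simp: power2_eq_square algebra_simps)
  also have "\<dots> = \<alpha> * (\<integral>x. \<alpha> + \<beta> * x \<partial>M01) + \<beta> * (\<integral>x. (\<alpha> + \<beta> * x) * x \<partial>M01)"
    by (subst Bochner_Integration.integral_add) (use i in \<open>auto intro: integrable_mult_right\<close>)
  finally have "(\<integral>x. (\<alpha> + \<beta> * x)\<^sup>2 \<partial>M01) = 0" using assms by simp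
  then show "AE x in M01. \<alpha> + \<beta> * x = 0"
    using integral_nonneg_eq_0_iff_AE[OF i(3)] by simp
  show "continuous_on {0..1} (\<lambda>x. \<alpha> + \<beta> * x)" by (rule c)
qed

text \<open>Pairing with functions that are smooth up to the boundary encodes the boundary conditions.\<close>

lemma weak_H20_iff:
  assumes u: "integrable M01 u" and h: "integrable M01 h"
  shows "(\<forall>\<phi>. smooth \<phi> \<longrightarrow> (\<integral>x. u x * (deriv ^^ 2) \<phi> x \<partial>M01) = (\<integral>x. h x * \<phi> x \<partial>M01)) \<longleftrightarrow>
    (\<integral>x. h x \<partial>M01) = 0 \<and> (\<integral>x. prim h x \<partial>M01) = 0 \<and> (AE x in M01. u x = prim (prim h) x)"
    (is "?weak \<longleftrightarrow> ?strong")
proof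
  assume s: ?strong
  have Kh: "continuous_on {0..1} (prim (prim h))" by (intro prim_continuous prim_integrable h)
  show ?weak
  proof (intro allI impI)
    fix \<phi> :: "real \<Rightarrow> real" assume \<phi>: "smooth \<phi>"
    have c: "continuous_on {0..1} ((deriv ^^ 2) \<phi>)" by (intro smooth_continuous smooth_funpow_deriv \<phi>)
    have "(\<integral>x. u x * (deriv ^^ 2) \<phi> x \<partial>M01) = (\<integral>x. prim (prim h) x * (deriv ^^ 2) \<phi> x \<partial>M01)"
    proof (rule integral_cong_AE)
      show "(\<lambda>x. u x * (deriv ^^ 2) \<phi> x) \<in> borel_measurable M01" using M01_bounded_mult[OF u c] by auto
      show "(\<lambda>x. prim (prim h) x * (deriv ^^ 2) \<phi> x) \<in> borel_measurable M01"
        using M01_bounded_mult[OF M01_continuous_integrable[OF Kh] c] by auto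
      have "AE x in M01. u x = prim (prim h) x" using s by blast
      then show "AE x in M01. u x * (deriv ^^ 2) \<phi> x = prim (prim h) x * (deriv ^^ 2) \<phi> x" by eventually_elim simp
    qed
    then show "(\<integral>x. u x * (deriv ^^ 2) \<phi> x \<partial>M01) = (\<integral>x. h x * \<phi> x \<partial>M01)"
      using prim2_smooth_by_parts[OF h _ _ \<phi>] s by simp
  qed
next
  assume w: ?weak
  have deriv_poly: "deriv (poly p) = poly (pderiv p)" for p :: "real poly"
    by (intro ext DERIV_imp_deriv poly_DERIV)
  have wp: "(\<integral>x. u x * poly (pderiv (pderiv p)) x \<partial>M01) = (\<integral>x. h x * poly p x \<partial>M01)" for p
    using w[rule_format, OF smooth_poly[of p]] by (simp add: numeral_2_eq_2 deriv_poly)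
  \<comment> \<open>The polynomials \<open>1\<close> and \<open>x\<close> have vanishing second
    derivative, so the weak identity turns into moment conditions on \<open>h\<close>.\<close>
  have m0: "(\<integral>x. h x \<partial>M01) = 0" using wp[of 1] by simp
  have "(\<integral>x. x * h x \<partial>M01) = 0" using wp[of "[:0, 1:]"] by (simp add: pderiv_pCons mult.commute)
  then have m1: "(\<integral>x. prim h x \<partial>M01) = 0" using moment_prim[OF h m0] by simp
  let ?K = "prim (prim h)"
  have Kh: "continuous_on {0..1} ?K" by (intro prim_continuous prim_integrable h)
  have Ki: "integrable M01 ?K" by (rule M01_continuous_integrable[OF Kh])
  have q: "integrable M01 (\<lambda>x. u x - ?K x)" using u Ki by simp
  have orth: "(\<integral>x. (u x - ?K x) * (deriv ^^ 2) \<phi> x \<partial>M01) = 0" if \<phi>: "smooth \<phi>" for \<phi>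
  proof -
    have c: "continuous_on {0..1} ((deriv ^^ 2) \<phi>)" by (intro smooth_continuous smooth_funpow_deriv \<phi>)
    have "(\<integral>x. (u x - ?K x) * (deriv ^^ 2) \<phi> x \<partial>M01)
      = (\<integral>x. u x * (deriv ^^ 2) \<phi> x \<partial>M01) - (\<integral>x. ?K x * (deriv ^^ 2) \<phi> x \<partial>M01)"
      using M01_bounded_mult[OF u c] M01_bounded_mult[OF Ki c] by (simp add: left_diff_distrib)
    then show ?thesis using w \<phi> prim2_smooth_by_parts[OF h m0 m1 \<phi>] by simp
  qed
  obtain \<alpha> \<beta> where ab: "AE x in M01. x \<in> {0<..<1} \<longrightarrow> u x - ?K x = \<alpha> + \<beta> * x"
    by (rule du_Bois_Reymond_second_order[OF q, of 0 1])
      (use orth in \<open>auto dest: test_on_smooth\<close>)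
  have "AE x in M01. x \<in> {0<..<1}" by (rule AE_I2) simp
  with ab have ab: "AE x in M01. u x - ?K x = \<alpha> + \<beta> * x" by eventually_elim simp
  have aff: "(\<integral>x. (\<alpha> + \<beta> * x) * poly (pderiv (pderiv p)) x \<partial>M01) = 0" for p
  proof -
    have c: "continuous_on {0..1} (poly (pderiv (pderiv p)))" by (intro continuous_intros)
    have "(\<integral>x. (\<alpha> + \<beta> * x) * poly (pderiv (pderiv p)) x \<partial>M01) = (\<integral>x. (u x - ?K x) * poly (pderiv (pderiv p)) x \<partial>M01)"
    proof (rule integral_cong_AE)
      show "(\<lambda>x. (u x - ?K x) * poly (pderiv (pderiv p)) x) \<in> borel_measurable M01" using M01_bounded_mult[OF q c] by auto
      have "integrable M01 (\<lambda>x. (\<alpha> + \<beta> * x) * poly (pderiv (pderiv p)) x)"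
        by (intro M01_continuous_integrable continuous_intros)
      then show "(\<lambda>x. (\<alpha> + \<beta> * x) * poly (pderiv (pderiv p)) x) \<in> borel_measurable M01" by auto
      show "AE x in M01. (\<alpha> + \<beta> * x) * poly (pderiv (pderiv p)) x = (u x - ?K x) * poly (pderiv (pderiv p)) x"
        using ab by eventually_elim simp
    qed
    then show ?thesis using orth[OF smooth_poly[of p]] by (simp add: numeral_2_eq_2 deriv_poly)
  qed
  \<comment> \<open>The second derivatives of \<open>x\<^sup>2 / 2\<close> and
    \<open>x ^ 3 / 6\<close> are \<open>1\<close> and \<open>x\<close>.\<close>
  have "(\<integral>x. \<alpha> + \<beta> * x \<partial>M01) = 0" using aff[of "[:0, 0, 1/2:]"] by (simp add: pderiv_pCons)
  moreover have "(\<integral>x. (\<alpha> + \<beta> * x) * x \<partial>M01) = 0" using aff[of "[:0, 0, 0, 1/6:]"] by (simp add: pderiv_pCons)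
  ultimately have "\<alpha> + \<beta> * x = 0" if "x \<in> {0..1}" for x using affine_zero that by blast
  moreover have "AE x in M01. x \<in> {0..1}" by (rule AE_I2) simp
  ultimately have "AE x in M01. \<alpha> + \<beta> * x = 0" by (auto elim: eventually_mono)
  with ab have "AE x in M01. u x = ?K x" by eventually_elim simp
  then show ?strong using m0 m1 by blast
qed

text \<open>The continuously differentiable representative is the double primitive of the second
  derivative \<open>h\<close> plus an affine function. The boundary conditions at 0 annihilate the
  affine part, and those at 1 become the two integral conditions on \<open>h\<close>.\<close>

lemma H20_iff:
  "u \<in> H20 \<longleftrightarrow> u \<in> L2 \<and> (\<exists>h\<in>L2. (\<integral>x. rep_l0 h x \<partial>M01) = 0 \<and> (\<integral>x. prim (rep_l0 h) x \<partial>M01) = 0 \<and>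
     (AE x in M01. rep_l0 u x = prim (prim (rep_l0 h)) x))"
proof
  assume u: "u \<in> H20"
  then obtain h U U' where uL: "u \<in> L2" and h: "h \<in> L2" "has_dist_deriv 2 u h" and C1: "C1_representative u U U'"
    and bc: "U 0 = 0" "U' 0 = 0" "U 1 = 0" "U' 1 = 0"
    by (auto simp: H20_def H2_def)
  have D: "\<And>x. x \<in> {0..1} \<Longrightarrow> (U has_real_derivative U' x) (at x within {0..1})"
    and U'c: "continuous_on {0..1} U'" and uU: "AE x in M01. rep_l0 u x = U x"
    using C1 by (auto simp: C1_representative_def)
  have Uc: "continuous_on {0..1} U" using D by (meson DERIV_continuous_on)
  have hi: "integrable M01 (rep_l0 h)" by (rule L2_integrable[OF h(1)])
  let ?K = "prim (prim (rep_l0 h))"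
  have Kc: "continuous_on {0..1} ?K" by (intro prim_continuous prim_integrable hi)
  have pc: "continuous_on {0..1} (prim (rep_l0 h))" by (intro prim_continuous hi)
  obtain \<alpha> \<beta> where ab: "AE x in M01. x \<in> {0<..<1} \<longrightarrow> U x - ?K x = \<alpha> + \<beta> * x"
  proof (rule du_Bois_Reymond_second_order[of "\<lambda>x. U x - ?K x" 0 1])
    show "integrable M01 (\<lambda>x. U x - ?K x)"
      using M01_continuous_integrable[OF Uc] M01_continuous_integrable[OF Kc] by simp
    fix \<phi> assume \<phi>: "test_on 0 1 \<phi>"
    note d2 = test_on_funpow_deriv[OF \<phi>, of 2]
    have "(\<integral>x. (U x - ?K x) * (deriv ^^ 2) \<phi> x \<partial>M01)
      = (\<integral>x. U x * (deriv ^^ 2) \<phi> x \<partial>M01) - (\<integral>x. ?K x * (deriv ^^ 2) \<phi> x \<partial>M01)"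
      using test_on_integrable_mult[OF d2 M01_continuous_integrable[OF Uc]]
        test_on_integrable_mult[OF d2 M01_continuous_integrable[OF Kc]] by (simp add: left_diff_distrib)
    also have "(\<integral>x. U x * (deriv ^^ 2) \<phi> x \<partial>M01) = (\<integral>x. rep_l0 u x * (deriv ^^ 2) \<phi> x \<partial>M01)"
      using M01_continuous_integrable[OF Uc] test_on_integrable[OF d2]
      by (intro rep_integral_cong[OF uU, symmetric]) auto
    also have "\<dots> = (\<integral>x. rep_l0 h x * \<phi> x \<partial>M01)"
      using h(2) \<phi> unfolding has_dist_deriv_def test_function_iff by simp
    finally show "(\<integral>x. (U x - ?K x) * (deriv ^^ 2) \<phi> x \<partial>M01) = 0"
      using prim2_test_by_parts[OF hi \<phi>] by simp
  qed auto
  have "AE x in M01. x \<in> {0<..<1}" by (rule AE_I2) simp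
  with ab have ae: "AE x in M01. U x - ?K x - (\<alpha> + \<beta> * x) = 0" by eventually_elim simp
  have "continuous_on {0..1} (\<lambda>x. U x - ?K x - (\<alpha> + \<beta> * x))" by (intro continuous_intros Uc Kc)
  from AE_zero_continuous[OF this ae] have eq: "U x = ?K x + (\<alpha> + \<beta> * x)" if "x \<in> {0..1}" for x
    using that by fastforce
  have \<alpha>: "\<alpha> = 0" using eq[of 0] bc by simp
  have U'eq: "U' x = prim (rep_l0 h) x + \<beta>" if x: "x \<in> {0..1}" for x
  proof -
    have "((\<lambda>x. ?K x + (\<alpha> + \<beta> * x)) has_real_derivative prim (rep_l0 h) x + \<beta>) (at x within {0..1})"
      by (auto intro!: derivative_eq_intros prim_DERIV[OF pc x])
    then have "(U has_real_derivative prim (rep_l0 h) x + \<beta>) (at x within {0..1})"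
      by (rule has_field_derivative_transform_within[of _ _ _ _ 1]) (use eq x in auto)
    moreover have "at x within {0..1::real} \<noteq> bot" using x by (simp add: trivial_limit_within)
    ultimately show ?thesis using D[OF x] has_field_derivative_unique by blast
  qed
  have \<beta>: "\<beta> = 0" using U'eq[of 0] bc by simp
  have "(\<integral>x. rep_l0 h x \<partial>M01) = 0" using U'eq[of 1] bc \<beta> by (simp add: prim_1)
  moreover have "(\<integral>x. prim (rep_l0 h) x \<partial>M01) = 0" using eq[of 1] bc \<alpha> \<beta> by (simp add: prim_1)
  moreover have "AE x in M01. rep_l0 u x = ?K x"
  proof -
    have "AE x in M01. x \<in> {0<..<1}" by (rule AE_I2) simp
    with uU show ?thesis by eventually_elim (use eq \<alpha> \<beta> in auto)
  qed
  ultimately show "u \<in> L2 \<and> (\<exists>h\<in>L2. (\<integral>x. rep_l0 h x \<partial>M01) = 0 \<and> (\<integral>x. prim (rep_l0 h) x \<partial>M01) = 0 \<and>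
     (AE x in M01. rep_l0 u x = prim (prim (rep_l0 h)) x))" using uL h by blast
next
  assume "u \<in> L2 \<and> (\<exists>h\<in>L2. (\<integral>x. rep_l0 h x \<partial>M01) = 0 \<and> (\<integral>x. prim (rep_l0 h) x \<partial>M01) = 0 \<and>
     (AE x in M01. rep_l0 u x = prim (prim (rep_l0 h)) x))"
  then obtain h where uL: "u \<in> L2" and h: "h \<in> L2" "(\<integral>x. rep_l0 h x \<partial>M01) = 0" "(\<integral>x. prim (rep_l0 h) x \<partial>M01) = 0"
    and uK: "AE x in M01. rep_l0 u x = prim (prim (rep_l0 h)) x" by blast
  let ?P = "prim (rep_l0 h)" and ?K = "prim (prim (rep_l0 h))"
  have hi: "integrable M01 (rep_l0 h)" by (rule L2_integrable[OF h(1)])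
  have Pc: "continuous_on {0..1} ?P" and Kc: "continuous_on {0..1} ?K"
    by (intro prim_continuous prim_integrable hi)+
  have Pm: "?P \<in> borel_measurable M01" and Km: "?K \<in> borel_measurable M01"
    using M01_continuous_integrable[OF Pc] M01_continuous_integrable[OF Kc] by auto
  have "has_dist_deriv 1 u (abs_l0 ?P)"
    unfolding has_dist_deriv_def test_function_iff
  proof (intro conjI allI impI loc_integrableI L2_integrable uL abs_l0_L2 continuous_square_integrable Pc)
    fix \<phi> assume \<phi>: "test_on 0 1 \<phi>"
    have m: "\<phi> \<in> borel_measurable M01" "deriv \<phi> \<in> borel_measurable M01"
      using test_on_integrable[OF \<phi>] test_on_integrable[OF test_on_deriv[OF \<phi>]] by auto
    show "(\<integral>x. rep_l0 u x * (deriv ^^ 1) \<phi> x \<partial>M01) = (- 1) ^ 1 * (\<integral>x. rep_l0 (abs_l0 ?P) x * \<phi> x \<partial>M01)"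
      using rep_integral_cong[OF uK Km m(2)] rep_integral_cong[OF rep_abs_l0[OF Pm] Pm m(1)]
        prim_test_by_parts[OF prim_integrable[OF hi] \<phi>] by simp
  qed
  moreover have "has_dist_deriv 2 u h"
    unfolding has_dist_deriv_def test_function_iff
  proof (intro conjI allI impI loc_integrableI L2_integrable uL h(1))
    fix \<phi> assume \<phi>: "test_on 0 1 \<phi>"
    have m: "(deriv ^^ 2) \<phi> \<in> borel_measurable M01"
      using test_on_integrable[OF test_on_funpow_deriv[OF \<phi>]] by auto
    show "(\<integral>x. rep_l0 u x * (deriv ^^ 2) \<phi> x \<partial>M01) = (- 1) ^ 2 * (\<integral>x. rep_l0 h x * \<phi> x \<partial>M01)"
      using rep_integral_cong[OF uK Km m] prim2_test_by_parts[OF hi \<phi>] by simp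
  qed
  moreover have "abs_l0 ?P \<in> L2" by (intro abs_l0_L2 continuous_square_integrable Pc)
  ultimately have H2: "u \<in> H2" using uL h(1) unfolding H2_def by blast
  have "C1_representative u ?K ?P"
    unfolding C1_representative_def using prim_DERIV[OF Pc] Pc uK by blast
  moreover have "\<forall>j\<in>{0, 1}. ?K j = 0 \<and> ?P j = 0" using h by (simp add: prim_1)
  ultimately show "u \<in> H20" using H2 unfolding H20_def by blast
qed

section \<open>The degenerate operator\<close>

text \<open>Each constraint equates a continuous functional of the first component with one of the
  second, so it survives componentwise limits. This provides completeness of the form domain, with
  the second derivative carried as a separate component.\<close>

lemma hilbert_constrained_product:
  fixes H1 :: "'a::real_vector set" and H2 :: "'b::real_vector set"
  assumes h1: "hilbert H1 ip1" and h2: "hilbert H2 ip2"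
    and p: "\<And>i. i \<in> I \<Longrightarrow> p i \<in> H1" and q: "\<And>i. i \<in> I \<Longrightarrow> q i \<in> H2"
  shows "hilbert {w \<in> H1 \<times> H2. \<forall>i\<in>I. ip1 (fst w) (p i) = ip2 (snd w) (q i)}
    (\<lambda>w z. ip1 (fst w) (fst z) + ip2 (snd w) (snd z))" (is "hilbert ?V ?ip")
proof -
  interpret A: hilbert H1 ip1 by (rule h1)
  interpret B: hilbert H2 ip2 by (rule h2)
  have sub: "subspace ?V"
    by (rule subspaceI) (use p q in \<open>auto simp: A.ip_simps B.ip_simps zero_prod_def\<close>)
  have mem: "fst w \<in> H1" "snd w \<in> H2" if "w \<in> ?V" for w using that by auto
  show ?thesis
  proof
    show "subspace ?V" by (rule sub)
  next
    fix x y z assume "x \<in> ?V" "y \<in> ?V" "z \<in> ?V"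
    then show "?ip (x + y) z = ?ip x z + ?ip y z"
      using mem[of x] mem[of y] mem[of z] by (simp add: A.ip_simps B.ip_simps)
  next
    fix x y c assume "x \<in> ?V" "y \<in> ?V"
    then show "?ip (c *\<^sub>R x) y = c * ?ip x y"
      using mem[of x] mem[of y] by (simp add: A.ip_simps B.ip_simps distrib_left)
  next
    fix x y assume "x \<in> ?V" "y \<in> ?V"
    then show "?ip x y = ?ip y x"
      using mem[of x] mem[of y] A.ip_sym[of "fst x" "fst y"] B.ip_sym[of "snd x" "snd y"] by simp
  next
    fix x assume x: "x \<in> ?V"
    note m = mem[OF x]
    show "0 \<le> ?ip x x" using A.ip_nonneg[OF m(1)] B.ip_nonneg[OF m(2)] by simp
    assume "?ip x x = 0"
    then have "ip1 (fst x) (fst x) = 0" "ip2 (snd x) (snd x) = 0"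
      using A.ip_nonneg[OF m(1)] B.ip_nonneg[OF m(2)] by linarith+
    then show "x = 0" using A.ip_definite[OF m(1)] B.ip_definite[OF m(2)] by (simp add: prod_eq_iff)
  next
    fix X :: "nat \<Rightarrow> 'a \<times> 'b"
    assume X: "\<And>n. X n \<in> ?V"
      and Cauchy: "\<And>e. 0 < e \<Longrightarrow> \<exists>M. \<forall>m\<ge>M. \<forall>n\<ge>M. ipnorm ?ip (X m - X n) < e"
    have norm_eq: "ipnorm ?ip w = sqrt ((A.N (fst w))\<^sup>2 + (B.N (snd w))\<^sup>2)" if "w \<in> H1 \<times> H2" for w
      using that by (auto simp: ipnorm_def A.ip_nonneg B.ip_nonneg)
    have Xm: "fst (X n) \<in> H1" "snd (X n) \<in> H2" for n using mem[OF X] by auto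
    have dm: "X m - X n \<in> H1 \<times> H2" for m n using Xm by (auto simp: mem_Times_iff)
    have le: "A.N (fst (X m) - fst (X n)) \<le> ipnorm ?ip (X m - X n)"
      "B.N (snd (X m) - snd (X n)) \<le> ipnorm ?ip (X m - X n)" for m n
      unfolding norm_eq[OF dm] by (auto intro!: real_le_rsqrt)
    have CA: "\<exists>M. \<forall>m\<ge>M. \<forall>n\<ge>M. A.N (fst (X m) - fst (X n)) < e"
      and CB: "\<exists>M. \<forall>m\<ge>M. \<forall>n\<ge>M. B.N (snd (X m) - snd (X n)) < e" if e: "0 < e" for e
    proof -
      obtain M where M: "\<forall>m\<ge>M. \<forall>n\<ge>M. ipnorm ?ip (X m - X n) < e" using Cauchy[OF e] by blast
      show "\<exists>M. \<forall>m\<ge>M. \<forall>n\<ge>M. A.N (fst (X m) - fst (X n)) < e"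
        using M by (intro exI[of _ M] allI impI order.strict_trans1[OF le(1)]) blast
      show "\<exists>M. \<forall>m\<ge>M. \<forall>n\<ge>M. B.N (snd (X m) - snd (X n)) < e"
        using M by (intro exI[of _ M] allI impI order.strict_trans1[OF le(2)]) blast
    qed
    obtain l1 where l1: "l1 \<in> H1" "(\<lambda>n. A.N (fst (X n) - l1)) \<longlonglongrightarrow> 0"
      using A.complete_H[of "\<lambda>n. fst (X n)", OF Xm(1) CA] by blast
    obtain l2 where l2: "l2 \<in> H2" "(\<lambda>n. B.N (snd (X n) - l2)) \<longlonglongrightarrow> 0"
      using B.complete_H[of "\<lambda>n. snd (X n)", OF Xm(2) CB] by blast
    have "ip1 l1 (p i) = ip2 l2 (q i)" if i: "i \<in> I" for i
    proof -
      have "(\<lambda>n. ip1 (fst (X n)) (p i)) \<longlonglongrightarrow> ip1 l1 (p i)"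
        by (rule A.ip_tendsto[OF Xm(1) l1(1) p[OF i] l1(2)])
      moreover have "(\<lambda>n. ip2 (snd (X n)) (q i)) \<longlonglongrightarrow> ip2 l2 (q i)"
        by (rule B.ip_tendsto[OF Xm(2) l2(1) q[OF i] l2(2)])
      moreover have "ip1 (fst (X n)) (p i) = ip2 (snd (X n)) (q i)" for n using X[of n] i by auto
      ultimately show ?thesis using LIMSEQ_unique by simp
    qed
    then have l: "(l1, l2) \<in> ?V" using l1 l2 by simp
    have "(\<lambda>n. ipnorm ?ip (X n - (l1, l2))) \<longlonglongrightarrow> 0"
    proof -
      have "X n - (l1, l2) \<in> H1 \<times> H2" for n using Xm l1 l2 by (auto simp: mem_Times_iff)
      then have eq: "ipnorm ?ip (X n - (l1, l2)) = sqrt ((A.N (fst (X n) - l1))\<^sup>2 + (B.N (snd (X n) - l2))\<^sup>2)" for n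
        by (subst norm_eq) auto
      have "(\<lambda>n. sqrt ((A.N (fst (X n) - l1))\<^sup>2 + (B.N (snd (X n) - l2))\<^sup>2)) \<longlonglongrightarrow> sqrt (0\<^sup>2 + 0\<^sup>2)"
        by (intro tendsto_intros l1 l2)
      then show ?thesis unfolding eq by simp
    qed
    then show "\<exists>l\<in>?V. (\<lambda>n. ipnorm ?ip (X n - l)) \<longlonglongrightarrow> 0" using l by blast
  qed
qed

interpretation unweighted: weight "\<lambda>_. 1" 1
  by unfold_locales auto

lemma L2w_unweighted: "L2w (\<lambda>_. 1) = L2"
  by (auto simp: L2w_def L2_def)

lemma hilbert_L2: "hilbert L2 (ipw (\<lambda>_. 1))"
  using unweighted.hilbert_L2w by (simp add: L2w_unweighted)

lemma ipw_unweighted: "ipw (\<lambda>_. 1) u v = (\<integral>x. rep_l0 u x * rep_l0 v x \<partial>M01)"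
  by (simp add: ipw_def)

section \<open>The form domain and the weak resolvent\<close>

locale degenerate_beam = weight +
  assumes a_continuous: "continuous_on {0..1} a"
begin

lemma AE_interior: "AE x in M01. x \<in> {0<..<1}"
  by (rule AE_I2) simp

lemma L2w_imp_L2: "u \<in> L2w a \<Longrightarrow> u \<in> L2"
  by (simp add: L2w_def)

lemma L2w_abs:
  assumes "square_integrable M01 (\<lambda>x. f x / sqrt (a x))" "f \<in> borel_measurable M01"
  shows "abs_l0 f \<in> L2w a"
  unfolding L2w_iff
proof (rule square_integrable_cong_AE[OF assms(1)])
  show "AE x in M01. f x / sqrt (a x) = wrep (abs_l0 f) x"
    using rep_abs_l0[OF assms(2)] by eventually_elim (simp add: wrep_def)
qed (rule wrep_measurable)

lemma ipw_abs:
  assumes f: "f \<in> borel_measurable M01" shows "ipw a u (abs_l0 f) = (\<integral>x. rep_l0 u x * (f x / a x) \<partial>M01)"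
  unfolding ipw_def
proof (rule integral_cong_AE)
  have [measurable]: "rep_l0 w \<in> borel_measurable M01" for w by (rule rep_l0_measurable)
  note f [measurable]
  show "(\<lambda>x. rep_l0 u x * rep_l0 (abs_l0 f) x / a x) \<in> borel_measurable M01" by measurable
  show "(\<lambda>x. rep_l0 u x * (f x / a x)) \<in> borel_measurable M01" by measurable
  show "AE x in M01. rep_l0 u x * rep_l0 (abs_l0 f) x / a x = rep_l0 u x * (f x / a x)"
    using rep_abs_l0[OF f] by eventually_elim simp
qed

text \<open>The factor \<open>a\<close> cancels the weight, so pairing \<open>u\<close> with
  \<open>lift \<phi>\<close> in the weighted space is the unweighted pairing of \<open>u\<close>
  with \<open>\<phi>''\<close>. The weak definition of \<open>u''\<close> thereby becomes a
  constraint of the kind in \<open>hilbert_constrained_product\<close>.\<close>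

definition lift :: "(real \<Rightarrow> real) \<Rightarrow> l0" where
  "lift \<phi> = abs_l0 (\<lambda>x. a x * (deriv ^^ 2) \<phi> x)"

lemma lift_measurable: "smooth \<phi> \<Longrightarrow> (\<lambda>x. a x * (deriv ^^ 2) \<phi> x) \<in> borel_measurable M01"
  using M01_continuous_integrable[OF continuous_on_mult[OF a_continuous smooth_continuous[OF smooth_funpow_deriv, of \<phi> _ 2]]]
  by auto

lemma lift_mem: assumes \<phi>: "smooth \<phi>" shows "lift \<phi> \<in> L2w a"
  unfolding lift_def
proof (rule L2w_abs[OF _ lift_measurable[OF \<phi>]])
  have "continuous_on {0..1} (\<lambda>x. sqrt (a x) * (deriv ^^ 2) \<phi> x)"
    by (intro continuous_intros a_continuous smooth_continuous smooth_funpow_deriv \<phi>)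
  then have "square_integrable M01 (\<lambda>x. sqrt (a x) * (deriv ^^ 2) \<phi> x)" by (rule continuous_square_integrable)
  then show "square_integrable M01 (\<lambda>x. a x * (deriv ^^ 2) \<phi> x / sqrt (a x))"
  proof (rule square_integrable_cong_AE)
    show "AE x in M01. sqrt (a x) * (deriv ^^ 2) \<phi> x = a x * (deriv ^^ 2) \<phi> x / sqrt (a x)"
      using AE_interior
    proof eventually_elim
      case (elim x)
      have "a x * (deriv ^^ 2) \<phi> x / sqrt (a x) = a x / sqrt (a x) * (deriv ^^ 2) \<phi> x" by simp
      also have "a x / sqrt (a x) = sqrt (a x)" using a_pos[OF elim] by (intro real_div_sqrt) simp
      finally show ?case ..
    qed
    show "(\<lambda>x. a x * (deriv ^^ 2) \<phi> x / sqrt (a x)) \<in> borel_measurable M01"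
      using lift_measurable[OF \<phi>] by measurable
  qed
qed

lemma ipw_lift: assumes "smooth \<phi>" shows "ipw a u (lift \<phi>) = (\<integral>x. rep_l0 u x * (deriv ^^ 2) \<phi> x \<partial>M01)"
  unfolding lift_def ipw_abs[OF lift_measurable[OF assms]]
proof (rule Bochner_Integration.integral_cong)
  show "rep_l0 u x * (a x * (deriv ^^ 2) \<phi> x / a x) = rep_l0 u x * (deriv ^^ 2) \<phi> x" if "x \<in> space M01" for x
    using a_pos[of x] that by simp
qed simp

text \<open>The pairs \<open>(u, u'')\<close> with \<open>u\<close> in \<open>H2w a\<close>. Letting
  \<open>\<phi>\<close> range over functions smooth up to the boundary builds in the boundary
  conditions, and the form plus the weighted product becomes the product inner product
  \<open>ipV\<close>.\<close>

definition V :: "(l0 \<times> l0) set" where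
  "V = {w \<in> L2w a \<times> L2. \<forall>\<phi>\<in>Collect smooth. ipw a (fst w) (lift \<phi>) = ipw (\<lambda>_. 1) (snd w) (abs_l0 \<phi>)}"

definition ipV :: "l0 \<times> l0 \<Rightarrow> l0 \<times> l0 \<Rightarrow> real" where
  "ipV w z = ipw a (fst w) (fst z) + ipw (\<lambda>_. 1) (snd w) (snd z)"

lemma hilbert_V: "hilbert V ipV"
  unfolding V_def ipV_def[abs_def]
  by (rule hilbert_constrained_product[OF hilbert_L2w hilbert_L2])
    (auto intro: lift_mem abs_l0_L2 continuous_square_integrable smooth_continuous)

lemma V_weak: "(u, h) \<in> V \<longleftrightarrow> u \<in> L2w a \<and> h \<in> L2 \<and>
  (\<forall>\<phi>. smooth \<phi> \<longrightarrow> (\<integral>x. rep_l0 u x * (deriv ^^ 2) \<phi> x \<partial>M01) = (\<integral>x. rep_l0 h x * \<phi> x \<partial>M01))"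
proof -
  have "ipw (\<lambda>_. 1) h (abs_l0 \<phi>) = (\<integral>x. rep_l0 h x * \<phi> x \<partial>M01)" if "smooth \<phi>" for \<phi>
  proof -
    have m: "\<phi> \<in> borel_measurable M01" using M01_continuous_integrable[OF smooth_continuous[OF that]] by auto
    show ?thesis using rep_integral_cong[OF rep_abs_l0[OF m] m rep_l0_measurable[of h]]
      by (simp add: ipw_unweighted mult.commute)
  qed
  then show ?thesis by (auto simp: V_def ipw_lift)
qed

lemma V_iff: "(u, h) \<in> V \<longleftrightarrow> u \<in> L2w a \<and> h \<in> L2 \<and> (\<integral>x. rep_l0 h x \<partial>M01) = 0 \<and>
  (\<integral>x. prim (rep_l0 h) x \<partial>M01) = 0 \<and> (AE x in M01. rep_l0 u x = prim (prim (rep_l0 h)) x)"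
  unfolding V_weak using weak_H20_iff[OF L2_integrable L2_integrable, of u h] L2w_imp_L2[of u] by auto

lemma H2w_iff_V: "u \<in> H2w a \<longleftrightarrow> (\<exists>h. (u, h) \<in> V)"
  unfolding H2w_def V_iff using H20_iff[of u] L2w_imp_L2[of u] by auto

text \<open>The weak form of \<open>u + A u = f\<close>.\<close>

definition is_resolvent :: "l0 \<Rightarrow> l0 \<Rightarrow> bool" where
  "is_resolvent f u \<longleftrightarrow> (\<exists>h. (u, h) \<in> V \<and> (\<forall>w\<in>V. ipV (u, h) w = ipw a f (fst w)))"

definition R :: "l0 \<Rightarrow> l0" where
  "R f = (SOME u. is_resolvent f u)"

lemma resolvent_exists: assumes f: "f \<in> L2w a" shows "\<exists>u. is_resolvent f u"
proof -
  interpret W: hilbert "L2w a" "ipw a" by (rule hilbert_L2w)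
  interpret U: hilbert L2 "ipw (\<lambda>_. 1)" by (rule hilbert_L2)
  interpret V: hilbert V ipV by (rule hilbert_V)
  have mem: "fst w \<in> L2w a" "snd w \<in> L2" if "w \<in> V" for w using that by (auto simp: V_def)
  obtain p where p: "p \<in> V" "\<And>w. w \<in> V \<Longrightarrow> ipV p w = ipw a f (fst w)"
  proof (rule V.Riesz_subspace[OF V.subspace_H order_refl, of "\<lambda>w. ipw a f (fst w)" "W.N f"])
    show "ipw a f (fst (u + v)) = ipw a f (fst u) + ipw a f (fst v)" if "u \<in> V" "v \<in> V" for u v
      using f mem[OF that(1)] mem[OF that(2)] by (simp add: W.ip_simps)
    show "ipw a f (fst (c *\<^sub>R u)) = c * ipw a f (fst u)" if "u \<in> V" for u c
      using f mem[OF that] by (simp add: W.ip_simps)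
    show "\<bar>ipw a f (fst u)\<bar> \<le> W.N f * V.N u" if "u \<in> V" for u
    proof -
      have "W.N (fst u) \<le> V.N u"
        using U.ip_nonneg[OF mem(2)[OF that]] by (simp add: ipnorm_def ipV_def)
      then have "W.N f * W.N (fst u) \<le> W.N f * V.N u" using W.N_nonneg[OF f] by (rule mult_left_mono)
      then show ?thesis using W.Cauchy_Schwarz[OF f mem(1)[OF that]] by linarith
    qed
  qed blast
  have "is_resolvent f (fst p)"
    unfolding is_resolvent_def using p by (intro exI[of _ "snd p"]) simp
  then show ?thesis by blast
qed

lemma R_is_resolvent: "f \<in> L2w a \<Longrightarrow> is_resolvent f (R f)"
  unfolding R_def by (rule someI_ex[OF resolvent_exists])

lemma resolvent_unique:
  assumes "is_resolvent f u" "is_resolvent f v" shows "u = v"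
proof -
  interpret V: hilbert V ipV by (rule hilbert_V)
  obtain h k where h: "(u, h) \<in> V" "\<And>w. w \<in> V \<Longrightarrow> ipV (u, h) w = ipw a f (fst w)"
    and k: "(v, k) \<in> V" "\<And>w. w \<in> V \<Longrightarrow> ipV (v, k) w = ipw a f (fst w)"
    using assms unfolding is_resolvent_def by blast
  have "(u, h) - (v, k) = 0"
  proof (rule V.ip_definite)
    show "(u, h) - (v, k) \<in> V" using h k V.mem_H(3) by blast
    then show "ipV ((u, h) - (v, k)) ((u, h) - (v, k)) = 0"
      using V.ip_diff_left[OF h(1) k(1)] h(2) k(2) by simp
  qed
  then show ?thesis by (simp add: zero_prod_def)
qed

lemma R_eqI: "f \<in> L2w a \<Longrightarrow> is_resolvent f u \<Longrightarrow> R f = u"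
  using resolvent_unique R_is_resolvent by blast

section \<open>The weak resolvent inverts \<open>1 + A\<close>\<close>

lemma test_pair_V:
  assumes \<phi>: "test_on 0 1 \<phi>" shows "(abs_l0 \<phi>, abs_l0 ((deriv ^^ 2) \<phi>)) \<in> V"
proof -
  note d1 = test_on_deriv[OF \<phi>]
  have d2: "test_on 0 1 (deriv (deriv \<phi>))" by (rule test_on_deriv[OF d1])
  have s: "smooth \<phi>" by (rule test_on_smooth[OF \<phi>])
  have c: "continuous_on {0..1} \<phi>" "continuous_on {0..1} (deriv (deriv \<phi>))"
    by (intro smooth_continuous smooth_deriv s)+
  have m: "\<phi> \<in> borel_measurable M01" "deriv (deriv \<phi>) \<in> borel_measurable M01"
    using M01_continuous_integrable[OF c(1)] M01_continuous_integrable[OF c(2)] by auto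
  let ?h = "abs_l0 (deriv (deriv \<phi>))"
  have ae: "AE x in M01. rep_l0 ?h x = deriv (deriv \<phi>) x" by (rule rep_abs_l0[OF m(2)])
  have prim_ae: "prim (rep_l0 ?h) x = prim (deriv (deriv \<phi>)) x" for x
    unfolding prim_def
  proof (rule integral_cong_AE)
    show "(\<lambda>t. if t \<le> x then rep_l0 ?h t else 0) \<in> borel_measurable M01"
      using prim_integrand[OF L2_integrable[OF abs_l0_L2[OF continuous_square_integrable[OF c(2)]]]] by auto
    show "(\<lambda>t. if t \<le> x then deriv (deriv \<phi>) t else 0) \<in> borel_measurable M01"
      using prim_integrand[OF M01_continuous_integrable[OF c(2)]] by auto
    show "AE t in M01. (if t \<le> x then rep_l0 ?h t else 0) = (if t \<le> x then deriv (deriv \<phi>) t else 0)"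
      using ae by eventually_elim simp
  qed
  have p1: "prim (rep_l0 ?h) x = deriv \<phi> x" if "x \<in> {0..1}" for x
    using prim_test[OF d1 that] by (simp add: prim_ae)
  have p2: "prim (prim (rep_l0 ?h)) x = \<phi> x" if "x \<in> {0..1}" for x
  proof -
    have "prim (prim (rep_l0 ?h)) x = prim (deriv \<phi>) x" by (rule prim_cong) (auto simp: p1)
    then show ?thesis using prim_test[OF \<phi> that] by simp
  qed
  have "abs_l0 \<phi> \<in> L2w a"
  proof (rule L2w_abs[OF _ m(1)])
    \<comment> \<open>The support stays inside the open interval, where \<open>a\<close> is
      positive, so division by \<open>sqrt (a x)\<close> keeps \<open>\<phi>\<close>
      bounded.\<close>
    obtain k l where kl: "0 < k" "k \<le> l" "l < 1" "\<And>x. x \<notin> {k..l} \<Longrightarrow> \<phi> x = 0" using \<phi> by (auto simp: test_on_def)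
    have "sqrt (a x) \<noteq> 0" if "x \<in> {k..l}" for x using a_pos[of x] kl that by simp
    then have ak: "continuous_on {k..l} (\<lambda>x. \<phi> x / sqrt (a x))"
      using kl by (intro continuous_intros smooth_continuous[OF s] continuous_on_subset[OF a_continuous]) auto
    then obtain C where C: "\<forall>x\<in>{k..l}. \<bar>\<phi> x / sqrt (a x)\<bar> \<le> C"
      using compact_imp_bounded[OF compact_continuous_image[OF ak compact_Icc]] by (auto simp: bounded_iff)
    have bound: "\<bar>\<phi> x / sqrt (a x)\<bar> \<le> max C 0" for x
      using C kl(4)[of x] by (cases "x \<in> {k..l}") (auto simp: le_max_iff_disj)
    note m(1) [measurable]
    show "square_integrable M01 (\<lambda>x. \<phi> x / sqrt (a x))"
      unfolding square_integrable_def
    proof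
      show "(\<lambda>x. \<phi> x / sqrt (a x)) \<in> borel_measurable M01" by measurable
      show "integrable M01 (\<lambda>x. (\<phi> x / sqrt (a x))\<^sup>2)"
      proof (rule finite_measure.integrable_const_bound[OF finite_M01])
        show "AE x in M01. norm ((\<phi> x / sqrt (a x))\<^sup>2) \<le> (max C 0)\<^sup>2"
        proof (rule AE_I2)
          fix x
          show "norm ((\<phi> x / sqrt (a x))\<^sup>2) \<le> (max C 0)\<^sup>2"
            using power_mono[OF bound[of x] abs_ge_zero, of 2] unfolding real_norm_def power2_abs abs_power2 .
        qed
        show "(\<lambda>x. (\<phi> x / sqrt (a x))\<^sup>2) \<in> borel_measurable M01" by measurable
      qed
    qed
  qed
  moreover have "?h \<in> L2" by (rule abs_l0_L2[OF continuous_square_integrable[OF c(2)]])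
  moreover have "(\<integral>x. rep_l0 ?h x \<partial>M01) = 0" using p1[of 1] test_on_zero[OF d1, of 1] by (simp add: prim_1)
  moreover have "(\<integral>x. prim (rep_l0 ?h) x \<partial>M01) = 0" using p2[of 1] test_on_zero[OF \<phi>, of 1] by (simp add: prim_1)
  moreover have "AE x in M01. rep_l0 (abs_l0 \<phi>) x = prim (prim (rep_l0 ?h)) x"
    using rep_abs_l0[OF m(1)] AE_interior by eventually_elim (simp add: p2)
  ultimately show ?thesis unfolding V_iff by (simp add: numeral_2_eq_2)
qed

text \<open>On compact subsets of the open interval \<open>1 / a\<close> is continuous, hence
  bounded.\<close>

lemma loc_integrable_div_a:
  assumes w: "w \<in> L2" shows "loc_integrable (abs_l0 (\<lambda>x. rep_l0 w x / a x))"
proof -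
  have [measurable]: "rep_l0 w \<in> borel_measurable M01" by (rule rep_l0_measurable)
  let ?g = "\<lambda>x. rep_l0 w x / a x"
  have gm: "?g \<in> borel_measurable M01" by measurable
  show ?thesis
    unfolding loc_integrable_iff
  proof (intro allI impI)
    fix K :: "real set" assume K: "compact K \<and> K \<subseteq> {0<..<1}"
    have "continuous_on K (\<lambda>x. 1 / a x)"
      using K by (intro continuous_intros continuous_on_subset[OF a_continuous]) (auto, use a_pos in force)
    then obtain C where C: "\<forall>x\<in>K. \<bar>1 / a x\<bar> \<le> C"
      using compact_imp_bounded[OF compact_continuous_image[of K "\<lambda>x. 1 / a x"]] K by (auto simp: bounded_iff)
    have Kb: "{t. t \<in> K} \<in> sets borel" using K by (simp add: borel_compact)
    have i: "integrable M01 (\<lambda>t. if t \<in> K then ?g t else 0)"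
    proof (rule Bochner_Integration.integrable_bound)
      show "integrable M01 (\<lambda>x. C * rep_l0 w x)" using L2_integrable[OF w] by simp
      have "(\<lambda>t. ?g t * indicator K t) \<in> borel_measurable M01"
        using Kb by (intro borel_measurable_times[OF gm M01_borel_measurable]) simp
      also have "(\<lambda>t. ?g t * indicator K t) = (\<lambda>t. if t \<in> K then ?g t else 0)" by (auto simp: indicator_def)
      finally show "(\<lambda>t. if t \<in> K then ?g t else 0) \<in> borel_measurable M01" .
      show "AE x in M01. norm (if x \<in> K then ?g x else 0) \<le> norm (C * rep_l0 w x)"
      proof (rule AE_I2)
        fix x
        have "\<bar>rep_l0 w x\<bar> * \<bar>1 / a x\<bar> \<le> \<bar>rep_l0 w x\<bar> * \<bar>C\<bar>" if "x \<in> K"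
          using C that by (intro mult_left_mono) (auto intro: order_trans[OF _ abs_ge_self])
        then show "norm (if x \<in> K then ?g x else 0) \<le> norm (C * rep_l0 w x)"
          by (auto simp: abs_mult mult.commute)
      qed
    qed
    have ae: "AE t in M01. (if t \<in> K then ?g t else 0) = (if t \<in> K then rep_l0 (abs_l0 ?g) t else 0)"
      using rep_abs_l0[OF gm] by eventually_elim simp
    have "(\<lambda>t. rep_l0 (abs_l0 ?g) t * indicator K t) \<in> borel_measurable M01"
      using Kb by (intro borel_measurable_times[OF rep_l0_measurable M01_borel_measurable]) simp
    also have "(\<lambda>t. rep_l0 (abs_l0 ?g) t * indicator K t) = (\<lambda>t. if t \<in> K then rep_l0 (abs_l0 ?g) t else 0)"
      by (auto simp: indicator_def)
    finally show "integrable M01 (\<lambda>t. if t \<in> K then rep_l0 (abs_l0 ?g) t else 0)"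
      using i integrable_cong_AE[OF _ _ ae] by auto
  qed
qed

text \<open>Testing the weak equation with the pairs \<open>(\<phi>, \<phi>'')\<close> of test
  functions identifies the distribution \<open>u''''\<close> with \<open>(f - u) / a\<close>, which
  is locally integrable.\<close>

lemma domA_R: assumes f: "f \<in> L2w a" shows "R f \<in> domA a" "opA a (R f) = f - R f"
proof -
  interpret W: hilbert "L2w a" "ipw a" by (rule hilbert_L2w)
  define u where "u = R f"
  obtain h where h: "(u, h) \<in> V" "\<And>w. w \<in> V \<Longrightarrow> ipV (u, h) w = ipw a f (fst w)"
    using R_is_resolvent[OF f] unfolding is_resolvent_def u_def by blast
  have u: "u \<in> L2w a" "h \<in> L2" using h(1) by (auto simp: V_iff)
  define w where "w = f - u"
  have w: "w \<in> L2w a" unfolding w_def using f u by simp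
  have [measurable]: "rep_l0 v \<in> borel_measurable M01" for v by (rule rep_l0_measurable)
  let ?g = "\<lambda>x. rep_l0 w x / a x"
  have gm: "?g \<in> borel_measurable M01" by measurable
  define g where "g = abs_l0 ?g"
  have g: "AE x in M01. rep_l0 g x = rep_l0 w x / a x" unfolding g_def by (rule rep_abs_l0[OF gm])
  have dist: "has_dist_deriv 4 u g"
    unfolding has_dist_deriv_def test_function_iff
  proof (intro conjI allI impI)
    show "loc_integrable u" by (rule loc_integrableI[OF L2_integrable[OF L2w_imp_L2[OF u(1)]]])
    show "loc_integrable g" unfolding g_def by (rule loc_integrable_div_a[OF L2w_imp_L2[OF w]])
    fix \<phi> assume \<phi>: "test_on 0 1 \<phi>"
    have \<phi>m: "\<phi> \<in> borel_measurable M01" using test_on_integrable[OF \<phi>] by auto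
    note d2 = test_on_funpow_deriv[OF \<phi>, of 2]
    have "(deriv ^^ 4) \<phi> = (deriv ^^ 2) ((deriv ^^ 2) \<phi>)" by (simp add: eval_nat_numeral)
    then have "(\<integral>x. rep_l0 u x * (deriv ^^ 4) \<phi> x \<partial>M01) = (\<integral>x. rep_l0 h x * (deriv ^^ 2) \<phi> x \<partial>M01)"
      using h(1) test_on_smooth[OF d2] unfolding V_weak by simp
    also have "\<dots> = ipw (\<lambda>_. 1) h (abs_l0 ((deriv ^^ 2) \<phi>))"
    proof -
      have m: "(deriv ^^ 2) \<phi> \<in> borel_measurable M01" using test_on_integrable[OF d2] by auto
      show ?thesis using rep_integral_cong[OF rep_abs_l0[OF m] m rep_l0_measurable[of h]]
        by (simp add: ipw_unweighted mult.commute)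
    qed
    also have "\<dots> = ipw a w (abs_l0 \<phi>)"
    proof -
      have V: "(abs_l0 \<phi>, abs_l0 ((deriv ^^ 2) \<phi>)) \<in> V" by (rule test_pair_V[OF \<phi>])
      then have "abs_l0 \<phi> \<in> L2w a" by (simp add: V_weak)
      then show ?thesis using h(2)[OF V] f u unfolding w_def by (simp add: ipV_def W.ip_simps)
    qed
    also have "\<dots> = (\<integral>x. rep_l0 w x / a x * \<phi> x \<partial>M01)" unfolding ipw_abs[OF \<phi>m] by simp
    also have "\<dots> = (\<integral>x. rep_l0 g x * \<phi> x \<partial>M01)" by (rule rep_integral_cong[OF g gm \<phi>m, symmetric])
    finally show "(\<integral>x. rep_l0 u x * (deriv ^^ 4) \<phi> x \<partial>M01) = (- 1) ^ 4 * (\<integral>x. rep_l0 g x * \<phi> x \<partial>M01)" by simp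
  qed
  have ag: "l0_mult a g = w"
  proof (rule l0_eqI)
    have "AE x in M01. rep_l0 (l0_mult a g) x = a x * rep_l0 g x"
      unfolding l0_mult_def by (rule rep_abs_l0) measurable
    then show "AE x in M01. rep_l0 (l0_mult a g) x = rep_l0 w x"
      using g AE_interior
    proof eventually_elim
      case (elim x)
      then show ?case using a_pos[of x] by simp
    qed
  qed
  show "R f \<in> domA a"
    using h(1) dist ag w unfolding domA_def u_def[symmetric] by (auto simp: H2w_iff_V)
  show "opA a (R f) = f - R f"
    using ag dist_deriv_eq[OF dist] by (simp add: opA_def u_def w_def)
qed

text \<open>This shows that the maximal domain is no larger than the range of \<open>R\<close>.
  Green's formula extends the equation from test functions to all of \<open>V\<close>, so
  \<open>u\<close> solves the weak problem with right-hand side \<open>u + A u\<close>, and such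
  solutions are unique.\<close>

lemma domA_imp_R:
  assumes u: "u \<in> domA a" shows "opA a u \<in> L2w a" "u = R (u + opA a u)"
proof -
  interpret W: hilbert "L2w a" "ipw a" by (rule hilbert_L2w)
  obtain h g where h: "(u, h) \<in> V" and g: "has_dist_deriv 4 u g" and ag: "l0_mult a g \<in> L2w a"
    using u by (auto simp: domA_def H2w_iff_V)
  have A: "opA a u = l0_mult a g" unfolding opA_def dist_deriv_eq[OF g] ..
  show m: "opA a u \<in> L2w a" using ag A by simp
  have uL: "u \<in> L2w a" "h \<in> L2" using h by (auto simp: V_weak)
  have [measurable]: "rep_l0 v \<in> borel_measurable M01" for v by (rule rep_l0_measurable)
  have rep: "AE x in M01. rep_l0 (opA a u) x / a x = rep_l0 g x"
  proof -
    have "AE x in M01. rep_l0 (l0_mult a g) x = a x * rep_l0 g x"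
      unfolding l0_mult_def by (rule rep_abs_l0) measurable
    then show ?thesis using AE_interior
    proof eventually_elim
      case (elim x)
      then show ?case using a_pos[of x] by (simp add: A)
    qed
  qed
  have "is_resolvent (u + opA a u) u"
    unfolding is_resolvent_def
  proof (intro exI[of _ h] conjI h ballI)
    fix w assume "w \<in> V"
    then obtain v k where w: "w = (v, k)" "(v, k) \<in> V" by (cases w) auto
    have v: "v \<in> L2w a" "k \<in> L2" "(\<integral>x. rep_l0 k x \<partial>M01) = 0" "(\<integral>x. prim (rep_l0 k) x \<partial>M01) = 0"
      "AE x in M01. rep_l0 v x = prim (prim (rep_l0 k)) x" using w(2) by (auto simp: V_iff)
    have Km: "prim (prim (rep_l0 k)) \<in> borel_measurable M01"
      using prim_integrable[OF prim_integrable[OF L2_integrable[OF v(2)]]] by auto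
    note Km [measurable]
    have ae: "AE x in M01. rep_l0 (opA a u) x * rep_l0 v x / a x = rep_l0 g x * prim (prim (rep_l0 k)) x"
      using rep v(5)
    proof eventually_elim
      case (elim x)
      then show ?case by (metis times_divide_eq_left)
    qed
    \<comment> \<open>Though \<open>u''''\<close> alone is only locally integrable,
      \<open>u'''' v = (a u'''') v / a\<close> is a product of two members of the weighted space;
      this supplies the majorant for Green's formula.\<close>
    have int: "integrable M01 (\<lambda>x. rep_l0 (opA a u) x * rep_l0 v x / a x)"
    proof -
      have "integrable M01 (\<lambda>x. wrep (opA a u) x * wrep v x)" by (rule L2w_integrable[OF m v(1)])
      then show ?thesis
        by (subst Bochner_Integration.integrable_cong[OF refl, symmetric]) (auto simp: wrep_mult)
    qed
    have "ipw (\<lambda>_. 1) h k = (\<integral>x. rep_l0 h x * rep_l0 k x \<partial>M01)" by (rule ipw_unweighted)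
    also have "\<dots> = (\<integral>x. rep_l0 g x * prim (prim (rep_l0 k)) x \<partial>M01)"
    proof (rule Green_formula)
      show "square_integrable M01 (rep_l0 h)" "square_integrable M01 (rep_l0 k)" using uL v by (auto simp: L2_iff)
      show "integrable M01 (\<lambda>t. if c \<le> t \<and> t \<le> d then rep_l0 g t else 0)" if "0 < c" "d < 1" for c d
        using g that by (intro loc_integrable_Icc) (auto simp: has_dist_deriv_def)
      show "integrable M01 (\<lambda>x. rep_l0 g x * prim (prim (rep_l0 k)) x)"
        using int integrable_cong_AE[OF _ _ ae] by auto
      fix \<phi> assume \<phi>: "test_on 0 1 \<phi>"
      have "(deriv ^^ 4) \<phi> = (deriv ^^ 2) ((deriv ^^ 2) \<phi>)" by (simp add: eval_nat_numeral)
      then have "(\<integral>x. rep_l0 h x * (deriv ^^ 2) \<phi> x \<partial>M01) = (\<integral>x. rep_l0 u x * (deriv ^^ 4) \<phi> x \<partial>M01)"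
        using h test_on_smooth[OF test_on_funpow_deriv[OF \<phi>, of 2]] unfolding V_weak by simp
      also have "\<dots> = (\<integral>x. rep_l0 g x * \<phi> x \<partial>M01)"
        using g \<phi> unfolding has_dist_deriv_def test_function_iff by simp
      finally show "(\<integral>x. rep_l0 h x * (deriv ^^ 2) \<phi> x \<partial>M01) = (\<integral>x. rep_l0 g x * \<phi> x \<partial>M01)" .
    qed (use v in auto)
    also have "\<dots> = ipw a (opA a u) v"
      unfolding ipw_def by (rule integral_cong_AE[OF _ _ ae, symmetric]) measurable
    finally show "ipV (u, h) w = ipw a (u + opA a u) (fst w)"
      using uL m v by (simp add: w ipV_def W.ip_simps)
  qed
  then show "u = R (u + opA a u)" using R_eqI uL m by (metis W.mem_H(2))
qed

lemma selfadjoint_resolvent_R: "selfadjoint_resolvent (L2w a) (ipw a) R (opA a) (domA a)"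
proof -
  interpret W: hilbert "L2w a" "ipw a" by (rule hilbert_L2w)
  interpret U: hilbert L2 "ipw (\<lambda>_. 1)" by (rule hilbert_L2)
  interpret V: hilbert V ipV by (rule hilbert_V)
  have mem: "fst w \<in> L2w a" "snd w \<in> L2" if "w \<in> V" for w using that by (auto simp: V_def)
  have R_mem: "R f \<in> L2w a" if f: "f \<in> L2w a" for f
    using R_is_resolvent[OF f] mem unfolding is_resolvent_def by fastforce
  show ?thesis
  proof
    show "R f \<in> L2w a" if "f \<in> L2w a" for f by (rule R_mem[OF that])
  next
    fix f g assume f: "f \<in> L2w a" and g: "g \<in> L2w a"
    obtain h where h: "(R f, h) \<in> V" "\<And>w. w \<in> V \<Longrightarrow> ipV (R f, h) w = ipw a f (fst w)"
      using R_is_resolvent[OF f] unfolding is_resolvent_def by blast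
    obtain k where k: "(R g, k) \<in> V" "\<And>w. w \<in> V \<Longrightarrow> ipV (R g, k) w = ipw a g (fst w)"
      using R_is_resolvent[OF g] unfolding is_resolvent_def by blast
    show "R (f + g) = R f + R g"
    proof (rule R_eqI)
      show "f + g \<in> L2w a" using f g by simp
      show "is_resolvent (f + g) (R f + R g)"
        unfolding is_resolvent_def
      proof (intro exI[of _ "h + k"] conjI ballI)
        have eq: "(R f + R g, h + k) = (R f, h) + (R g, k)" by simp
        show "(R f + R g, h + k) \<in> V" unfolding eq by (rule V.mem_H(2)[OF h(1) k(1)])
        fix w assume w: "w \<in> V"
        show "ipV (R f + R g, h + k) w = ipw a (f + g) (fst w)"
          unfolding eq using V.ip_add_left[OF h(1) k(1) w] h(2)[OF w] k(2)[OF w] W.ip_add_left[OF f g mem(1)[OF w]]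
          by simp
      qed
    qed
    have "ipw a (R f) g = ipw a g (R f)" using R_mem[OF f] g by (rule W.ip_sym)
    also have "\<dots> = ipV (R g, k) (R f, h)" using k(2)[OF h(1)] by simp
    also have "\<dots> = ipV (R f, h) (R g, k)" by (rule V.ip_sym[OF k(1) h(1)])
    also have "\<dots> = ipw a f (R g)" using h(2)[OF k(1)] by simp
    finally show "ipw a (R f) g = ipw a f (R g)" .
  next
    fix f c assume f: "f \<in> L2w a"
    obtain h where h: "(R f, h) \<in> V" "\<And>w. w \<in> V \<Longrightarrow> ipV (R f, h) w = ipw a f (fst w)"
      using R_is_resolvent[OF f] unfolding is_resolvent_def by blast
    show "R (c *\<^sub>R f) = c *\<^sub>R R f"
    proof (rule R_eqI)
      show "c *\<^sub>R f \<in> L2w a" using f by simp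
      show "is_resolvent (c *\<^sub>R f) (c *\<^sub>R R f)"
        unfolding is_resolvent_def
      proof (intro exI[of _ "c *\<^sub>R h"] conjI ballI)
        have eq: "(c *\<^sub>R R f, c *\<^sub>R h) = c *\<^sub>R (R f, h)" by simp
        show "(c *\<^sub>R R f, c *\<^sub>R h) \<in> V" unfolding eq by (rule V.mem_H(4)[OF h(1)])
        fix w assume w: "w \<in> V"
        show "ipV (c *\<^sub>R R f, c *\<^sub>R h) w = ipw a (c *\<^sub>R f) (fst w)"
          unfolding eq using V.ip_scale_left[OF h(1) w] h(2)[OF w] W.ip_scale_left[OF f mem(1)[OF w]] by simp
      qed
    qed
    \<comment> \<open>The omitted term is the value \<open>\<integral> h\<^sup>2\<close> of the
      form.\<close>
    have "ipw a (R f) (R f) \<le> ipV (R f, h) (R f, h)"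
      using U.ip_nonneg[OF mem(2)[OF h(1)]] by (simp add: ipV_def)
    also have "\<dots> = ipw a f (R f)" using h(2)[OF h(1)] by simp
    also have "\<dots> = ipw a (R f) f" by (rule W.ip_sym[OF f R_mem[OF f]])
    finally show "ipw a (R f) (R f) \<le> ipw a (R f) f" .
  next
    show "domA a = R ` L2w a"
    proof (intro equalityI subsetI)
      fix u assume u: "u \<in> domA a"
      then have "u \<in> L2w a" by (simp add: domA_def H2w_def)
      then have "u + opA a u \<in> L2w a" using domA_imp_R(1)[OF u] by simp
      then show "u \<in> R ` L2w a" using domA_imp_R(2)[OF u] by (metis imageI)
    qed (use domA_R(1) in auto)
    show "opA a (R f) = f - R f" if "f \<in> L2w a" for f by (rule domA_R(2)[OF that])
  qed
qed

end

theorem theorem2p1: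
  fixes a :: "real \<Rightarrow> real" and x0 :: real
  assumes "continuous_on {0..1} a"
    and "\<forall>x\<in>{0..1}. 0 \<le> a x"
    and "x0 \<in> {0, 1}"
    and "a x0 = 0"
    and "\<forall>x\<in>{0..1} - {x0}. 0 < a x"
  shows "self_adjoint_op (L2w a) (ipw a) (domA a) (opA a) \<and>
         nonneg_op (ipw a) (domA a) (opA a) \<and>
         generates_contractive_analytic_semigroup (L2w a) (ipw a) (domA a) (\<lambda>u. - opA a u) (pi / 2)"
proof -
  obtain B where B: "\<forall>x\<in>{0..1}. \<bar>a x\<bar> \<le> B"
    using compact_imp_bounded[OF compact_continuous_image[OF assms(1) compact_Icc]] by (auto simp: bounded_iff)
  have "degenerate_beam a B"
  proof
    show "a \<in> borel_measurable M01" using M01_continuous_integrable[OF assms(1)] by auto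
    show "0 < a x" if "x \<in> {0<..<1}" for x using assms(3,5) that by auto
    show "a x \<le> B" if "x \<in> {0<..<1}" for x using B[rule_format, of x] that by simp
    show "continuous_on {0..1} a" by (rule assms(1))
  qed
  then interpret degenerate_beam a B .
  interpret selfadjoint_resolvent "L2w a" "ipw a" R "opA a" "domA a" by (rule selfadjoint_resolvent_R)
  show ?thesis using self_adjoint nonneg generates by blast
qed

end
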